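(* Let $d\ge2$, $\lambda>0$ and $\mu\ge-\frac12$. Let $\mathbb L_n$ and $\tilde{\mathbb L}_n$ be the reproducing kernels of the space $\Pi_n^d$ of polynomials of total degree at most $n$ in $d$ variables with respect to $\langle\cdot,\cdot\rangle_\mu$ and $\langle\cdot,\cdot\rangle_\mu^S$ respectively (defined in the context). Then for $\|x\|=1$, $$\lim_{n\to\infty}\frac{\mathbb L_n(x,x)-\tilde{\mathbb L}_n(x,x)}{n^{2\mu+d+1}}=\frac{2}{\Gamma(2\mu+d+2)}\,\frac{(\mu+1)(\mu+3)}{(\mu+2)^2}.$$ Moreover, $$\lim_{n\to\infty}\frac{\tilde{\mathbb L}_n(x,x)}{n^{2\mu+d+1}}=\frac{2}{\Gamma(2\mu+d+2)\,(\mu+2)^2}.$$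
   Context: $\mathbb B^d$ is the closed unit ball of $\mathbb R^d$, $\mathbb S^{d-1}$ the unit sphere with surface measure $d\sigma$ and total area $\sigma_d=2\pi^{d/2}/\Gamma(d/2)$; $W_\mu(x)=(1-\|x\|^2)^\mu$, $\omega_\mu=\int_{\mathbb B^d}W_\mu\,dx=\pi^{d/2}\Gamma(\mu+1)/\Gamma(\mu+d/2+1)$. The inner products are $$\langle f,g\rangle_\mu=\frac1{\omega_\mu}\int_{\mathbb B^d}fg\,W_\mu\,dx,\qquad \langle f,g\rangle_\mu^S=\langle f,g\rangle_\mu+\frac\lambda{\sigma_d}\int_{\mathbb S^{d-1}}\frac{\partial f}{\partial\mathbf n}\frac{\partial g}{\partial\mathbf n}\,d\sigma,$$ where $\frac{\partial f}{\partial\mathbf n}=\sum_{i=1}^dx_i\frac{\partial f}{\partial x_i}$ on $\mathbb S^{d-1}$. If $\{p_i\}$ is any mutually orthogonal basis of $\Pi_n^d$ for one of these inner products, the corresponding kernel is $\sum_ip_i(x)p_i(y)/\langle p_i,p_i\rangle$ (independent of the choice of basis); this gives $\mathbb L_n(x,y)$ for $\langle\cdot,\cdot\rangle_\mu$ and $\tilde{\mathbb L}_n(x,y)$ for $\langle\cdot,\cdot\rangle_\mu^S$. *)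

theory Defs
  imports "HOL-Analysis.Analysis" "HOL-Library.Function_Algebras"
begin

text \<open>Real-valued functions as a real vector space; addition and zero are pointwise
  (\<^theory>\<open>HOL-Library.Function_Algebras\<close>).\<close>

interpretation fn: vector_space "\<lambda>(c::real) (f::'a \<Rightarrow> real) x. c * f x"
  by unfold_locales (auto simp: fun_eq_iff algebra_simps)

text \<open>Polynomials in d real variables are represented by the functions they induce on
  \<open>\<real>\<^sup>d\<close> (faithful, since the field is infinite).\<close>

definition monomial_fun :: "('d::finite \<Rightarrow> nat) \<Rightarrow> real^'d \<Rightarrow> real" where
  "monomial_fun \<alpha> x = (\<Prod>i\<in>UNIV. (x $ i) ^ \<alpha> i)"

definition poly_space :: "nat \<Rightarrow> (real^'d::finite \<Rightarrow> real) set" where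
  "poly_space n = fn.span {monomial_fun \<alpha> | \<alpha>. (\<Sum>i\<in>UNIV. \<alpha> i) \<le> n}"

definition ball_weight :: "real \<Rightarrow> real^'d::finite \<Rightarrow> real" where
  "ball_weight \<mu> x = (1 - (norm x)\<^sup>2) powr \<mu>"

definition ball_mass :: "'d::finite itself \<Rightarrow> real \<Rightarrow> real" where
  "ball_mass _ \<mu> = (LINT x:cball 0 1|lborel. ball_weight \<mu> (x :: real^'d))"

definition inner_ball ::
  "real \<Rightarrow> (real^'d::finite \<Rightarrow> real) \<Rightarrow> (real^'d \<Rightarrow> real) \<Rightarrow> real" where
  "inner_ball \<mu> f g =
     (LINT x:cball 0 1|lborel. f x * g x * ball_weight \<mu> x) / ball_mass TYPE('d) \<mu>"

text \<open>Surface measure of the unit sphere, as a measure on the Borel sets of the sphere: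
  the measure of \<open>A\<close> is d times the volume of the cone \<open>{r u | 0 < r \<le> 1, u \<in> A}\<close>, i.e. the
  measure for which integration in polar coordinates has density \<open>r\<^bsup>d-1\<^esup> dr d\<sigma>\<close>. It is
  the image of Lebesgue measure on the punctured ball under \<open>sgn x = x / \<parallel>x\<parallel>\<close>, times d.
  The lemmas below check the cone formula and the total area.\<close>

definition sphere_measure :: "(real^'d::finite) measure" where
  "sphere_measure = scale_measure (ennreal (real CARD('d)))
     (distr (restrict_space lborel (cball 0 1 - {0})) (restrict_space borel (sphere 0 1)) sgn)"

definition sphere_area :: "'d::finite itself \<Rightarrow> real" where
  "sphere_area _ = 2 * pi powr (real CARD('d) / 2) / Gamma (real CARD('d) / 2)"

definition partial_deriv :: "'d::finite \<Rightarrow> (real^'d \<Rightarrow> real) \<Rightarrow> real^'d \<Rightarrow> real" where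
  "partial_deriv i f x = deriv (\<lambda>t. f (x + t *\<^sub>R axis i 1)) 0"

definition normal_deriv :: "(real^'d::finite \<Rightarrow> real) \<Rightarrow> real^'d \<Rightarrow> real" where
  "normal_deriv f x = (\<Sum>i\<in>UNIV. x $ i * partial_deriv i f x)"

definition inner_sobolev ::
  "real \<Rightarrow> real \<Rightarrow> (real^'d::finite \<Rightarrow> real) \<Rightarrow> (real^'d \<Rightarrow> real) \<Rightarrow> real" where
  "inner_sobolev lam \<mu> f g = inner_ball \<mu> f g +
     lam / sphere_area TYPE('d) * (LINT x|sphere_measure. normal_deriv f x * normal_deriv g x)"

definition orthogonal_basis ::
  "(('a \<Rightarrow> real) \<Rightarrow> ('a \<Rightarrow> real) \<Rightarrow> real) \<Rightarrow> ('a \<Rightarrow> real) set \<Rightarrow> ('a \<Rightarrow> real) set \<Rightarrow> bool" where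
  "orthogonal_basis ip V B \<longleftrightarrow>
     fn.independent B \<and> fn.span B = V \<and> pairwise (\<lambda>p q. ip p q = 0) B"

text \<open>The common value over all mutually orthogonal bases (unspecified unless such a basis
  exists and the value does not depend on it).\<close>

definition repr_kernel ::
  "(('a \<Rightarrow> real) \<Rightarrow> ('a \<Rightarrow> real) \<Rightarrow> real) \<Rightarrow> ('a \<Rightarrow> real) set \<Rightarrow> 'a \<Rightarrow> 'a \<Rightarrow> real" where
  "repr_kernel ip V x y =
     (THE k. \<exists>B. orthogonal_basis ip V B \<and> k = (\<Sum>p\<in>B. p x * p y / ip p p))"

definition ball_kernel :: "real \<Rightarrow> nat \<Rightarrow> real^'d::finite \<Rightarrow> real^'d \<Rightarrow> real" where
  "ball_kernel \<mu> n = repr_kernel (inner_ball \<mu>) (poly_space n)"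

definition sobolev_kernel :: "real \<Rightarrow> real \<Rightarrow> nat \<Rightarrow> real^'d::finite \<Rightarrow> real^'d \<Rightarrow> real" where
  "sobolev_kernel lam \<mu> n = repr_kernel (inner_sobolev lam \<mu>) (poly_space n)"

lemma sgn_measurable_sphere:
  "sgn \<in> measurable (restrict_space lborel (cball 0 1 - {0 :: real^'d::finite}))
     (restrict_space borel (sphere 0 1))"
proof (rule measurable_restrict_space2)
  have "(sgn :: real^'d \<Rightarrow> _) \<in> borel_measurable borel"
    unfolding sgn_div_norm[abs_def] by measurable
  then show "sgn \<in> measurable (restrict_space lborel (cball 0 1 - {0 :: real^'d})) borel"
    by (intro measurable_restrict_space1) simp
qed (auto simp: space_restrict_space norm_sgn)

lemma emeasure_sphere_measure:
  fixes A :: "(real^'d::finite) set"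
  assumes A: "A \<in> sets borel" "A \<subseteq> sphere 0 1"
  shows "emeasure sphere_measure A =
    ennreal (real CARD('d)) * emeasure lborel {r *\<^sub>R u |r u. 0 < r \<and> r \<le> 1 \<and> u \<in> A}"
proof -
  have A': "A \<in> sets (restrict_space borel (sphere 0 1))"
    using A by (auto simp: sets_restrict_space)
  have eq: "sgn -` A \<inter> (cball 0 1 - {0}) = {r *\<^sub>R u |r u. 0 < r \<and> r \<le> 1 \<and> u \<in> A}"
    (is "?L = ?R")
  proof (intro set_eqI iffI)
    fix x assume "x \<in> ?L"
    then have "0 < norm x \<and> norm x \<le> 1 \<and> sgn x \<in> A \<and> x = norm x *\<^sub>R sgn x"
      by (auto simp: sgn_div_norm)
    then show "x \<in> ?R" by blast
  next
    fix x assume "x \<in> ?R"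
    then obtain r u where *: "x = r *\<^sub>R u" "0 < r" "r \<le> 1" "u \<in> A" by blast
    then have "norm u = 1" using A by auto
    with * show "x \<in> ?L" by (auto simp: sgn_div_norm)
  qed
  have "emeasure (distr (restrict_space lborel (cball 0 1 - {0})) (restrict_space borel (sphere 0 1)) sgn) A
     = emeasure (restrict_space lborel (cball 0 1 - {0})) (sgn -` A \<inter> (cball 0 1 - {0}))"
    by (subst emeasure_distr[OF sgn_measurable_sphere A']) (simp add: space_restrict_space)
  also have "\<dots> = emeasure lborel (sgn -` A \<inter> (cball 0 1 - {0}))"
    by (rule emeasure_restrict_space) auto
  finally show ?thesis by (simp add: sphere_measure_def eq)
qed

lemma emeasure_sphere_measure_space:
  "emeasure sphere_measure (sphere 0 1 :: (real^'d::finite) set) = ennreal (sphere_area TYPE('d))"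
proof -
  have "{r *\<^sub>R u |r u. 0 < r \<and> r \<le> 1 \<and> u \<in> sphere 0 (1::real)} = cball 0 1 - {0 :: real^'d}"
    (is "?L = ?R")
  proof (intro set_eqI iffI)
    fix x assume "x \<in> ?R"
    then have "0 < norm x \<and> norm x \<le> 1 \<and> sgn x \<in> sphere 0 1 \<and> x = norm x *\<^sub>R sgn x"
      by (auto simp: norm_sgn) (simp add: sgn_div_norm)
    then show "x \<in> ?L" by blast
  qed auto
  moreover have "emeasure lborel (cball 0 1 - {0 :: real^'d}) = emeasure lborel (cball 0 1 :: (real^'d) set)"
    by (rule emeasure_Diff_null_set) auto
  moreover have "real CARD('d) * unit_ball_vol (real CARD('d)) = sphere_area TYPE('d)"
  proof -
    have "Gamma (real CARD('d) / 2 + 1) = real CARD('d) / 2 * Gamma (real CARD('d) / 2)"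
    proof (rule Gamma_plus1[of "real CARD('d) / 2"])
      have "real CARD('d) / 2 > 0" by simp
      then show "real CARD('d) / 2 \<notin> \<int>\<^sub>\<le>\<^sub>0" by (meson nonpos_Ints_nonpos not_le)
    qed
    moreover have "Gamma (real CARD('d) / 2) > 0" by (intro Gamma_real_pos) auto
    ultimately show ?thesis
      by (simp add: unit_ball_vol_def sphere_area_def divide_simps) force
  qed
  ultimately show ?thesis
    by (subst emeasure_sphere_measure)
       (auto simp: emeasure_cball ennreal_mult[symmetric])
qed

end

theory Submission
  imports Defs "HOL-Computational_Algebra.Polynomial" "HOL-Real_Asymp.Real_Asymp"
begin

text \<open>Restricting polynomials to the sphere and splitting off \<open>\<parallel>y\<parallel>\<^sup>2\<close> gives \<open>\<Pi>\<^sub>n\<close> as the sum of the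
  spaces of \<open>q (1 - \<parallel>y\<parallel>\<^sup>2) Y(y)\<close> with \<open>Y\<close> a spherical harmonic of degree \<open>k\<close> and
  \<open>deg q \<le> m = (n - k) div 2\<close>. They are orthogonal for both inner products. On each of them
  the first is a Jacobi inner product in \<open>q\<close>, and the second is its perturbation by the square
  of the functional \<open>q \<mapsto> k q(0) - 2 q'(0)\<close>. Hence at a boundary point the Sobolev kernel is the sum
  over \<open>k\<close> of the contributions to the ball kernel, each multiplied by a ratio in \<open>[0, 1]\<close>, which is
  explicit because the Jacobi kernels for value and derivative at the endpoint are. The ratio
  tends to \<open>1 / (\<mu> + 2)\<^sup>2\<close> as \<open>m\<close> grows, uniformly in \<open>k\<close>, and the contributions with bounded \<open>m\<close> are
  negligible since the Jacobi kernel increases without bound in \<open>m\<close>. The ball kernel itself reduces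
  at a boundary point to the Gegenbauer kernel at the endpoint, by integrating over slices.\<close>

section \<open>Finite-dimensional spaces of functions with an inner product\<close>

text \<open>The weights of the sum over \<open>k\<close>, values of zonal harmonics, are never
  computed, and no orthogonal basis on the ball is written down. One family of weights serves every
  \<open>lam \<ge> 0\<close>, so \<open>lam = 0\<close> turns the closed form of the ball kernel
  into the asymptotics of the weighted sum, which positive \<open>lam\<close> inherits once each
  summand carries its ratio. The obstacle is that for \<open>k\<close> close to \<open>n\<close> the
  ratio is not near its limit, while nothing bounds the weights one by one; such summands are
  compared with those of the same \<open>k\<close> for a larger \<open>n\<close>, which needs growth
  estimates uniform in \<open>k\<close>. As \<open>m\<close> grows the perturbation acts like the
  constraint that the functional vanishes, whatever the value of \<open>lam > 0\<close>, and the
  derivative part of the functional dominates. The share of the evaluation at 0 that survives is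
  \<open>1 - A (A + 2) / (A + 1)^2 = 1 / (A + 1)^2\<close> with \<open>A = \<mu> + 1\<close>.
  Dimension at least 2 enters as \<open>B \<ge> 1\<close>, which keeps the quadratic form of the
  functional nonnegative in its closed form.\<close>

lemma sum_fun_apply: "(\<Sum>i\<in>I. F i) x = (\<Sum>i\<in>I. F i x)"
  for F :: "'i \<Rightarrow> 'a \<Rightarrow> 'b::comm_monoid_add"
  by (induction I rule: infinite_finite_induct) auto

text \<open>The laws are required only on \<open>V\<close>: for functions whose products are not
  integrable the integrals behind the two inner products need not be additive.\<close>

locale fn_inner =
  fixes V :: "('a \<Rightarrow> real) set" and ip :: "('a \<Rightarrow> real) \<Rightarrow> ('a \<Rightarrow> real) \<Rightarrow> real"
  assumes subspace: "fn.subspace V"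
    and finite_dim: "\<exists>S. finite S \<and> V \<subseteq> fn.span S"
    and sym: "f \<in> V \<Longrightarrow> g \<in> V \<Longrightarrow> ip f g = ip g f"
    and add_left: "f \<in> V \<Longrightarrow> g \<in> V \<Longrightarrow> h \<in> V \<Longrightarrow> ip (f + g) h = ip f h + ip g h"
    and scale_left: "f \<in> V \<Longrightarrow> h \<in> V \<Longrightarrow> ip (\<lambda>x. c * f x) h = c * ip f h"
    and pos: "f \<in> V \<Longrightarrow> f \<noteq> 0 \<Longrightarrow> 0 < ip f f"
begin

lemma scale_mem: "f \<in> V \<Longrightarrow> (\<lambda>x. c * f x) \<in> V"
  using fn.subspace_scale[OF subspace] .

lemma zero_left: "h \<in> V \<Longrightarrow> ip 0 h = 0"
  using scale_left[of h h 0] scale_left[of 0 h 0] fn.subspace_0[OF subspace]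
  by (simp add: zero_fun_def)

lemma sum_mem: "(\<And>i. i \<in> I \<Longrightarrow> F i \<in> V) \<Longrightarrow> (\<Sum>i\<in>I. (\<lambda>x. c i * F i x)) \<in> V"
  by (intro fn.subspace_sum[OF subspace] scale_mem)

lemma sum_left:
  assumes "h \<in> V" "\<And>i. i \<in> I \<Longrightarrow> F i \<in> V"
  shows "ip (\<Sum>i\<in>I. (\<lambda>x. c i * F i x)) h = (\<Sum>i\<in>I. c i * ip (F i) h)"
  using assms(2)
proof (induction I rule: infinite_finite_induct)
  case (insert i I)
  then have "ip ((\<lambda>x. c i * F i x) + (\<Sum>i\<in>I. (\<lambda>x. c i * F i x))) h
      = c i * ip (F i) h + (\<Sum>i\<in>I. c i * ip (F i) h)"
    by (subst add_left) (auto intro!: scale_mem sum_mem simp: scale_left \<open>h \<in> V\<close>)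
  then show ?case unfolding sum.insert[OF insert.hyps] .
qed (auto simp: zero_left \<open>h \<in> V\<close>)

lemma add_right: "f \<in> V \<Longrightarrow> g \<in> V \<Longrightarrow> h \<in> V \<Longrightarrow> ip h (f + g) = ip h f + ip h g"
  using add_left[of f g h] sym[of h "f + g"] sym[of h f] sym[of h g] fn.subspace_add[OF subspace, of f g]
  by simp

lemma sum_right:
  assumes "h \<in> V" "\<And>i. i \<in> I \<Longrightarrow> F i \<in> V"
  shows "ip h (\<Sum>i\<in>I. (\<lambda>x. c i * F i x)) = (\<Sum>i\<in>I. c i * ip h (F i))"
proof -
  have "ip h (\<Sum>i\<in>I. (\<lambda>x. c i * F i x)) = ip (\<Sum>i\<in>I. (\<lambda>x. c i * F i x)) h"
    by (intro sym sum_mem assms)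
  also have "\<dots> = (\<Sum>i\<in>I. c i * ip h (F i))"
    using assms by (subst sum_left) (auto intro!: sum.cong sym)
  finally show ?thesis .
qed

lemma orthogonal_coefficient:
  assumes "finite B" "B \<subseteq> V" "pairwise (\<lambda>p q. ip p q = 0) B" "b \<in> B"
  shows "ip b (\<Sum>p\<in>B. (\<lambda>x. c p * p x)) = c b * ip b b"
proof -
  have "ip b (\<Sum>p\<in>B. (\<lambda>x. c p * p x)) = (\<Sum>p\<in>B. c p * ip b p)"
    using assms by (intro sum_right) auto
  also have "\<dots> = (\<Sum>p\<in>B. if p = b then c b * ip b b else 0)"
    using assms by (intro sum.cong) (auto simp: pairwise_def)
  finally show ?thesis using assms by simp
qed

lemma orthogonal_independent:
  assumes "finite B" "B \<subseteq> V" "0 \<notin> B" "pairwise (\<lambda>p q. ip p q = 0) B"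
  shows "fn.independent B"
proof
  assume "fn.dependent B"
  then obtain u b where u: "b \<in> B" "u b \<noteq> 0" "(\<Sum>p\<in>B. (\<lambda>x. u p * p x)) = 0"
    using fn.dependent_finite[OF \<open>finite B\<close>] by auto
  then have bV: "b \<in> V" "b \<noteq> 0" using assms by auto
  have "u b * ip b b = ip b 0"
    using orthogonal_coefficient[OF assms(1,2,4) u(1), of u] u(3) by simp
  also have "\<dots> = 0"
    using zero_left[OF bV(1)] sym[OF bV(1) fn.subspace_0[OF subspace]] by simp
  finally show False using u pos[OF bV] by simp
qed

lemma gram_schmidt:
  assumes "finite S" "S \<subseteq> V"
  shows "\<exists>B. finite B \<and> B \<subseteq> V \<and> 0 \<notin> B \<and> pairwise (\<lambda>p q. ip p q = 0) B \<and> fn.span B = fn.span S"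
  using assms
proof (induction S rule: finite_induct)
  case empty
  show ?case by (intro exI[of _ "{}"]) simp
next
  case (insert s S)
  have "S \<subseteq> V" using insert.prems by simp
  from insert.IH[OF this] obtain B where B: "finite B" "B \<subseteq> V" "0 \<notin> B"
    "pairwise (\<lambda>p q. ip p q = 0) B" "fn.span B = fn.span S" by blast
  define P where "P = (\<Sum>b\<in>B. (\<lambda>x. ip s b / ip b b * b x))"
  define s' where "s' = s - P"
  have sV: "s \<in> V" using insert.prems by simp
  have PV: "P \<in> V" unfolding P_def using B(2) by (intro sum_mem) blast
  have s'V: "s' \<in> V" unfolding s'_def by (rule fn.subspace_diff[OF subspace sV PV])
  have PB: "P \<in> fn.span B"
    unfolding P_def by (rule fn.span_sum) (rule fn.span_scale[OF fn.span_base])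
  have orth: "ip b s' = 0" if "b \<in> B" for b
  proof -
    have bV: "b \<in> V" "b \<noteq> 0" using that B by auto
    have "ip b s = ip b (s' + P)" by (simp add: s'_def)
    also have "\<dots> = ip b s' + ip b P" using s'V PV bV by (intro add_right) auto
    also have "ip b P = ip s b"
      unfolding P_def orthogonal_coefficient[OF B(1,2,4) that] using pos[OF bV] by simp
    finally show ?thesis using sym[OF sV bV(1)] by simp
  qed
  have span: "fn.span (insert s' B) = fn.span (insert s S)"
  proof -
    have "fn.span (insert s S) = fn.span (insert s B)"
      using B(5) by (simp add: fn.span_insert)
    also have "\<dots> = fn.span (insert s' B)"
      using PB by (intro fn.eq_span_insert_eq) (simp add: s'_def)
    finally show ?thesis by simp
  qed
  show ?case
  proof (cases "s' = 0")
    case True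
    then have "fn.span B = fn.span (insert s S)" using span by simp
    then show ?thesis using B by blast
  next
    case False
    have "pairwise (\<lambda>p q. ip p q = 0) (insert s' B)"
    proof -
      have "ip s' b = 0" if "b \<in> B" for b
        using orth[OF that] sym[of b s'] that B s'V by auto
      then show ?thesis using B(4) orth by (simp add: pairwise_insert)
    qed
    moreover have "finite (insert s' B)" "insert s' B \<subseteq> V" "0 \<notin> insert s' B"
      using False B(1-3) s'V by auto
    ultimately show ?thesis using span by (intro exI[of _ "insert s' B"] conjI)
  qed
qed

lemma finite_independent:
  assumes "fn.independent B" "B \<subseteq> V"
  shows "finite B"
proof -
  obtain S where "finite S" "V \<subseteq> fn.span S" using finite_dim by auto
  then show ?thesis using fn.independent_span_bound[OF _ assms(1)] assms(2) by auto
qed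

lemma orthogonal_basis_exists:
  "\<exists>B. finite B \<and> B \<subseteq> V \<and> orthogonal_basis ip V B"
proof -
  obtain S where S: "S \<subseteq> V" "fn.independent S" "V \<subseteq> fn.span S"
    by (rule fn.basis_exists[of V])
  then have "finite S" by (intro finite_independent)
  from gram_schmidt[OF this S(1)] obtain B where B: "finite B" "B \<subseteq> V" "0 \<notin> B"
    "pairwise (\<lambda>p q. ip p q = 0) B" "fn.span B = fn.span S" by blast
  have "fn.span S = V" using S subspace by (intro fn.span_subspace)
  then show ?thesis
    using B orthogonal_independent[OF B(1-4)] by (intro exI[of _ B]) (auto simp: orthogonal_basis_def)
qed

lemma orthogonal_basis_expand:
  assumes "orthogonal_basis ip V B" "f \<in> V"
  shows "finite B" "B \<subseteq> V" "\<And>b. b \<in> B \<Longrightarrow> 0 < ip b b"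
    "f = (\<Sum>b\<in>B. (\<lambda>x. ip b f / ip b b * b x))"
proof -
  have ind: "fn.independent B" and sp: "fn.span B = V" and pw: "pairwise (\<lambda>p q. ip p q = 0) B"
    using assms(1) by (auto simp: orthogonal_basis_def)
  show BV: "B \<subseteq> V" using sp fn.span_superset by auto
  with ind show fB: "finite B" by (intro finite_independent)
  have "0 \<notin> B" using ind fn.dependent_zero by auto
  then show p: "0 < ip b b" if "b \<in> B" for b using pos BV that by auto
  obtain u where u: "f = (\<Sum>b\<in>B. (\<lambda>x. u b * b x))"
    using sp assms(2) fn.span_finite[OF fB] by auto
  have "u b = ip b f / ip b b" if "b \<in> B" for b
    using orthogonal_coefficient[OF fB BV pw that, of u] p[OF that] u by simp
  then show "f = (\<Sum>b\<in>B. (\<lambda>x. ip b f / ip b b * b x))"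
    by (subst (1) u) (auto intro!: sum.cong)
qed

text \<open>Riesz representation: against an orthogonal basis the coefficient of \<open>b\<close> is
  forced to be \<open>\<phi> b / ip b b\<close>. It supplies projections of homogeneous polynomials
  and zonal harmonics.\<close>

lemma representer_exists:
  assumes add: "\<And>f g. f \<in> V \<Longrightarrow> g \<in> V \<Longrightarrow> \<phi> (f + g) = \<phi> f + (\<phi> g :: real)"
    and scale: "\<And>f c. f \<in> V \<Longrightarrow> \<phi> (\<lambda>x. c * f x) = c * \<phi> f"
  shows "\<exists>K\<in>V. \<forall>f\<in>V. ip f K = \<phi> f"
proof -
  obtain B where B: "finite B" "B \<subseteq> V" "orthogonal_basis ip V B"
    using orthogonal_basis_exists by auto
  define K where "K = (\<Sum>b\<in>B. (\<lambda>x. \<phi> b / ip b b * b x))"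
  have KV: "K \<in> V" unfolding K_def using B by (intro sum_mem) auto
  have \<phi>0: "\<phi> 0 = 0"
    using scale[of 0 0] fn.subspace_0[OF subspace] by (simp add: zero_fun_def)
  have \<phi>sum: "\<phi> (\<Sum>i\<in>I. (\<lambda>x. c i * i x)) = (\<Sum>i\<in>I. c i * \<phi> i)" if "I \<subseteq> V" for I c
    using that
  proof (induction I rule: infinite_finite_induct)
    case (insert i I)
    then have "\<phi> ((\<lambda>x. c i * i x) + (\<Sum>i\<in>I. (\<lambda>x. c i * i x))) = c i * \<phi> i + (\<Sum>i\<in>I. c i * \<phi> i)"
      by (subst add) (auto intro!: scale_mem sum_mem simp: scale)
    then show ?case unfolding sum.insert[OF insert.hyps] .
  qed (auto simp: \<phi>0)
  have "ip f K = \<phi> f" if "f \<in> V" for f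
  proof -
    note e = orthogonal_basis_expand[OF B(3) that]
    have "\<phi> f = (\<Sum>b\<in>B. ip b f / ip b b * \<phi> b)"
      using \<phi>sum[OF B(2), of "\<lambda>b. ip b f / ip b b"] e(4) by simp
    also have "\<dots> = (\<Sum>b\<in>B. \<phi> b / ip b b * ip f b)"
      using sym[OF _ that] B(2) by (intro sum.cong) auto
    also have "\<dots> = ip f K"
      unfolding K_def using that B(2) by (subst sum_right) auto
    finally show ?thesis by simp
  qed
  with KV show ?thesis by blast
qed

text \<open>Expanding \<open>K\<close> in any orthogonal basis gives the coefficient
  \<open>ip b K / ip b b = b x / ip b b\<close>, so every basis yields the same sum and the
  \<open>THE\<close> in \<open>repr_kernel\<close> is determined. From here on a kernel is
  identified by its reproducing property.\<close>

lemma repr_kernel_eqI: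
  assumes K: "K \<in> V" "\<And>f. f \<in> V \<Longrightarrow> ip f K = f x"
  shows "repr_kernel ip V x y = K y"
proof -
  have *: "(\<Sum>p\<in>B. p x * p y / ip p p) = K y" if B: "orthogonal_basis ip V B" for B
  proof -
    note e = orthogonal_basis_expand[OF B K(1)]
    have "K y = (\<Sum>b\<in>B. ip b K / ip b b * b y)"
      by (subst e(4)) (simp add: sum_fun_apply)
    also have "\<dots> = (\<Sum>p\<in>B. p x * p y / ip p p)"
      using K(2) e(2) by (intro sum.cong) auto
    finally show ?thesis by simp
  qed
  show ?thesis unfolding repr_kernel_def
  proof (rule the_equality)
    show "\<exists>B. orthogonal_basis ip V B \<and> K y = (\<Sum>p\<in>B. p x * p y / ip p p)"
      using orthogonal_basis_exists * by force
  qed (auto simp: *)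
qed

end

section \<open>Polar coordinates\<close>

lemma nn_integral_lborel_scale:
  fixes f :: "'a::euclidean_space \<Rightarrow> ennreal"
  assumes [measurable]: "f \<in> borel_measurable borel" and "r > 0"
  shows "(\<integral>\<^sup>+y. f y \<partial>lborel) = ennreal (r ^ DIM('a)) * (\<integral>\<^sup>+y. f (r *\<^sub>R y) \<partial>lborel)"
  using assms(2)
  by (subst lborel_affine[of r 0])
     (simp_all add: nn_integral_density nn_integral_distr nn_integral_cmult ennreal_power)

lemma sgn_borel_measurable [measurable]: "(sgn :: 'a::euclidean_space \<Rightarrow> _) \<in> borel_measurable borel"
  unfolding sgn_div_norm[abs_def] by measurable

lemma nn_integral_powr_segment:
  fixes a t :: real
  assumes "a > 0"
  shows "(\<integral>\<^sup>+s. ennreal (a * s powr (a - 1)) * indicator {0..} s * indicator {..t} s \<partial>lborel)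
    = (if t \<ge> 0 then ennreal (t powr a) else 0)"
proof (cases "t \<ge> 0")
  case True
  have "((\<lambda>s. a * s powr (a - 1)) has_integral a * (t powr (a - 1 + 1) / (a - 1 + 1))) {0..t}"
    using assms True by (intro has_integral_mult_right has_integral_powr_from_0) auto
  then have "((\<lambda>s. a * s powr (a - 1)) has_integral t powr a) {0..t}"
    using assms by simp
  from nn_integral_has_integral_lebesgue'[OF _ this]
  have "(\<integral>\<^sup>+s. ennreal (a * s powr (a - 1)) * indicator {0..t} s \<partial>lborel) = ennreal (t powr a)"
    using assms by simp
  moreover have "(\<integral>\<^sup>+s. ennreal (a * s powr (a - 1)) * indicator {0..} s * indicator {..t} s \<partial>lborel)
    = (\<integral>\<^sup>+s. ennreal (a * s powr (a - 1)) * indicator {0..t} s \<partial>lborel)"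
    by (intro nn_integral_cong) (auto simp: indicator_def)
  ultimately show ?thesis using True by simp
next
  case False
  then have "(\<integral>\<^sup>+s. ennreal (a * s powr (a - 1)) * indicator {0..} s * indicator {..t} s \<partial>lborel)
    = (\<integral>\<^sup>+s. 0 \<partial>(lborel :: real measure))"
    by (intro nn_integral_cong) (auto simp: indicator_def)
  then show ?thesis using False by simp
qed

text \<open>\<open>D\<close> is the image of the measure \<open>h (sgn y) dy\<close> under the
  squared norm. As \<open>sgn\<close> is invariant under dilations, scaling gives it mass
  \<open>C t^a\<close> on \<open>{..t}\<close> for \<open>t \<ge> 0\<close>, the same as
  \<open>E\<close>, and half-lines determine a measure. With the squared norm as radial variable the
  ball weight becomes a Beta integrand directly.\<close>

lemma nn_integral_polar:
  fixes h :: "'a::euclidean_space \<Rightarrow> ennreal" and \<phi> :: "real \<Rightarrow> ennreal"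
  defines "C \<equiv> (\<integral>\<^sup>+y. h (sgn y) * indicator (cball 0 1) y \<partial>lborel)"
    and "a \<equiv> real DIM('a) / 2"
  assumes h [measurable]: "h \<in> borel_measurable borel" and "C < \<infinity>"
    and \<phi> [measurable]: "\<phi> \<in> borel_measurable borel"
  shows "(\<integral>\<^sup>+y. h (sgn y) * \<phi> ((norm y)\<^sup>2) \<partial>lborel)
    = C * (\<integral>\<^sup>+t. ennreal (a * t powr (a - 1)) * indicator {0..} t * \<phi> t \<partial>lborel)"
proof -
  define D where "D = distr (density lborel (\<lambda>y. h (sgn y))) borel (\<lambda>y::'a. (norm y)\<^sup>2)"
  define E where "E = density lborel (\<lambda>t. C * (ennreal (a * t powr (a - 1)) * indicator {0..} t))"
  have a: "a > 0" by (simp add: a_def)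
  have D: "emeasure D {..t} = (\<integral>\<^sup>+y. h (sgn y) * indicator {y. (norm y)\<^sup>2 \<le> t} y \<partial>lborel)" for t
  proof -
    have "emeasure D {..t} = emeasure (density lborel (\<lambda>y. h (sgn y))) {y. (norm y)\<^sup>2 \<le> t}"
      unfolding D_def by (subst emeasure_distr) (auto intro!: arg_cong[where f="emeasure _"])
    also have "\<dots> = (\<integral>\<^sup>+y. h (sgn y) * indicator {y. (norm y)\<^sup>2 \<le> t} y \<partial>lborel)"
      by (subst emeasure_density) auto
    finally show ?thesis .
  qed
  have E: "emeasure E {..t} = C * (if t \<ge> 0 then ennreal (t powr a) else 0)" for t
    unfolding E_def using nn_integral_powr_segment[OF a, of t]
    by (subst emeasure_density) (simp_all add: mult.assoc nn_integral_cmult)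
  have DE: "emeasure D {..t} = emeasure E {..t}" for t
  proof -
    consider "t < 0" | "t = 0" | "t > 0" by linarith
    then show ?thesis
    proof cases
      case 1
      then have "{y. (norm (y::'a))\<^sup>2 \<le> t} = {}"
        by (auto simp: not_le intro: less_le_trans)
      with 1 show ?thesis unfolding D E by simp
    next
      case 2
      have "AE y in lborel. y \<noteq> (0 :: 'a)" by (intro AE_lborel_singleton)
      then have "emeasure D {..t} = (\<integral>\<^sup>+y. 0 \<partial>(lborel :: ('a) measure))"
        unfolding D 2 by (intro nn_integral_cong_AE) (auto simp: indicator_def)
      with 2 a show ?thesis unfolding E by simp
    next
      case 3
      define r where "r = sqrt t"
      have r: "r > 0" "t = r\<^sup>2" using 3 by (auto simp: r_def)
      have "emeasure D {..t} = ennreal (r ^ DIM('a)) *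
        (\<integral>\<^sup>+y. h (sgn (r *\<^sub>R y)) * indicator {y. (norm y)\<^sup>2 \<le> t} (r *\<^sub>R y) \<partial>(lborel :: ('a) measure))"
        unfolding D using r by (intro nn_integral_lborel_scale) auto
      also have "(\<integral>\<^sup>+y. h (sgn (r *\<^sub>R y)) * indicator {y. (norm y)\<^sup>2 \<le> t} (r *\<^sub>R y) \<partial>lborel) = C"
      proof -
        have "(norm (r *\<^sub>R y))\<^sup>2 \<le> t \<longleftrightarrow> norm y \<le> 1" for y :: "'a"
          using r by (simp add: power_mult_distrib power_le_one_iff)
        then show ?thesis
          unfolding C_def using r by (intro nn_integral_cong) (simp add: indicator_def sgn_scaleR)
      qed
      also have "r ^ DIM('a) = t powr a"
      proof -
        have "t powr a = (r powr 2) powr a" using r by simp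
        also have "\<dots> = r powr real DIM('a)" by (simp only: powr_powr) (simp add: a_def)
        also have "\<dots> = r ^ DIM('a)" using r by (intro powr_realpow)
        finally show ?thesis by simp
      qed
      finally show ?thesis using 3 unfolding E by (simp add: mult.commute)
    qed
  qed
  have "D = E"
  proof (rule measure_eqI_generator_eq[where E="range atMost" and \<Omega>=UNIV and A="\<lambda>n. {..real n}"])
    show "Int_stable (range (atMost :: real \<Rightarrow> _))"
      by (auto simp: Int_stable_def)
    show "sets D = sigma_sets UNIV (range atMost)" "sets E = sigma_sets UNIV (range atMost)"
      by (simp_all add: D_def E_def borel_eq_atMost)
    show "emeasure D {..real n} \<noteq> \<infinity>" for n
      unfolding DE E using \<open>C < \<infinity>\<close> by (auto simp: ennreal_mult_eq_top_iff)
    show "(\<Union>n. {..real n}) = UNIV" using real_arch_simple by auto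
  qed (auto simp: DE)
  have "(\<integral>\<^sup>+y. h (sgn y) * \<phi> ((norm y)\<^sup>2) \<partial>lborel) = integral\<^sup>N D \<phi>"
    unfolding D_def by (simp add: nn_integral_distr nn_integral_density)
  also have "\<dots> = C * (\<integral>\<^sup>+t. ennreal (a * t powr (a - 1)) * indicator {0..} t * \<phi> t \<partial>lborel)"
    unfolding \<open>D = E\<close> E_def by (simp add: nn_integral_density mult.assoc nn_integral_cmult)
  finally show ?thesis .
qed

lemma cball_borel [measurable]: "cball a r \<in> sets (borel :: 'a::euclidean_space measure)"
  by simp

text \<open>Up to the factor \<open>d\<close> the surface integral of \<open>h\<close>, as an
  integral over the solid ball; it makes sense in every Euclidean space, including the real
  line.\<close>

definition cone_integral :: "('a::euclidean_space \<Rightarrow> real) \<Rightarrow> real" where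
  "cone_integral h = (LINT y|lborel. h (sgn y) * indicator (cball 0 1) y)"

lemma cone_integrable:
  fixes h :: "'a::euclidean_space \<Rightarrow> real"
  assumes [measurable]: "h \<in> borel_measurable borel" and "\<And>x. \<bar>h x\<bar> \<le> M"
  shows "integrable lborel (\<lambda>y. h (sgn y) * indicator (cball 0 1) y)"
proof (rule Bochner_Integration.integrable_bound)
  show "integrable lborel (\<lambda>y::'a. M * indicator (cball 0 1) y)"
    by (intro integrable_mult_right integrable_real_indicator) (auto simp: emeasure_lborel_cball_finite[unfolded infinity_ennreal_def])
  show "AE y in lborel. norm (h (sgn y) * indicator (cball 0 1) y) \<le> norm (M * indicator (cball 0 1) (y::'a))"
    using order.trans[OF assms(2) abs_ge_self] by (intro AE_I2) (auto simp: indicator_def)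
qed measurable

lemma polar_nonneg:
  fixes h :: "'a::euclidean_space \<Rightarrow> real" and \<phi> :: "real \<Rightarrow> real"
  defines "a \<equiv> real DIM('a) / 2"
  assumes h [measurable]: "h \<in> borel_measurable borel" "\<And>x. \<bar>h x\<bar> \<le> M" "\<And>x. 0 \<le> h x"
    and \<phi> [measurable]: "\<phi> \<in> borel_measurable borel" "\<And>t. 0 \<le> \<phi> t"
    and I: "((\<lambda>t. \<phi> t * t powr (a - 1)) has_integral I) {0..}"
  shows "has_bochner_integral lborel (\<lambda>y. h (sgn y) * \<phi> ((norm y)\<^sup>2)) (a * I * cone_integral h)"
proof -
  have C: "(\<integral>\<^sup>+y. ennreal (h (sgn y)) * indicator (cball 0 1) y \<partial>lborel) = ennreal (cone_integral h)"
  proof -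
    have "(\<integral>\<^sup>+y. ennreal (h (sgn y)) * indicator (cball 0 1) y \<partial>lborel)
      = (\<integral>\<^sup>+y. ennreal (h (sgn y) * indicator (cball 0 1) y) \<partial>lborel)"
      by (intro nn_integral_cong) (auto simp: indicator_def)
    also have "\<dots> = ennreal (cone_integral h)"
      unfolding cone_integral_def
      by (intro nn_integral_eq_integral cone_integrable[OF h(1,2)] AE_I2) (auto simp: h(3))
    finally show ?thesis .
  qed
  have c0: "0 \<le> cone_integral h"
    unfolding cone_integral_def by (intro integral_nonneg_AE AE_I2) (auto simp: h)
  have I0: "0 \<le> I" using I by (rule has_integral_nonneg) (auto simp: \<phi>)
  have "(\<integral>\<^sup>+t. ennreal (a * t powr (a - 1)) * indicator {0..} t * ennreal (\<phi> t) \<partial>lborel)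
     = (\<integral>\<^sup>+t. ennreal (a * (\<phi> t * t powr (a - 1))) * indicator {0..} t \<partial>lborel)"
    by (intro nn_integral_cong)
       (auto simp: indicator_def a_def \<phi> simp flip: ennreal_mult intro!: arg_cong[where f=ennreal])
  also have "\<dots> = ennreal (a * I)"
    using \<phi> by (intro nn_integral_has_integral_lebesgue' has_integral_mult_right I) (auto simp: a_def)
  finally have J: "(\<integral>\<^sup>+t. ennreal (a * t powr (a - 1)) * indicator {0..} t * ennreal (\<phi> t) \<partial>lborel) = ennreal (a * I)" .
  have "(\<integral>\<^sup>+y. ennreal (h (sgn y)) * ennreal (\<phi> ((norm y)\<^sup>2)) \<partial>lborel)
      = ennreal (cone_integral h) * ennreal (a * I)"
    using nn_integral_polar[of "\<lambda>y. ennreal (h y)" "\<lambda>t. ennreal (\<phi> t)"]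
    unfolding C J[unfolded a_def] by (simp add: a_def)
  also have "\<dots> = ennreal (a * I * cone_integral h)"
    using c0 I0 by (subst ennreal_mult[symmetric]) (auto simp: a_def mult_ac)
  finally have "(\<integral>\<^sup>+y. ennreal (h (sgn y) * \<phi> ((norm y)\<^sup>2)) \<partial>lborel) = ennreal (a * I * cone_integral h)"
    using h \<phi> by (simp add: ennreal_mult)
  then show ?thesis
    using c0 I0 h \<phi> by (intro has_bochner_integral_nn_integral) (auto simp: a_def)
qed

text \<open>\<open>h = (h + M) - M\<close> is a difference of two nonnegative bounded functions, to
  which \<open>polar_nonneg\<close> applies.\<close>

lemma polar:
  fixes h :: "'a::euclidean_space \<Rightarrow> real" and \<phi> :: "real \<Rightarrow> real"
  defines "a \<equiv> real DIM('a) / 2"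
  assumes h [measurable]: "h \<in> borel_measurable borel" "\<And>x. \<bar>h x\<bar> \<le> M"
    and \<phi> [measurable]: "\<phi> \<in> borel_measurable borel" "\<And>t. 0 \<le> \<phi> t"
    and I: "((\<lambda>t. \<phi> t * t powr (a - 1)) has_integral I) {0..}"
  shows "has_bochner_integral lborel (\<lambda>y. h (sgn y) * \<phi> ((norm y)\<^sup>2)) (a * I * cone_integral h)"
proof -
  have M: "0 \<le> M" using h(2)[of 0] by linarith
  have hM: "0 \<le> h x + M" "\<bar>h x + M\<bar> \<le> 2 * M" for x using h(2)[of x] by linarith+
  have 1: "has_bochner_integral lborel (\<lambda>y. (h (sgn y) + M) * \<phi> ((norm y)\<^sup>2))
      (a * I * cone_integral (\<lambda>y. h y + M))"
    unfolding a_def using hM by (intro polar_nonneg[where M="2 * M"]) (auto simp: \<phi> I[unfolded a_def])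
  have 2: "has_bochner_integral lborel (\<lambda>y::'a. M * \<phi> ((norm y)\<^sup>2))
      (a * I * cone_integral (\<lambda>y::'a. M))"
    unfolding a_def using M by (intro polar_nonneg[where M=M and h="\<lambda>_. M"]) (auto simp: \<phi> I[unfolded a_def])
  have "cone_integral (\<lambda>y. h y + M) = cone_integral h + cone_integral (\<lambda>y::'a. M)"
    unfolding cone_integral_def distrib_right
    using cone_integrable[of h, OF h] cone_integrable[of "\<lambda>y::'a. M" M] M
    by (intro Bochner_Integration.integral_add) auto
  then show ?thesis
    using has_bochner_integral_diff[OF 1 2] by (simp add: algebra_simps)
qed

lemma integral_sphere_measure:
  fixes h :: "real^'d::finite \<Rightarrow> real"
  assumes [measurable]: "h \<in> borel_measurable borel"
  shows "(LINT x|sphere_measure. h x) = real CARD('d) * cone_integral h"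
proof -
  let ?R = "restrict_space lborel (cball 0 1 - {0 :: real^'d})"
  let ?S = "restrict_space borel (sphere 0 1 :: (real^'d) set)"
  have hS: "h \<in> borel_measurable ?S" by (intro measurable_restrict_space1) simp
  have "sphere_measure = density (distr ?R ?S sgn) (\<lambda>_. ennreal (real CARD('d)))"
    by (intro measure_eqI) (auto simp: sphere_measure_def emeasure_density_const)
  then have "(LINT x|sphere_measure. h x)
      = (LINT x|density (distr ?R ?S sgn) (\<lambda>_. ennreal (real CARD('d))). h x)"
    by (rule arg_cong)
  also have "\<dots> = real CARD('d) * (LINT x|distr ?R ?S sgn. h x)"
    using hS by (subst integral_density) auto
  also have "(LINT x|distr ?R ?S sgn. h x) = (LINT y|?R. h (sgn y))"
    by (rule integral_distr[OF sgn_measurable_sphere hS])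
  also have "\<dots> = (LINT y|lborel. indicator (cball 0 1 - {0}) y *\<^sub>R h (sgn y))"
    by (subst integral_restrict_space) (auto simp: set_lebesgue_integral_def)
  also have "\<dots> = cone_integral h"
    unfolding cone_integral_def
  proof (rule integral_cong_AE)
    show "AE y in lborel. indicat_real (cball 0 1 - {0}) y *\<^sub>R h (sgn y)
        = h (sgn y) * indicat_real (cball 0 1) y"
      using AE_lborel_singleton[of 0] by eventually_elim (auto simp: indicator_def)
  next
    show "(\<lambda>y. indicat_real (cball 0 1 - {0}) y *\<^sub>R h (sgn y)) \<in> borel_measurable lborel"
      by (intro borel_measurable_scaleR borel_measurable_indicator) auto
    show "(\<lambda>y. h (sgn y) * indicat_real (cball 0 1) y) \<in> borel_measurable lborel"
      by measurable
  qed
  finally show ?thesis .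
qed

section \<open>Polynomial functions\<close>

definition polys :: "nat set \<Rightarrow> (real^'d::finite \<Rightarrow> real) set" where
  "polys D = fn.span {monomial_fun \<alpha> | \<alpha>. (\<Sum>i\<in>UNIV. \<alpha> i) \<in> D}"

lemma poly_space_eq: "poly_space n = polys {..n}"
  by (simp add: poly_space_def polys_def)

lemma polys_subspace: "fn.subspace (polys D)"
  unfolding polys_def by (rule fn.subspace_span)

lemma polys_add: "f \<in> polys D \<Longrightarrow> g \<in> polys D \<Longrightarrow> (\<lambda>x. f x + g x) \<in> polys D"
  using fn.subspace_add[OF polys_subspace] by (simp add: plus_fun_def)

lemma polys_scale: "f \<in> polys D \<Longrightarrow> (\<lambda>x. c * f x) \<in> polys D"
  using fn.subspace_scale[OF polys_subspace] .

lemma polys_diff: "f \<in> polys D \<Longrightarrow> g \<in> polys D \<Longrightarrow> (\<lambda>x. f x - g x) \<in> polys D"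
  using polys_add[of f D "\<lambda>x. (-1) * g x"] polys_scale[of g D "-1"] by simp

lemma polys_zero: "(\<lambda>x. 0) \<in> polys D"
  using fn.subspace_0[OF polys_subspace] by (simp add: zero_fun_def)

lemma polys_sum: "(\<And>i. i \<in> I \<Longrightarrow> F i \<in> polys D) \<Longrightarrow> (\<lambda>x. \<Sum>i\<in>I. F i x) \<in> polys D"
  by (induction I rule: infinite_finite_induct) (auto intro: polys_add polys_zero)

lemma monomial_polys: "(\<Sum>i\<in>UNIV. \<alpha> i) \<in> D \<Longrightarrow> monomial_fun \<alpha> \<in> polys D"
  unfolding polys_def by (rule fn.span_base) blast

lemma polys_mono: "D \<subseteq> E \<Longrightarrow> polys D \<subseteq> polys E"
  unfolding polys_def by (rule fn.span_mono) blast

lemma polys_induct [consumes 1, case_names zero step]: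
  assumes "f \<in> polys D" "P (\<lambda>x. 0)"
    and "\<And>c \<alpha> f. (\<Sum>i\<in>UNIV. \<alpha> i) \<in> D \<Longrightarrow> P f \<Longrightarrow> P (\<lambda>x. c * monomial_fun \<alpha> x + f x)"
  shows "P f"
  using assms(1) unfolding polys_def
proof (induction rule: fn.span_induct_alt)
  case base
  show ?case using assms(2) by (simp add: zero_fun_def)
next
  case (step c x y)
  then show ?case using assms(3)[of _ y c] by (auto simp: plus_fun_def)
qed

lemma polys_finite_dim: "finite D \<Longrightarrow> \<exists>S. finite S \<and> polys D \<subseteq> fn.span S"
proof (intro exI conjI)
  assume "finite D"
  have "{\<alpha>::'a \<Rightarrow> nat. (\<Sum>i\<in>UNIV. \<alpha> i) \<in> D} \<subseteq> PiE UNIV (\<lambda>_. {..Max D})"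
  proof safe
    fix \<alpha> :: "'a \<Rightarrow> nat" and i
    assume "(\<Sum>i\<in>UNIV. \<alpha> i) \<in> D"
    then have "(\<Sum>i\<in>UNIV. \<alpha> i) \<le> Max D" using \<open>finite D\<close> by simp
    moreover have "\<alpha> i \<le> (\<Sum>i\<in>UNIV. \<alpha> i)" by (rule member_le_sum) auto
    ultimately show "\<alpha> i \<le> Max D" by linarith
  qed auto
  then have "finite {\<alpha>::'a \<Rightarrow> nat. (\<Sum>i\<in>UNIV. \<alpha> i) \<in> D}"
    by (rule finite_subset) (auto intro: finite_PiE)
  then show "finite {monomial_fun \<alpha> :: real^'a \<Rightarrow> real | \<alpha>. (\<Sum>i\<in>UNIV. \<alpha> i) \<in> D}"
    by simp
qed (simp add: polys_def)

lemma monomial_mult: "monomial_fun \<alpha> x * monomial_fun \<beta> x = monomial_fun (\<lambda>i. \<alpha> i + \<beta> i) x"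
  by (simp add: monomial_fun_def power_add prod.distrib)

lemma polys_mult:
  assumes f: "f \<in> polys A" and g: "g \<in> polys B" and C: "\<And>a b. a \<in> A \<Longrightarrow> b \<in> B \<Longrightarrow> a + b \<in> C"
  shows "(\<lambda>x. f x * g x) \<in> polys C"
  using f
proof (induction rule: polys_induct)
  case zero
  show ?case by (simp add: polys_zero)
next
  case (step c \<alpha> f)
  from g have "(\<lambda>x. monomial_fun \<alpha> x * g x) \<in> polys C"
  proof (induction rule: polys_induct)
    case zero
    show ?case by (simp add: polys_zero)
  next
    case (step c' \<beta> g)
    have "(\<lambda>x. c' * monomial_fun (\<lambda>i. \<alpha> i + \<beta> i) x + monomial_fun \<alpha> x * g x) \<in> polys C"
      using step \<open>sum \<alpha> UNIV \<in> A\<close> by (intro polys_add polys_scale monomial_polys) (auto simp: sum.distrib C)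
    then show ?case by (simp add: algebra_simps flip: monomial_mult)
  qed
  then have "(\<lambda>x. c * (monomial_fun \<alpha> x * g x) + f x * g x) \<in> polys C"
    using step by (intro polys_add polys_scale)
  then show ?case by (simp add: algebra_simps)
qed

lemma polys_const: "(\<lambda>x. c) \<in> polys {0}"
proof -
  have "(\<lambda>x. c * monomial_fun (\<lambda>_. 0) x) \<in> polys {0}"
    by (intro polys_scale monomial_polys) simp
  then show ?thesis by (simp add: monomial_fun_def)
qed

lemma polys_coord: "(\<lambda>x. x $ i) \<in> polys {1}"
proof -
  have "monomial_fun (\<lambda>j. if j = i then 1 else 0) \<in> polys {1}"
    by (intro monomial_polys) simp
  moreover have "monomial_fun (\<lambda>j. if j = i then 1 else 0) x = x $ i" for x :: "real^'a"
    by (simp add: monomial_fun_def if_distrib cong: if_cong)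
  ultimately show ?thesis by (metis (no_types, lifting) ext)
qed

lemma polys_power: "f \<in> polys {a} \<Longrightarrow> (\<lambda>x. f x ^ k) \<in> polys {a * k}"
proof (induction k)
  case (Suc k)
  then have "(\<lambda>x. f x * f x ^ k) \<in> polys {a * Suc k}"
    by (intro polys_mult[of f "{a}" _ "{a * k}"]) auto
  then show ?case by simp
qed (simp add: polys_const)

lemma polys_power_le: "f \<in> polys {..a} \<Longrightarrow> (\<lambda>x. f x ^ k) \<in> polys {..a * k}"
proof (induction k)
  case 0
  show ?case using polys_const[of 1] polys_mono[of "{0}" "{..0}"] by auto
next
  case (Suc k)
  then have "(\<lambda>x. f x * f x ^ k) \<in> polys {..a * Suc k}"
    by (intro polys_mult[of f "{..a}" _ "{..a * k}"]) auto
  then show ?case by simp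
qed

lemma polys_prod:
  assumes "finite I" "\<And>i. i \<in> I \<Longrightarrow> F i \<in> polys {a i}"
  shows "(\<lambda>x. \<Prod>i\<in>I. F i x) \<in> polys {\<Sum>i\<in>I. a i}"
  using assms
proof (induction I rule: finite_induct)
  case (insert i I)
  then have "(\<lambda>x. F i x * (\<Prod>i\<in>I. F i x)) \<in> polys {a i + (\<Sum>i\<in>I. a i)}"
    by (intro polys_mult[of _ "{a i}" _ "{\<Sum>i\<in>I. a i}"]) auto
  with insert.hyps show ?case by simp
qed (simp add: polys_const)

lemma norm_sq_vec: "(norm x)\<^sup>2 = (\<Sum>i\<in>UNIV. (x $ i)\<^sup>2)" for x :: "real^'d::finite"
  by (simp add: norm_vec_def L2_set_def sum_nonneg)

lemma polys_norm_sq: "(\<lambda>x. (norm x)\<^sup>2) \<in> polys {2}"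
  unfolding norm_sq_vec by (rule polys_sum) (use polys_power[OF polys_coord, of _ 2] in simp)

text \<open>A linear substitution replaces coordinates by linear forms and so preserves the degree
  of every monomial. It serves to move a boundary point to a coordinate axis.\<close>

lemma polys_linear_compose:
  fixes T :: "real^'d::finite \<Rightarrow> real^'d"
  assumes T: "linear T" and f: "f \<in> polys D"
  shows "(\<lambda>x. f (T x)) \<in> polys D"
proof -
  have coord: "(\<lambda>x. T x $ i) \<in> polys {1}" for i
  proof -
    have "(\<lambda>x. T x $ i) = (\<lambda>x. \<Sum>j\<in>UNIV. T (axis j 1) $ i * x $ j)"
    proof
      fix x
      have "T x = T (\<Sum>j\<in>UNIV. x $ j *\<^sub>R axis j 1)"
        by (metis (no_types, lifting) basis_expansion scalar_mult_eq_scaleR sum.cong)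
      also have "\<dots> = (\<Sum>j\<in>UNIV. x $ j *\<^sub>R T (axis j 1))"
        using T by (simp add: linear_sum linear_cmul)
      finally show "T x $ i = (\<Sum>j\<in>UNIV. T (axis j 1) $ i * x $ j)"
        by (simp add: mult.commute)
    qed
    then show ?thesis by (simp only:) (intro polys_sum polys_scale polys_coord)
  qed
  show ?thesis using f
  proof (induction rule: polys_induct)
    case (step c \<alpha> f)
    have "(\<lambda>x. monomial_fun \<alpha> (T x)) \<in> polys {\<Sum>i\<in>UNIV. \<alpha> i}"
      unfolding monomial_fun_def using polys_power[OF coord] by (intro polys_prod) simp_all
    then have "(\<lambda>x. monomial_fun \<alpha> (T x)) \<in> polys D"
      using polys_mono[of "{\<Sum>i\<in>UNIV. \<alpha> i}" D] step(1) by blast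
    then show ?case using step by (intro polys_add polys_scale)
  qed (rule polys_zero)
qed

lemma monomial_scaleR: "monomial_fun \<alpha> (c *\<^sub>R x) = c ^ (\<Sum>i\<in>UNIV. \<alpha> i) * monomial_fun \<alpha> x"
  by (simp add: monomial_fun_def power_mult_distrib prod.distrib power_sum)

lemma polys_scaleR:
  assumes "f \<in> polys {k}"
  shows "f (c *\<^sub>R x) = c ^ k * f x"
  using assms by (induction rule: polys_induct) (auto simp: monomial_scaleR algebra_simps)

lemma polys_norm_sgn:
  assumes "f \<in> polys {k}"
  shows "f x = norm x ^ k * f (sgn x)"
proof (cases "x = 0")
  case False
  then have "x = norm x *\<^sub>R sgn x" by (simp add: sgn_div_norm)
  then show ?thesis using polys_scaleR[OF assms, of "norm x" "sgn x"] by simp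
next
  case True
  then show ?thesis using polys_scaleR[OF assms, of 0 0] by (cases k) auto
qed

lemma continuous_monomial_fun: "continuous_on A (monomial_fun \<alpha>)"
  unfolding monomial_fun_def[abs_def] by (intro continuous_intros)

lemma polys_continuous: "f \<in> polys D \<Longrightarrow> continuous_on A f"
  by (induction rule: polys_induct) (auto intro!: continuous_intros continuous_monomial_fun)

lemma polys_borel: "f \<in> polys D \<Longrightarrow> f \<in> borel_measurable borel"
  by (intro borel_measurable_continuous_onI polys_continuous)

lemma polys_bounded: "f \<in> polys D \<Longrightarrow> \<exists>M. \<forall>x\<in>cball 0 1. \<bar>f x\<bar> \<le> M"
  using compact_imp_bounded[OF compact_continuous_image[OF polys_continuous compact_cball]]
  unfolding bounded_iff by (metis image_eqI real_norm_def)

lemma polys_line: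
  assumes "f \<in> polys D"
  shows "\<exists>p. \<forall>t. f (t *\<^sub>R x) = poly p t"
  using assms
proof (induction rule: polys_induct)
  case zero
  show ?case by (intro exI[of _ 0]) simp
next
  case (step c \<alpha> f)
  then obtain p where "\<forall>t. f (t *\<^sub>R x) = poly p t" by auto
  then show ?case
    by (intro exI[of _ "Polynomial.monom (c * monomial_fun \<alpha> x) (sum \<alpha> UNIV) + p"])
       (simp add: poly_monom monomial_scaleR)
qed

text \<open>On each line through the origin \<open>f\<close> is a polynomial in one variable that
  vanishes for all small positive parameters, hence identically. The \<open>+ 1\<close> in the
  interval covers \<open>x = 0\<close>.\<close>

lemma polys_eq_0_if_ball:
  assumes f: "f \<in> polys D" and 0: "\<And>x. norm x < 1 \<Longrightarrow> f x = 0"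
  shows "f = 0"
proof
  fix x :: "real^'a"
  obtain p where p: "\<And>t. f (t *\<^sub>R x) = poly p t" using polys_line[OF f] by blast
  have "poly p t = 0" if "t \<in> {0<..<1 / (norm x + 1)}" for t
  proof -
    have "norm (t *\<^sub>R x) = t * norm x" using that by simp
    also have "\<dots> \<le> t * (norm x + 1)" using that by (intro mult_left_mono) auto
    also have "\<dots> < 1" using that pos_less_divide_eq[of "norm x + 1" t 1] by (simp add: add_nonneg_pos)
    finally show ?thesis using 0 p by metis
  qed
  then have "{0<..<1 / (norm x + 1)} \<subseteq> {t. poly p t = 0}" by blast
  moreover have "infinite {0<..<1 / (norm x + 1)}"
    by (intro infinite_Ioo) (simp add: add_nonneg_pos)
  ultimately have "infinite {t. poly p t = 0}" using finite_subset by blast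
  then have "p = 0" using poly_roots_finite by blast
  then show "f x = 0 x" using p[of 1] by simp
qed

section \<open>Rotation invariance of Lebesgue measure\<close>

lemma lborel_translate:
  fixes f :: "'a::euclidean_space \<Rightarrow> ennreal"
  assumes [measurable]: "f \<in> borel_measurable borel"
  shows "(\<integral>\<^sup>+x. f (c + x) \<partial>lborel) = (\<integral>\<^sup>+x. f x \<partial>lborel)"
  by (subst lborel_distr_plus[of c, symmetric]) (simp add: nn_integral_distr)

text \<open>Uniqueness of translation invariant measures by Fubini: the image measure is
  translation invariant and gives the unit ball its Lebesgue measure.\<close>

lemma lborel_distr_orthogonal:
  fixes T :: "'a::euclidean_space \<Rightarrow> 'a"
  assumes T: "orthogonal_transformation T"
  shows "distr lborel borel T = lborel"
proof (rule measure_eqI)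
  have lin: "linear T" and bl: "bounded_linear T"
    using T orthogonal_transformation_linear linear_conv_bounded_linear by blast+
  have [measurable]: "T \<in> borel_measurable borel"
    using bl by (intro borel_measurable_continuous_onI linear_continuous_on)
  obtain S where S: "T (S y) = y" for y
    using orthogonal_transformation_surj[OF T] by (metis surjD)
  let ?M = "distr lborel borel T"
  let ?B = "cball 0 1 :: 'a set"
  fix A assume "A \<in> sets ?M"
  then have [measurable]: "A \<in> sets borel" by simp
  have inv: "(\<integral>\<^sup>+x. f (T x + y) \<partial>lborel) = (\<integral>\<^sup>+x. f (T x) \<partial>lborel)"
    if [measurable]: "f \<in> borel_measurable borel" for f :: "'a \<Rightarrow> ennreal" and y
  proof -
    have "(\<integral>\<^sup>+x. f (T x + y) \<partial>lborel) = (\<integral>\<^sup>+x. f (T (S y + x)) \<partial>lborel)"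
      using S by (simp add: linear_add[OF lin] add.commute)
    also have "\<dots> = (\<integral>\<^sup>+x. f (T x) \<partial>lborel)" by (rule lborel_translate) measurable
    finally show ?thesis .
  qed
  have "emeasure ?M A * emeasure lborel ?B
      = (\<integral>\<^sup>+x. indicator A (T x) * (\<integral>\<^sup>+y. indicator ?B y \<partial>lborel) \<partial>lborel)"
    by (subst nn_integral_multc) (simp_all add: emeasure_distr nn_integral_distr flip: nn_integral_indicator)
  also have "\<dots> = (\<integral>\<^sup>+x. (\<integral>\<^sup>+y. indicator A (T x) * indicator ?B (- T x + y) \<partial>lborel) \<partial>lborel)"
    using lborel_translate[of "indicator ?B"] by (simp add: nn_integral_cmult del: diff_conv_add_uminus uminus_add_conv_diff add_uminus_conv_diff)
  also have "\<dots> = (\<integral>\<^sup>+y. (\<integral>\<^sup>+x. indicator A (T x) * indicator ?B (- T x + y) \<partial>lborel) \<partial>lborel)"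
    by (rule lborel_pair.Fubini') measurable
  \<comment> \<open>For fixed \<open>y\<close> the inner integral is unchanged when
    \<open>T x\<close> is replaced by \<open>T x + y\<close>. Then \<open>y\<close> cancels in the
    second indicator, and as \<open>T\<close> preserves norms this becomes the indicator of the ball
    at \<open>x\<close>.\<close>
  also have "\<dots> = (\<integral>\<^sup>+y. (\<integral>\<^sup>+x. indicator A (T x + y) * indicator ?B (- (T x + y) + y) \<partial>lborel) \<partial>lborel)"
    by (intro nn_integral_cong inv[symmetric]) measurable
  also have "\<dots> = (\<integral>\<^sup>+y. (\<integral>\<^sup>+x. indicator A (T x + y) * indicator ?B x \<partial>lborel) \<partial>lborel)"
    using orthogonal_transformation_norm[OF T] by (simp add: indicator_def)
  also have "\<dots> = (\<integral>\<^sup>+x. (\<integral>\<^sup>+y. indicator A (T x + y) * indicator ?B x \<partial>lborel) \<partial>lborel)"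
    by (rule lborel_pair.Fubini'[symmetric]) measurable
  also have "\<dots> = (\<integral>\<^sup>+x. emeasure lborel A * indicator ?B x \<partial>lborel)"
    by (intro nn_integral_cong) (simp add: nn_integral_multc lborel_translate[of "indicator A"])
  also have "\<dots> = emeasure lborel A * emeasure lborel ?B"
    by (simp add: nn_integral_cmult)
  finally have "emeasure ?M A * emeasure lborel ?B = emeasure lborel A * emeasure lborel ?B" .
  moreover have "emeasure lborel ?B \<noteq> \<infinity>" using emeasure_lborel_cball_finite[of "0::'a" 1] by simp
  moreover have "emeasure lborel ?B \<noteq> 0"
    using emeasure_cball[of 1 "0::'a"] unit_ball_vol_pos[of "real DIM('a)"]
    by (simp add: less_imp_neq[symmetric])
  ultimately show "emeasure ?M A = emeasure lborel A"
    by (metis ennreal_mult_cancel_left infinity_ennreal_def mult.commute)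
qed simp

section \<open>Integrals of polynomials over the ball and the sphere\<close>

definition sph :: "(real^'d::finite \<Rightarrow> real) \<Rightarrow> real" where
  "sph f = (LINT x|sphere_measure. f x)"

lemma sgn_sgn_vec: "sgn (sgn x) = sgn (x :: 'a::real_normed_vector)"
  by (cases "x = 0") (simp_all add: sgn_div_norm)

lemma polys_sgn_bounded:
  assumes "f \<in> polys D"
  obtains M where "\<And>x. \<bar>f (sgn x)\<bar> \<le> M"
proof -
  obtain M where "\<forall>x\<in>cball 0 1. \<bar>f x\<bar> \<le> M" using polys_bounded[OF assms] by blast
  then have "\<bar>f (sgn x)\<bar> \<le> M" for x by (simp add: norm_sgn)
  then show ?thesis using that by blast
qed

lemma polys_sgn_borel: "f \<in> polys D \<Longrightarrow> (\<lambda>x. f (sgn x)) \<in> borel_measurable borel"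
  using polys_borel by measurable

lemma sph_eq: "f \<in> polys D \<Longrightarrow> sph (f :: real^'d::finite \<Rightarrow> real) = real CARD('d) * cone_integral f"
  unfolding sph_def by (intro integral_sphere_measure polys_borel)

lemma cone_integrable_polys:
  assumes "f \<in> polys D"
  shows "integrable lborel (\<lambda>y. f (sgn y) * indicator (cball 0 1) y)"
proof -
  obtain M where "\<And>x. \<bar>f (sgn x)\<bar> \<le> M" using polys_sgn_bounded[OF assms] by blast
  then have "integrable lborel (\<lambda>y. f (sgn (sgn y)) * indicator (cball 0 1) y)"
    using polys_sgn_borel[OF assms] by (intro cone_integrable[of "\<lambda>x. f (sgn x)" M])
  then show ?thesis by (simp add: sgn_sgn_vec)
qed

lemma sph_add:
  assumes "f \<in> polys D" "g \<in> polys D"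
  shows "sph (\<lambda>x. f x + g x) = sph f + sph g"
proof -
  have "cone_integral (\<lambda>x. f x + g x) = cone_integral f + cone_integral g"
    unfolding cone_integral_def distrib_right
    using cone_integrable_polys assms by (intro Bochner_Integration.integral_add) blast+
  then show ?thesis
    unfolding sph_eq[OF polys_add[OF assms]] sph_eq[OF assms(1)] sph_eq[OF assms(2)]
    by (simp add: distrib_left)
qed

lemma sph_scale: "sph (\<lambda>x. c * f x) = c * sph f"
  by (simp add: sph_def)

lemma sph_cong:
  assumes "f \<in> polys D" "g \<in> polys E" "\<And>x. norm x = 1 \<Longrightarrow> f x = g x"
  shows "sph f = sph (g :: real^'d::finite \<Rightarrow> real)"
proof -
  have "cone_integral f = cone_integral g"
    unfolding cone_integral_def
  proof (rule integral_cong_AE)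
    show "AE y in lborel. f (sgn y) * indicat_real (cball 0 1) y = g (sgn y) * indicat_real (cball 0 1) y"
      using AE_lborel_singleton[of 0] by eventually_elim (simp add: norm_sgn assms(3))
  qed (use cone_integrable_polys[OF assms(1)] cone_integrable_polys[OF assms(2)] in auto)
  then show ?thesis using assms by (simp add: sph_eq)
qed

lemma sqrt_power_powr:
  fixes t a :: real
  assumes "t \<ge> 0"
  shows "sqrt \<bar>t\<bar> ^ l * t powr (a / 2 - 1) = t powr ((real l + a) / 2 - 1)"
proof (cases "t = 0")
  case False
  then have t: "t > 0" using assms by auto
  then have "sqrt \<bar>t\<bar> ^ l = t powr (real l / 2)"
    by (simp add: powr_half_sqrt[symmetric] powr_powr mult.commute flip: powr_realpow)
  then have "sqrt \<bar>t\<bar> ^ l * t powr (a / 2 - 1) = t powr (real l / 2 + (a / 2 - 1))"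
    by (simp only: powr_add)
  also have "real l / 2 + (a / 2 - 1) = (real l + a) / 2 - 1" by (simp add: field_simps)
  finally show ?thesis .
qed simp

text \<open>Homogeneity gives \<open>f y = norm y ^ l * f (sgn y)\<close>; the power of the norm
  joins the radial factor and moves the exponent from \<open>d / 2\<close> to
  \<open>(l + d) / 2\<close>.\<close>

lemma polys_polar:
  fixes f :: "real^'d::finite \<Rightarrow> real"
  assumes f: "f \<in> polys {l}" and \<phi> [measurable]: "\<phi> \<in> borel_measurable borel" "\<And>t. 0 \<le> \<phi> t"
    and I: "((\<lambda>t. \<phi> t * t powr ((real l + real CARD('d)) / 2 - 1)) has_integral I) {0..}"
  shows "has_bochner_integral lborel (\<lambda>y. f y * \<phi> ((norm y)\<^sup>2)) (I / 2 * sph f)"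
proof -
  obtain M where M: "\<And>x. \<bar>f (sgn x)\<bar> \<le> M" using polys_sgn_bounded[OF f] by blast
  have I': "((\<lambda>t. \<phi> t * sqrt \<bar>t\<bar> ^ l * t powr (real DIM(real^'d) / 2 - 1)) has_integral I) {0..}"
    by (rule has_integral_eq[OF _ I]) (simp only: mult.assoc sqrt_power_powr atLeast_iff DIM_cart DIM_real mult_1_right)
  \<comment> \<open>\<open>polar\<close> asks for a globally bounded angular factor and a
    nonnegative radial one: hence \<open>f (sgn _)\<close> in place of \<open>f\<close>, and the
    absolute value under the root, which matters for negative arguments.\<close>
  have "has_bochner_integral lborel (\<lambda>y. f (sgn (sgn y)) * (\<phi> ((norm y)\<^sup>2) * sqrt \<bar>(norm y)\<^sup>2\<bar> ^ l))
      (real DIM(real^'d) / 2 * I * cone_integral (\<lambda>y. f (sgn y)))"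
    using polys_sgn_borel[OF f] M I' \<phi> by (intro polar[where M=M]) auto
  moreover have "f (sgn (sgn y)) * (\<phi> ((norm y)\<^sup>2) * sqrt \<bar>(norm y)\<^sup>2\<bar> ^ l) = f y * \<phi> ((norm y)\<^sup>2)" for y
    using polys_norm_sgn[OF f, of y] by (simp add: sgn_sgn_vec)
  moreover have "real DIM(real^'d) / 2 * I * cone_integral (\<lambda>y. f (sgn y)) = I / 2 * sph f"
    by (simp add: sph_eq[OF f] cone_integral_def sgn_sgn_vec)
  ultimately show ?thesis by (simp only:)
qed

section \<open>Radial moments with Beta and Gamma weights\<close>

lemma Beta_has_integral_halfline:
  assumes "a > 0" "b > (0::real)"
  shows "((\<lambda>t. (indicator {..1} t * (1 - t) powr (b - 1)) * t powr (a - 1)) has_integral Beta a b) {0..}"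
proof -
  have "((\<lambda>t. if t \<in> {0..1} then t powr (a - 1) * (1 - t) powr (b - 1) else 0) has_integral Beta a b) {0..}"
    using has_integral_Beta_real[OF assms] by (subst has_integral_restrict) auto
  then show ?thesis
    by (rule has_integral_eq[rotated]) (auto simp: indicator_def)
qed

lemma ball_moment:
  fixes f :: "real^'d::finite \<Rightarrow> real"
  assumes f: "f \<in> polys {l}" and \<mu>: "\<mu> > -1"
  shows "has_bochner_integral lborel (\<lambda>y. indicator (cball 0 1) y *\<^sub>R (f y * ball_weight \<mu> y))
    (Beta ((real l + real CARD('d)) / 2) (\<mu> + 1) / 2 * sph f)"
proof -
  define \<phi> :: "real \<Rightarrow> real" where "\<phi> = (\<lambda>t. indicator {..1} t * (1 - t) powr \<mu>)"
  have "real CARD('d) > 0" by simp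
  then have "(real l + real CARD('d)) / 2 > 0" by (simp add: add_nonneg_pos)
  from Beta_has_integral_halfline[OF this, of "\<mu> + 1"] \<mu>
  have "has_bochner_integral lborel (\<lambda>y. f y * \<phi> ((norm y)\<^sup>2))
      (Beta ((real l + real CARD('d)) / 2) (\<mu> + 1) / 2 * sph f)"
    by (intro polys_polar[OF f]) (auto simp: \<phi>_def)
  moreover have "f y * \<phi> ((norm y)\<^sup>2) = indicator (cball 0 1) y *\<^sub>R (f y * ball_weight \<mu> y)" for y
    by (auto simp: \<phi>_def ball_weight_def indicator_def power_le_one_iff)
  ultimately show ?thesis by simp
qed

text \<open>The Gaussian appears beside the ball weight because it factorizes over the coordinates,
  which \<open>even_moment\<close> exploits.\<close>

lemma gauss_moment:
  fixes f :: "real^'d::finite \<Rightarrow> real"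
  assumes f: "f \<in> polys {l}"
  shows "has_bochner_integral lborel (\<lambda>y. f y * exp (- (norm y)\<^sup>2))
    (Gamma ((real l + real CARD('d)) / 2) / 2 * sph f)"
proof (rule polys_polar[OF f])
  have "real CARD('d) > 0" by simp
  then have "(real l + real CARD('d)) / 2 > 0" by (simp add: add_nonneg_pos)
  from Gamma_integral_real[OF this]
  show "((\<lambda>t. exp (- t) * t powr ((real l + real CARD('d)) / 2 - 1)) has_integral
      Gamma ((real l + real CARD('d)) / 2)) {0..}"
    by (simp only: exp_minus divide_inverse mult.commute[of "inverse _"])
qed auto

lemma cone_integral_one_real: "cone_integral (\<lambda>_::real. 1) = 2"
proof -
  have "cball 0 1 = {-1..1::real}" by (auto simp: abs_le_iff)
  then show ?thesis by (simp add: cone_integral_def)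
qed

text \<open>The polar formula in dimension one, where the unit ball has length 2, cancelling the
  factor \<open>1 / 2\<close>; evenness of \<open>j\<close> lets \<open>\<bar>t\<bar> ^ j\<close> be
  read as \<open>t ^ j\<close>.\<close>

lemma real_even_polar:
  assumes \<phi> [measurable]: "\<phi> \<in> borel_measurable borel" "\<And>t. 0 \<le> \<phi> t" and "even j"
    and I: "((\<lambda>t. \<phi> t * t powr ((real j + 1) / 2 - 1)) has_integral I) {0..}"
  shows "has_bochner_integral lborel (\<lambda>t::real. t ^ j * \<phi> (t\<^sup>2)) I"
proof -
  have I': "((\<lambda>t. \<phi> t * sqrt \<bar>t\<bar> ^ j * t powr (real DIM(real) / 2 - 1)) has_integral I) {0..}"
    by (rule has_integral_eq[OF _ I]) (simp only: mult.assoc sqrt_power_powr atLeast_iff DIM_real of_nat_1)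
  have "has_bochner_integral lborel (\<lambda>y::real. 1 * (\<phi> ((norm y)\<^sup>2) * sqrt \<bar>(norm y)\<^sup>2\<bar> ^ j))
      (real DIM(real) / 2 * I * cone_integral (\<lambda>y::real. 1))"
    using I' \<phi> by (intro polar[where M=1]) auto
  then show ?thesis
    using \<open>even j\<close> by (simp add: cone_integral_one_real power_even_abs mult.commute)
qed

lemma real_ball_moment_even:
  assumes "even j" "\<nu> > -1"
  shows "has_bochner_integral lborel (\<lambda>t::real. indicator {-1..1} t * (t ^ j * (1 - t\<^sup>2) powr \<nu>))
    (Beta ((real j + 1) / 2) (\<nu> + 1))"
proof -
  define \<phi> :: "real \<Rightarrow> real" where "\<phi> = (\<lambda>t. indicator {..1} t * (1 - t) powr \<nu>)"
  have "has_bochner_integral lborel (\<lambda>t. t ^ j * \<phi> (t\<^sup>2)) (Beta ((real j + 1) / 2) (\<nu> + 1))"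
    using Beta_has_integral_halfline[of "(real j + 1) / 2" "\<nu> + 1"] assms
    by (intro real_even_polar) (auto simp: \<phi>_def)
  moreover have "t ^ j * \<phi> (t\<^sup>2) = indicator {-1..1} t * (t ^ j * (1 - t\<^sup>2) powr \<nu>)" for t
    by (auto simp: \<phi>_def indicator_def abs_square_le_1 abs_le_iff)
  ultimately show ?thesis by simp
qed

lemma real_gauss_moment_even:
  assumes "even j"
  shows "has_bochner_integral lborel (\<lambda>t::real. t ^ j * exp (- t\<^sup>2)) (Gamma ((real j + 1) / 2))"
proof (rule real_even_polar)
  show "((\<lambda>t. exp (- t) * t powr ((real j + 1) / 2 - 1)) has_integral Gamma ((real j + 1) / 2)) {0..}"
    using Gamma_integral_real[of "(real j + 1) / 2"]
    by (simp only: exp_minus divide_inverse mult.commute[of "inverse _"]) simp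
qed (use assms in auto)

lemma lborel_integral_odd:
  fixes f :: "real \<Rightarrow> real"
  assumes "\<And>t. f (- t) = - f t"
  shows "(LINT t|lborel. f t) = 0"
  using lborel_integral_real_affine[of "-1" f 0] assms by simp

lemma prod_Basis_vec: "(\<Prod>b\<in>Basis. f b) = (\<Prod>i\<in>UNIV. f (axis i 1))"
  for f :: "real^'d::finite \<Rightarrow> 'b::comm_monoid_mult"
proof -
  have "(Basis :: (real^'d) set) = range (\<lambda>i. axis i 1)" by (auto simp: Basis_vec_def)
  then have "(\<Prod>b\<in>Basis. f b) = (\<Prod>b\<in>range (\<lambda>i. axis i 1). f b)" by (rule arg_cong)
  also have "\<dots> = (\<Prod>i\<in>UNIV. f (axis i 1))"
    by (subst prod.reindex) (auto simp: inj_on_def axis_eq_axis)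
  finally show ?thesis .
qed

text \<open>The Gaussian integral of a monomial is evaluated twice, in polar coordinates and as a
  product over the coordinates; the comparison gives the moments of the sphere.\<close>

lemma even_moment:
  fixes \<alpha> :: "'d::finite \<Rightarrow> nat"
  assumes "\<And>i. even (\<alpha> i)"
  shows "Gamma ((real (\<Sum>i\<in>UNIV. \<alpha> i) + real CARD('d)) / 2) / 2 * sph (monomial_fun \<alpha>)
    = (\<Prod>i\<in>UNIV. Gamma ((real (\<alpha> i) + 1) / 2))"
proof -
  \<comment> \<open>The product formula for Lebesgue measure runs over \<open>Basis\<close>, so the
    coordinate has to be recovered from the basis vector.\<close>
  define F where "F = (\<lambda>(b::real^'d) (t::real). t ^ \<alpha> (THE i. b = axis i 1) * exp (- t\<^sup>2))"
  have Fa: "F (axis i 1) t = t ^ \<alpha> i * exp (- t\<^sup>2)" for i t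
    by (simp add: F_def axis_eq_axis)
  have F0: "F b t \<ge> 0" if "b \<in> Basis" for b t
    using that assms by (auto simp: Basis_vec_def Fa zero_le_power_eq)
  have Fm: "F b \<in> borel_measurable borel" for b by (simp add: F_def)
  have 1: "(\<integral>\<^sup>+t. ennreal (t ^ \<alpha> i * exp (- t\<^sup>2)) \<partial>lborel) = ennreal (Gamma ((real (\<alpha> i) + 1) / 2))" for i
    using real_gauss_moment_even[OF assms[of i]] assms[of i]
    by (subst nn_integral_eq_integral) (auto simp: has_bochner_integral_iff zero_le_power_eq)
  have "(\<integral>\<^sup>+y. ennreal (monomial_fun \<alpha> y * exp (- (norm y)\<^sup>2)) \<partial>lborel)
      = (\<integral>\<^sup>+y. (\<Prod>b\<in>Basis. ennreal (F b (y \<bullet> b))) \<partial>lborel)"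
    using assms
    by (intro nn_integral_cong)
       (simp add: prod_Basis_vec Fa inner_axis prod_ennreal monomial_fun_def zero_le_power_eq prod.distrib
          norm_sq_vec sum_negf[symmetric] exp_sum)
  also have "\<dots> = (\<Prod>b\<in>Basis. (\<integral>\<^sup>+t. ennreal (F b t) \<partial>lborel))"
    using Fm by (intro nn_integral_lborel_prod) auto
  also have "\<dots> = (\<Prod>i\<in>UNIV. ennreal (Gamma ((real (\<alpha> i) + 1) / 2)))"
    by (simp add: prod_Basis_vec Fa 1)
  also have "\<dots> = ennreal (\<Prod>i\<in>UNIV. Gamma ((real (\<alpha> i) + 1) / 2))"
    by (intro prod_ennreal) (auto intro: less_imp_le Gamma_real_pos)
  finally have "has_bochner_integral lborel (\<lambda>y. monomial_fun \<alpha> y * exp (- (norm y)\<^sup>2))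
      (\<Prod>i\<in>UNIV. Gamma ((real (\<alpha> i) + 1) / 2))"
    using assms polys_borel[OF monomial_polys[of \<alpha> UNIV]]
    by (intro has_bochner_integral_nn_integral)
       (auto simp: monomial_fun_def zero_le_power_eq intro!: prod_nonneg AE_I2 mult_nonneg_nonneg
          intro: less_imp_le Gamma_real_pos)
  moreover have "has_bochner_integral lborel (\<lambda>y. monomial_fun \<alpha> y * exp (- (norm y)\<^sup>2))
      (Gamma ((real (\<Sum>i\<in>UNIV. \<alpha> i) + real CARD('d)) / 2) / 2 * sph (monomial_fun \<alpha>))"
    by (rule gauss_moment) (rule monomial_polys, simp)
  ultimately show ?thesis using has_bochner_integral_eq by blast
qed

section \<open>Positivity and rotation invariance of the ball integral\<close>

lemma AE_zero_imp_zero: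
  fixes f :: "'a::euclidean_space \<Rightarrow> real"
  assumes "AE y in lborel. y \<in> S \<longrightarrow> f y = 0" "open S" "continuous_on S f" "x \<in> S"
  shows "f x = 0"
proof (rule ccontr)
  assume "f x \<noteq> 0"
  have "open (S \<inter> f -` (- {0}))"
    using assms by (intro continuous_open_preimage) auto
  moreover have "x \<in> S \<inter> f -` (- {0})" using assms \<open>f x \<noteq> 0\<close> by auto
  ultimately obtain r where r: "r > 0" "ball x r \<subseteq> S \<inter> f -` (- {0})"
    using open_contains_ball by meson
  have "AE y in lborel. y \<notin> ball x r"
    using assms(1) by eventually_elim (use r in auto)
  then have "emeasure lborel (ball x r) = 0"
    by (subst (asm) AE_iff_measurable[of "ball x r"]) auto
  then have "unit_ball_vol (real DIM('a)) * r ^ DIM('a) \<le> 0"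
    using r emeasure_ball[of r x] by (simp add: ennreal_eq_0_iff)
  moreover have "0 < unit_ball_vol (real DIM('a)) * r ^ DIM('a)"
    using r by (intro mult_pos_pos) auto
  ultimately show False by simp
qed

definition ball_int :: "real \<Rightarrow> (real^'d::finite \<Rightarrow> real) \<Rightarrow> real" where
  "ball_int \<mu> f = (LINT y:cball 0 1|lborel. f y * ball_weight \<mu> y)"

lemma ball_int_homogeneous:
  fixes f :: "real^'d::finite \<Rightarrow> real"
  assumes "f \<in> polys {l}" "\<mu> > -1"
  shows "ball_int \<mu> f = Beta ((real l + real CARD('d)) / 2) (\<mu> + 1) / 2 * sph f"
  using ball_moment[OF assms] by (simp add: ball_int_def set_lebesgue_integral_def has_bochner_integral_iff)

lemma ball_integrable:
  fixes f :: "real^'d::finite \<Rightarrow> real"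
  assumes "f \<in> polys D" "\<mu> > -1"
  shows "set_integrable lborel (cball 0 1) (\<lambda>y. f y * ball_weight \<mu> y)"
  using assms(1)
proof (induction rule: polys_induct)
  case zero
  show ?case by (simp add: set_integrable_def)
next
  case (step c \<alpha> f)
  have "monomial_fun \<alpha> \<in> polys {\<Sum>i\<in>UNIV. \<alpha> i}" by (rule monomial_polys) simp
  from ball_moment[OF this \<open>\<mu> > -1\<close>]
  have "set_integrable lborel (cball 0 1) (\<lambda>y. monomial_fun \<alpha> y * ball_weight \<mu> y)"
    by (simp add: set_integrable_def has_bochner_integral_iff)
  then have "set_integrable lborel (cball 0 1) (\<lambda>y. c * (monomial_fun \<alpha> y * ball_weight \<mu> y) + f y * ball_weight \<mu> y)"
    using step by (intro set_integral_add(1) set_integrable_mult_right) auto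
  then show ?case by (simp add: algebra_simps)
qed

lemma ball_int_add:
  assumes "f \<in> polys D" "g \<in> polys E" "\<mu> > -1"
  shows "ball_int \<mu> (\<lambda>y. f y + g y) = ball_int \<mu> f + ball_int \<mu> g"
  unfolding ball_int_def distrib_right using assms ball_integrable by (intro set_integral_add(2)) blast+

lemma ball_int_scale: "ball_int \<mu> (\<lambda>y. c * f y) = c * ball_int \<mu> f"
  unfolding ball_int_def mult.assoc by simp

lemma ball_int_sum:
  assumes "\<And>i. i \<in> I \<Longrightarrow> F i \<in> polys D" "\<mu> > -1"
  shows "ball_int \<mu> (\<lambda>y. \<Sum>i\<in>I. F i y) = (\<Sum>i\<in>I. ball_int \<mu> (F i))"
  using assms(1)
proof (induction I rule: infinite_finite_induct)
  case (insert i I)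
  then have "ball_int \<mu> (\<lambda>y. F i y + (\<Sum>i\<in>I. F i y)) = ball_int \<mu> (F i) + (\<Sum>i\<in>I. ball_int \<mu> (F i))"
    using \<open>\<mu> > -1\<close> by (subst ball_int_add[of _ D _ D]) (auto intro: polys_sum)
  with insert.hyps show ?case by simp
qed (auto simp: ball_int_def set_lebesgue_integral_def)

lemma ball_int_square_pos:
  fixes f :: "real^'d::finite \<Rightarrow> real"
  assumes f: "f \<in> polys D" "f \<noteq> 0" and \<mu>: "\<mu> > -1"
  shows "0 < ball_int \<mu> (\<lambda>y. f y * f y)"
proof -
  have "(\<lambda>y. f y * f y) \<in> polys UNIV" using f by (intro polys_mult[of f D f D]) auto
  from ball_integrable[OF this \<mu>]
  have int: "integrable lborel (\<lambda>y. indicator (cball 0 1) y *\<^sub>R (f y * f y * ball_weight \<mu> y))"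
    by (simp add: set_integrable_def)
  have nn: "AE y in lborel. 0 \<le> indicator (cball 0 1) y *\<^sub>R (f y * f y * ball_weight \<mu> y)"
    by (intro AE_I2) (auto simp: ball_weight_def indicator_def)
  have "ball_int \<mu> (\<lambda>y. f y * f y) \<ge> 0"
    unfolding ball_int_def set_lebesgue_integral_def by (rule integral_nonneg_AE[OF nn])
  moreover have "ball_int \<mu> (\<lambda>y. f y * f y) \<noteq> 0"
  proof
    assume "ball_int \<mu> (\<lambda>y. f y * f y) = 0"
    then have "AE y in lborel. indicator (cball 0 1) y *\<^sub>R (f y * f y * ball_weight \<mu> y) = 0"
      using integral_nonneg_eq_0_iff_AE[OF int nn] by (simp add: ball_int_def set_lebesgue_integral_def)
    then have "AE y in lborel. y \<in> ball 0 1 \<longrightarrow> f y = 0"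
    proof eventually_elim
      case (elim y)
      \<comment> \<open>On the unit sphere the weight is 0 by \<open>0 powr \<mu> = 0\<close>, so a
        vanishing product says something about \<open>f\<close> only inside the open ball.\<close>
      have "(norm y)\<^sup>2 \<noteq> 1" if "norm y < 1"
        using that power_strict_mono[of "norm y" 1 2] by auto
      with elim show ?case by (auto simp: ball_weight_def indicator_def)
    qed
    then have "f y = 0" if "norm y < 1" for y
      using that by (intro AE_zero_imp_zero[of "ball 0 1"] polys_continuous[OF f(1)]) auto
    with f show False using polys_eq_0_if_ball[OF f(1)] by blast
  qed
  ultimately show ?thesis by simp
qed

lemma ball_int_rotate:
  fixes T :: "real^'d::finite \<Rightarrow> real^'d"
  assumes T: "orthogonal_transformation T" and f: "f \<in> polys D"
  shows "ball_int \<mu> (\<lambda>y. f (T y)) = ball_int \<mu> f"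
proof -
  have nT: "norm (T y) = norm y" for y using orthogonal_transformation_norm[OF T] .
  have lin: "bounded_linear T"
    using T orthogonal_transformation_linear linear_conv_bounded_linear by blast
  have [measurable]: "T \<in> borel_measurable borel"
    using lin by (intro borel_measurable_continuous_onI linear_continuous_on)
  have [measurable]: "f \<in> borel_measurable borel" by (rule polys_borel[OF f])
  have "ball_int \<mu> f = (LINT y|distr lborel borel T. indicator (cball 0 1) y *\<^sub>R (f y * ball_weight \<mu> y))"
    by (simp add: lborel_distr_orthogonal[OF T] ball_int_def set_lebesgue_integral_def)
  also have "\<dots> = (LINT y|lborel. indicator (cball 0 1) (T y) *\<^sub>R (f (T y) * ball_weight \<mu> (T y)))"
    by (subst integral_distr) (auto simp: ball_weight_def)
  also have "\<dots> = ball_int \<mu> (\<lambda>y. f (T y))"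
    by (simp add: ball_int_def set_lebesgue_integral_def indicator_def nT ball_weight_def)
  finally show ?thesis ..
qed

lemma sphere_area_pos: "0 < sphere_area TYPE('d::finite)"
  by (auto simp: sphere_area_def intro!: divide_pos_pos mult_pos_pos Gamma_real_pos)

lemma sph_one: "sph (\<lambda>_::real^'d::finite. 1) = sphere_area TYPE('d)"
proof -
  have "space (sphere_measure :: (real^'d) measure) = sphere 0 1"
    by (auto simp: sphere_measure_def space_scale_measure space_restrict_space)
  then show ?thesis
    using emeasure_sphere_measure_space[where 'd='d] sphere_area_pos[where 'd='d]
    by (simp add: sph_def measure_def)
qed

definition avg :: "(real^'d::finite \<Rightarrow> real) \<Rightarrow> real" where
  "avg f = sph f / sphere_area TYPE('d)"

lemma card_half_pos: "(real l + real CARD('d::finite)) / 2 > 0"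
  by (simp add: add_nonneg_pos)

lemma Beta_real_pos: "a > 0 \<Longrightarrow> b > 0 \<Longrightarrow> Beta a b > (0::real)"
  by (simp add: Beta_def Gamma_real_pos)

lemma ball_mass_eq:
  assumes "\<mu> > -1"
  shows "ball_mass TYPE('d::finite) \<mu> = Beta (real CARD('d) / 2) (\<mu> + 1) / 2 * sphere_area TYPE('d)"
  using ball_int_homogeneous[OF polys_const[of 1] assms, where 'd='d]
  by (simp add: ball_int_def ball_mass_def sph_one)

lemma ball_mass_pos: "\<mu> > -1 \<Longrightarrow> ball_mass TYPE('d::finite) \<mu> > 0"
  using sphere_area_pos[where 'd='d] Beta_real_pos[of "real CARD('d) / 2" "\<mu> + 1"]
  by (simp add: ball_mass_eq)

lemma inner_ball_eq: "inner_ball \<mu> f g = ball_int \<mu> (\<lambda>y. f y * g y) / ball_mass TYPE('d) \<mu>"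
  for f :: "real^'d::finite \<Rightarrow> real"
  by (simp add: inner_ball_def ball_int_def)

lemma ball_int_homogeneous_avg:
  fixes f :: "real^'d::finite \<Rightarrow> real"
  assumes "f \<in> polys {l}" "\<mu> > -1" "\<mu>' > -1"
  shows "ball_int \<mu>' f / ball_mass TYPE('d) \<mu>
    = Beta ((real l + real CARD('d)) / 2) (\<mu>' + 1) / Beta (real CARD('d) / 2) (\<mu> + 1) * avg f"
  using assms sphere_area_pos[where 'd='d] Beta_real_pos[of "real CARD('d) / 2" "\<mu> + 1"]
  by (simp add: ball_int_homogeneous ball_mass_eq avg_def field_simps)

text \<open>At a boundary point both sides vanish, as \<open>0 powr _\<close> is 0 for every
  exponent, negative ones included.\<close>

lemma ball_weight_shift:
  assumes "y \<in> cball 0 1"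
  shows "(1 - (norm y)\<^sup>2) ^ j * ball_weight \<mu> y = ball_weight (\<mu> + real j) y"
proof (cases "norm y = 1")
  case False
  then have "norm y < 1" using assms by auto
  then have "(norm y)\<^sup>2 < 1" using power_strict_mono[of "norm y" 1 2] by auto
  then show ?thesis by (simp add: ball_weight_def powr_add powr_realpow)
qed (cases j, auto simp: ball_weight_def)

text \<open>The powers of \<open>1 - norm y ^ 2\<close> are absorbed by the weight, so that only the
  moment of a homogeneous polynomial for a shifted \<open>\<mu>\<close> remains.\<close>

lemma inner_ball_radial:
  fixes Y Y' :: "real^'d::finite \<Rightarrow> real"
  assumes Y: "Y \<in> polys {k}" "Y' \<in> polys {l}" and \<mu>: "\<mu> > -1"
  shows "inner_ball \<mu> (\<lambda>y. (1 - (norm y)\<^sup>2) ^ i * Y y) (\<lambda>y. (1 - (norm y)\<^sup>2) ^ j * Y' y)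
    = Beta ((real (k + l) + real CARD('d)) / 2) (\<mu> + real (i + j) + 1) / Beta (real CARD('d) / 2) (\<mu> + 1)
      * avg (\<lambda>y. Y y * Y' y)"
proof -
  have "(1 - (norm y)\<^sup>2) ^ i * Y y * ((1 - (norm y)\<^sup>2) ^ j * Y' y) * ball_weight \<mu> y
      = Y y * Y' y * ball_weight (\<mu> + real (i + j)) y" if "y \<in> cball 0 1" for y
    by (simp only: ball_weight_shift[OF that, symmetric]) (simp add: power_add)
  then have "ball_int \<mu> (\<lambda>y. (1 - (norm y)\<^sup>2) ^ i * Y y * ((1 - (norm y)\<^sup>2) ^ j * Y' y))
      = ball_int (\<mu> + real (i + j)) (\<lambda>y. Y y * Y' y)"
    unfolding ball_int_def by (intro set_lebesgue_integral_cong) auto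
  moreover have "(\<lambda>y. Y y * Y' y) \<in> polys {k + l}" using Y by (rule polys_mult) auto
  ultimately show ?thesis
    using ball_int_homogeneous_avg[of "\<lambda>y. Y y * Y' y" "k + l" \<mu> "\<mu> + real (i + j)"] \<mu>
    by (simp add: inner_ball_eq)
qed

section \<open>Normal derivatives\<close>

lemma normal_deriv_has_derivative:
  fixes f :: "real^'d::finite \<Rightarrow> real"
  assumes f: "(f has_derivative F) (at x)"
  shows "normal_deriv f x = F x"
proof -
  have lin: "linear F" using f has_derivative_linear by blast
  have pd: "partial_deriv i f x = F (axis i 1)" for i
  proof -
    have "((\<lambda>t. x + t *\<^sub>R axis i 1) has_derivative (\<lambda>t. t *\<^sub>R axis i 1)) (at 0)"
      by (auto intro!: derivative_eq_intros)
    from has_derivative_compose[OF this, of f F] f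
    have "((\<lambda>t. f (x + t *\<^sub>R axis i 1)) has_derivative (\<lambda>t. F (t *\<^sub>R axis i 1))) (at 0)"
      by simp
    then have "((\<lambda>t. f (x + t *\<^sub>R axis i 1)) has_field_derivative F (axis i 1)) (at 0)"
      by (simp add: has_field_derivative_def linear_cmul[OF lin] mult.commute[of _ "F _"])
    then show ?thesis unfolding partial_deriv_def by (rule DERIV_imp_deriv)
  qed
  have "F x = F (\<Sum>j\<in>UNIV. x $ j *\<^sub>R axis j 1)"
    by (metis (no_types, lifting) basis_expansion scalar_mult_eq_scaleR sum.cong)
  also have "\<dots> = normal_deriv f x"
    by (simp add: normal_deriv_def pd linear_sum[OF lin] linear_cmul[OF lin])
  finally show ?thesis ..
qed

lemma polys_differentiable: "f \<in> polys D \<Longrightarrow> f differentiable (at x)"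
proof (induction rule: polys_induct)
  case (step c \<alpha> f)
  have "monomial_fun \<alpha> differentiable (at x)"
    unfolding monomial_fun_def[abs_def] differentiable_def
    by (rule exI) (rule has_derivative_prod, rule has_derivative_power, rule bounded_linear.has_derivative, rule bounded_linear_vec_nth, rule has_derivative_ident)
  with step show ?case by (intro differentiable_add differentiable_mult differentiable_const)
qed simp

lemma normal_deriv_add:
  assumes "f \<in> polys D" "g \<in> polys E"
  shows "normal_deriv (\<lambda>y. f y + g y) x = normal_deriv f x + normal_deriv g x"
proof -
  obtain F G where "(f has_derivative F) (at x)" "(g has_derivative G) (at x)"
    using assms polys_differentiable unfolding differentiable_def by blast
  then show ?thesis
    using normal_deriv_has_derivative[OF has_derivative_add[of f F "at x" g G]]
    by (simp add: normal_deriv_has_derivative)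
qed

lemma normal_deriv_scale:
  assumes "f \<in> polys D"
  shows "normal_deriv (\<lambda>y. c * f y) x = c * normal_deriv f x"
proof -
  obtain F where "(f has_derivative F) (at x)"
    using assms polys_differentiable unfolding differentiable_def by blast
  then show ?thesis
    using normal_deriv_has_derivative[OF has_derivative_mult_right[of f F "at x" c]]
    by (simp add: normal_deriv_has_derivative)
qed

text \<open>Both sides of \<open>f ((1 + t) x) = (1 + t) ^ k f x\<close> are differentiated at
  \<open>t = 0\<close>.\<close>

lemma euler_homogeneous:
  fixes f :: "real^'d::finite \<Rightarrow> real"
  assumes f: "f \<in> polys {k}" and F: "(f has_derivative F) (at x)"
  shows "F x = real k * f x"
proof -
  have lin: "linear F" using F has_derivative_linear by blast
  have "((\<lambda>t. x + t *\<^sub>R x) has_derivative (\<lambda>t. t *\<^sub>R x)) (at 0)"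
    by (auto intro!: derivative_eq_intros)
  from has_derivative_compose[OF this, of f F] F
  have 1: "((\<lambda>t. f (x + t *\<^sub>R x)) has_derivative (\<lambda>t. F (t *\<^sub>R x))) (at 0)" by simp
  have "(\<lambda>t. f (x + t *\<^sub>R x)) = (\<lambda>t. (1 + t) ^ k * f x)"
    using polys_scaleR[OF f, of "1 + _" x] by (simp add: scaleR_left_distrib fun_eq_iff)
  moreover have "((\<lambda>t. (1 + t) ^ k * f x) has_derivative (\<lambda>t. t * (real k * f x))) (at 0)"
    by (auto intro!: derivative_eq_intros simp: mult_ac)
  ultimately have "(\<lambda>t. F (t *\<^sub>R x)) = (\<lambda>t. t * (real k * f x))"
    using has_derivative_unique[OF 1] by simp
  from fun_cong[OF this, of 1] show ?thesis by simp
qed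

lemma normal_deriv_homogeneous:
  assumes "f \<in> polys {k}"
  shows "normal_deriv f x = real k * f x"
  using polys_differentiable[OF assms, of x] euler_homogeneous[OF assms]
  by (auto simp: differentiable_def normal_deriv_has_derivative)

lemma normal_deriv_polys:
  assumes "f \<in> polys D"
  shows "normal_deriv f \<in> polys D"
proof -
  have "f \<in> polys D \<and> normal_deriv f \<in> polys D" using assms
  proof (induction rule: polys_induct)
    case zero
    have "normal_deriv (\<lambda>x::real^'a. 0) = (\<lambda>x. 0)"
      using normal_deriv_homogeneous[of "\<lambda>_. 0" 0] polys_zero by fastforce
    then show ?case by (simp add: polys_zero)
  next
    case (step c \<alpha> f)
    have m: "monomial_fun \<alpha> \<in> polys {\<Sum>i\<in>UNIV. \<alpha> i}" by (rule monomial_polys) simp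
    have mD: "monomial_fun \<alpha> \<in> polys D" using step(1) by (rule monomial_polys)
    have "normal_deriv (\<lambda>x. c * monomial_fun \<alpha> x + f x)
        = (\<lambda>x. c * (real (\<Sum>i\<in>UNIV. \<alpha> i) * monomial_fun \<alpha> x) + normal_deriv f x)"
      using step mD
      by (simp add: fun_eq_iff normal_deriv_add[of _ D _ D] polys_scale normal_deriv_scale[of _ D]
          normal_deriv_homogeneous[OF m])
    then show ?case using step mD by (simp del: of_nat_sum) (intro conjI polys_add polys_scale; simp)
  qed
  then show ?thesis ..
qed

text \<open>The factor \<open>1 - norm y ^ 2\<close> vanishes on the sphere, so the product rule
  leaves Euler's identity for \<open>j = 0\<close>, the radial derivative \<open>-2\<close> of that
  factor for \<open>j = 1\<close>, and nothing beyond. This is why the boundary term is a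
  perturbation of rank one in the radial variable.\<close>

lemma normal_deriv_radial:
  fixes Y :: "real^'d::finite \<Rightarrow> real"
  assumes Y: "Y \<in> polys {k}" and x: "norm x = 1"
  shows "normal_deriv (\<lambda>y. (1 - (norm y)\<^sup>2) ^ j * Y y) x
    = (if j = 0 then real k else if j = 1 then -2 else 0) * Y x"
proof -
  obtain F where F: "(Y has_derivative F) (at x)"
    using polys_differentiable[OF Y] unfolding differentiable_def by blast
  have [simp]: "x \<bullet> x = 1" using x by (simp add: dot_square_norm)
  have "((\<lambda>y. (1 - y \<bullet> y) ^ j * Y y) has_derivative
      (\<lambda>h. (1 - x \<bullet> x) ^ j * F h + (real j * (0 - (x \<bullet> h + h \<bullet> x)) * (1 - x \<bullet> x) ^ (j - 1)) * Y x)) (at x)"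
    by (intro has_derivative_mult has_derivative_power has_derivative_diff has_derivative_const
        has_derivative_inner has_derivative_ident F)
  then have "normal_deriv (\<lambda>y. (1 - y \<bullet> y) ^ j * Y y) x
      = 0 ^ j * F x + real j * (- 2) * 0 ^ (j - 1) * Y x"
    by (subst normal_deriv_has_derivative, assumption) simp
  then show ?thesis
    using euler_homogeneous[OF Y F] by (cases j) (auto simp: dot_square_norm power_0_left)
qed

section \<open>The inner product spaces\<close>

lemma poly_space_mult: "f \<in> poly_space n \<Longrightarrow> g \<in> poly_space n \<Longrightarrow> (\<lambda>x. f x * g x) \<in> polys UNIV"
  unfolding poly_space_eq by (rule polys_mult) auto

lemma fn_inner_ball:
  assumes \<mu>: "\<mu> > -1"
  shows "fn_inner (poly_space n) (inner_ball \<mu> :: (real^'d::finite \<Rightarrow> real) \<Rightarrow> _)"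
proof
  show "fn.subspace (poly_space n :: (real^'d \<Rightarrow> real) set)"
    unfolding poly_space_eq by (rule polys_subspace)
  show "\<exists>S. finite S \<and> (poly_space n :: (real^'d \<Rightarrow> real) set) \<subseteq> fn.span S"
    unfolding poly_space_eq by (rule polys_finite_dim) simp
  fix f g h :: "real^'d \<Rightarrow> real" and c
  show "inner_ball \<mu> f g = inner_ball \<mu> g f" by (simp add: inner_ball_eq mult.commute)
  show "inner_ball \<mu> (\<lambda>x. c * f x) h = c * inner_ball \<mu> f h"
    by (simp add: inner_ball_eq mult.assoc ball_int_scale)
  assume f: "f \<in> poly_space n"
  { assume "f \<noteq> 0"
    then show "0 < inner_ball \<mu> f f"
      using f ball_int_square_pos[of f "{..n}" \<mu>] ball_mass_pos[OF \<mu>, where 'd='d] \<mu>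
      by (simp add: inner_ball_eq poly_space_eq) }
  assume "g \<in> poly_space n" "h \<in> poly_space n"
  with f show "inner_ball \<mu> (f + g) h = inner_ball \<mu> f h + inner_ball \<mu> g h"
    using ball_int_add[OF poly_space_mult poly_space_mult \<mu>, of f n h g n h]
    by (simp add: inner_ball_eq distrib_right add_divide_distrib)
qed

lemma inner_sobolev_eq:
  "inner_sobolev lam \<mu> f g = inner_ball \<mu> f g + lam * avg (\<lambda>x. normal_deriv f x * normal_deriv g x)"
  for f :: "real^'d::finite \<Rightarrow> real"
  by (simp add: inner_sobolev_def avg_def sph_def)

lemma avg_add: "f \<in> polys D \<Longrightarrow> g \<in> polys D \<Longrightarrow> avg (\<lambda>x. f x + g x) = avg f + avg g"
  by (simp add: avg_def sph_add add_divide_distrib)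

lemma avg_scale: "avg (\<lambda>x. c * f x) = c * avg f"
  by (simp add: avg_def sph_scale)

lemma avg_cong:
  assumes "f \<in> polys D" "g \<in> polys E" "\<And>x. norm x = 1 \<Longrightarrow> f x = g x"
  shows "avg f = avg g"
  using sph_cong[OF assms] by (simp add: avg_def)

lemma avg_nonneg: "(\<And>x. 0 \<le> f x) \<Longrightarrow> 0 \<le> avg (f :: real^'d::finite \<Rightarrow> real)"
  using sphere_area_pos[where 'd='d] unfolding avg_def sph_def by (intro divide_nonneg_pos) auto

text \<open>Positivity comes from the ball part alone. The case \<open>lam = 0\<close> is included
  because it makes the ball kernel an instance of the same decomposition.\<close>

lemma fn_inner_sobolev:
  assumes \<mu>: "\<mu> > -1" and lam: "lam \<ge> 0"
  shows "fn_inner (poly_space n) (inner_sobolev lam \<mu> :: (real^'d::finite \<Rightarrow> real) \<Rightarrow> _)"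
proof -
  interpret B: fn_inner "poly_space n" "inner_ball \<mu> :: (real^'d \<Rightarrow> real) \<Rightarrow> _"
    by (rule fn_inner_ball[OF \<mu>])
  show ?thesis
  proof
    fix f g h :: "real^'d \<Rightarrow> real" and c
    show "inner_sobolev lam \<mu> f g = inner_sobolev lam \<mu> g f"
      by (simp add: inner_sobolev_eq inner_ball_eq mult.commute)
    assume f: "f \<in> poly_space n"
    then show "inner_sobolev lam \<mu> (\<lambda>x. c * f x) h = c * inner_sobolev lam \<mu> f h" if "h \<in> poly_space n"
      using B.scale_left[OF f that]
      by (simp add: inner_sobolev_eq normal_deriv_scale[of f "{..n}"] poly_space_eq mult.assoc avg_scale distrib_left)
    { assume "f \<noteq> 0"
      then have "0 < inner_ball \<mu> f f" by (rule B.pos[OF f])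
      moreover have "0 \<le> lam * avg (\<lambda>x. normal_deriv f x * normal_deriv f x)"
        using lam by (intro mult_nonneg_nonneg avg_nonneg zero_le_square)
      ultimately show "0 < inner_sobolev lam \<mu> f f" by (simp add: inner_sobolev_eq) }
    assume g: "g \<in> poly_space n" and h: "h \<in> poly_space n"
    have "avg (\<lambda>x. normal_deriv f x * normal_deriv h x + normal_deriv g x * normal_deriv h x)
        = avg (\<lambda>x. normal_deriv f x * normal_deriv h x) + avg (\<lambda>x. normal_deriv g x * normal_deriv h x)"
      using f g h normal_deriv_polys unfolding poly_space_eq
      by (intro avg_add[of _ UNIV] polys_mult[of _ "{..n}" _ "{..n}"]) auto
    then show "inner_sobolev lam \<mu> (f + g) h = inner_sobolev lam \<mu> f h + inner_sobolev lam \<mu> g h"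
      using B.add_left[OF f g h] f g normal_deriv_add[of f "{..n}" g "{..n}"]
      by (simp add: inner_sobolev_eq poly_space_eq distrib_right distrib_left plus_fun_def)
  qed (rule B.subspace B.finite_dim)+
qed

text \<open>For homogeneous polynomials the mean over the sphere is a positive multiple of an
  integral over the ball, hence definite; without homogeneity \<open>1 - norm x ^ 2\<close> would
  have mean square 0.\<close>

lemma fn_inner_avg:
  assumes V: "fn.subspace V" "V \<subseteq> polys {k}"
  shows "fn_inner V (\<lambda>f g :: real^'d::finite \<Rightarrow> real. avg (\<lambda>x. f x * g x))"
proof
  show "\<exists>S. finite S \<and> V \<subseteq> fn.span S"
    using polys_finite_dim[of "{k}", where 'a='d] V(2) by (simp, meson order.trans)
  fix f g h :: "real^'d \<Rightarrow> real" and c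
  show "avg (\<lambda>x. f x * g x) = avg (\<lambda>x. g x * f x)" by (simp add: mult.commute)
  show "avg (\<lambda>x. c * f x * h x) = c * avg (\<lambda>x. f x * h x)" by (simp add: mult.assoc avg_scale)
  assume f: "f \<in> V"
  then have ff: "(\<lambda>x. f x * f x) \<in> polys {k + k}" using V by (intro polys_mult[of f "{k}" f "{k}"]) auto
  { assume "f \<noteq> 0"
    then have "0 < ball_int 0 (\<lambda>x. f x * f x)"
      using f V by (intro ball_int_square_pos[of f "{k}"]) auto
    then show "0 < avg (\<lambda>x. f x * f x)"
      using sphere_area_pos[where 'd='d] Beta_real_pos[OF card_half_pos[of "k + k", where 'd='d], of 1]
      by (simp add: ball_int_homogeneous[OF ff] avg_def zero_less_mult_iff) }
  assume "g \<in> V" "h \<in> V"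
  with f V show "avg (\<lambda>x. (f + g) x * h x) = avg (\<lambda>x. f x * h x) + avg (\<lambda>x. g x * h x)"
    by (simp add: distrib_right) (intro avg_add[of _ UNIV] polys_mult[of _ "{k}" _ "{k}"]; auto)
qed (rule V)

section \<open>One-variable kernels at the endpoint\<close>

lemma alternating_binomial_poly:
  fixes p :: "real poly"
  assumes "degree p < m"
  shows "(\<Sum>i\<le>m. (-1) ^ i * real (m choose i) * poly p (real i)) = 0"
  using assms
proof (induction m arbitrary: p)
  case (Suc m)
  obtain a q where p: "p = pCons a q" by (cases p)
  \<comment> \<open>The identity \<open>i * (Suc m choose i) = Suc m * (m choose (i - 1))\<close>
    absorbs the factor \<open>i\<close> of \<open>p = a + x q\<close>, lowering both the order of
    the difference and the degree; the shift of the index composes \<open>q\<close> with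
    \<open>x + 1\<close>.\<close>
  have 1: "(\<Sum>i\<le>Suc m. (-1) ^ i * real (Suc m choose i) * (real i * poly q (real i)))
      = - real (Suc m) * (\<Sum>i\<le>m. (-1) ^ i * real (m choose i) * poly (pcompose q [:1, 1:]) (real i))"
  proof -
    have "(\<Sum>i\<le>Suc m. (-1) ^ i * real (Suc m choose i) * (real i * poly q (real i)))
        = (\<Sum>i\<le>m. (-1) ^ Suc i * (real (Suc i) * real (Suc m choose Suc i)) * poly q (real (Suc i)))"
      by (subst sum.atMost_Suc_shift) (simp add: mult_ac del: binomial_Suc_Suc of_nat_Suc)
    also have "\<dots> = (\<Sum>i\<le>m. (-1) ^ Suc i * (real (Suc m) * real (m choose i)) * poly q (real (Suc i)))"
      by (simp only: Suc_times_binomial flip: of_nat_mult)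
    finally show ?thesis
      unfolding sum_distrib_left by (rule trans) (rule sum.cong, simp_all add: poly_pcompose algebra_simps)
  qed
  have "(\<Sum>i\<le>m. (-1) ^ i * real (m choose i) * poly (pcompose q [:1, 1:]) (real i)) = 0"
  proof (cases "m = 0")
    case True
    then have "degree p = 0" using Suc.prems by simp
    then have "q = 0" using p by (metis degree_pCons_eq old.nat.distinct(2))
    then show ?thesis by simp
  next
    case False
    then have "degree q < m" using Suc.prems p by (cases "q = 0") auto
    then show ?thesis by (intro Suc.IH) (simp add: degree_pcompose)
  qed
  moreover have "(\<Sum>i\<le>Suc m. (-1) ^ i * real (Suc m choose i) * a) = 0"
    using choose_alternating_sum[of "Suc m", where 'a=real] by (simp flip: sum_distrib_right del: binomial_Suc_Suc sum.atMost_Suc)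
  ultimately show ?case
    using 1 by (simp add: p distrib_left sum.distrib del: binomial_Suc_Suc sum.atMost_Suc)
qed simp

lemma alternating_binomial_Suc:
  fixes f :: "nat \<Rightarrow> real"
  shows "(\<Sum>i\<le>Suc m. (-1) ^ i * real (Suc m choose i) * f i)
    = (\<Sum>i\<le>m. (-1) ^ i * real (m choose i) * f i) - (\<Sum>i\<le>m. (-1) ^ i * real (m choose i) * f (Suc i))"
proof -
  have t: "(-1) ^ Suc i * real (Suc m choose Suc i) * f (Suc i)
      = (-1) ^ Suc i * real (m choose Suc i) * f (Suc i) - (-1) ^ i * real (m choose i) * f (Suc i)" for i
    by (simp add: algebra_simps)
  have "(\<Sum>i\<le>Suc m. (-1) ^ i * real (Suc m choose i) * f i)
      = f 0 + (\<Sum>i\<le>m. (-1) ^ Suc i * real (m choose Suc i) * f (Suc i))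
        - (\<Sum>i\<le>m. (-1) ^ i * real (m choose i) * f (Suc i))"
    by (subst sum.atMost_Suc_shift) (simp only: t sum_subtractf, simp)
  also have "f 0 + (\<Sum>i\<le>m. (-1) ^ Suc i * real (m choose Suc i) * f (Suc i))
      = (\<Sum>i\<le>Suc m. (-1) ^ i * real (m choose i) * f i)"
    by (subst sum.atMost_Suc_shift) simp
  finally show ?thesis by simp
qed

text \<open>The \<open>m\<close>-th difference of \<open>1 / (x + z)\<close>: Pascal's rule, in the
  form \<open>alternating_binomial_Suc\<close>, subtracts the sum at \<open>z + 1\<close> from the
  sum at \<open>z\<close>.\<close>

lemma alternating_binomial_pole:
  fixes z :: real
  assumes "z > 0"
  shows "(\<Sum>i\<le>m. (-1) ^ i * real (m choose i) * (1 / (real i + z))) = fact m / pochhammer z (Suc m)"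
  using assms
proof (induction m arbitrary: z)
  case (Suc m)
  have "(\<Sum>i\<le>Suc m. (-1) ^ i * real (Suc m choose i) * (1 / (real i + z)))
      = fact m / pochhammer z (Suc m) - fact m / pochhammer (z + 1) (Suc m)"
    using Suc.IH[of z] Suc.IH[of "z + 1"] Suc.prems
    by (subst alternating_binomial_Suc) (simp add: add_ac)
  also have "\<dots> = fact (Suc m) / pochhammer z (Suc (Suc m))"
  proof -
    define P where "P = pochhammer (z + 1) m"
    have P: "P > 0" unfolding P_def using Suc.prems by (intro pochhammer_pos) auto
    have 1: "pochhammer z (Suc m) = z * P" "pochhammer (z + 1) (Suc m) = P * (z + 1 + real m)"
      "pochhammer z (Suc (Suc m)) = z * (P * (z + 1 + real m))"
      by (simp_all only: P_def pochhammer_rec[of z] pochhammer_Suc[of "z + 1"])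
    have w: "z + 1 + real m > 0" using Suc.prems by simp
    have "fact m / (z * P) - fact m / (P * (z + 1 + real m))
        = fact m * ((z + 1 + real m) - z) / (z * (P * (z + 1 + real m)))"
      using P w Suc.prems by (simp add: divide_simps) (simp add: algebra_simps)
    then show ?thesis unfolding 1 by (simp add: algebra_simps)
  qed
  finally show ?case .
qed simp

text \<open>For \<open>m > 0\<close> division by \<open>x + z\<close> leaves a quotient of degree
  below \<open>m\<close>, annihilated by the alternating sum, and the remainder
  \<open>poly R (- z)\<close> over the simple pole.\<close>

lemma alternating_binomial_div:
  fixes R :: "real poly" and z :: real
  assumes R: "degree R \<le> m" and z: "z > 0"
  shows "(\<Sum>i\<le>m. (-1) ^ i * real (m choose i) * (poly R (real i) / (real i + z)))
    = poly R (- z) * (fact m / pochhammer z (Suc m))"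
proof (cases "m = 0")
  case True
  then obtain c where "R = [:c:]" using R degree_eq_zeroE by auto
  then show ?thesis using True by simp
next
  case False
  define S where "S = synthetic_div R (- z)"
  have RS: "poly R x = (x + z) * poly S x + poly R (- z)" for x
    using arg_cong[OF synthetic_div_correct'[of "- z" R], of "\<lambda>p. poly p x"]
    by (simp add: S_def algebra_simps)
  have "poly R (real i) / (real i + z) = poly S (real i) + poly R (- z) * (1 / (real i + z))" for i
    using z by (simp add: RS[of "real i"] field_simps add_pos_nonneg)
  then have "(\<Sum>i\<le>m. (-1) ^ i * real (m choose i) * (poly R (real i) / (real i + z)))
      = (\<Sum>i\<le>m. (-1) ^ i * real (m choose i) * poly S (real i))
        + poly R (- z) * (\<Sum>i\<le>m. (-1) ^ i * real (m choose i) * (1 / (real i + z)))"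
    by (simp add: distrib_left sum.distrib sum_distrib_left mult_ac)
  moreover have "degree S < m" using R False by (simp add: S_def degree_synthetic_div)
  ultimately show ?thesis
    using alternating_binomial_poly[of S m] alternating_binomial_pole[OF z, of m] by simp
qed

section \<open>Moments and endpoint values of the Jacobi kernels\<close>

text \<open>Below \<open>A = \<mu> + 1\<close> and \<open>B = k + d / 2\<close>, and \<open>i\<close>, \<open>j\<close> are exponents of \<open>u = 1 - \<parallel>y\<parallel>\<^sup>2\<close>, so that
  \<open>Beta B (A + i + j)\<close> is the Gram matrix of the powers of \<open>u\<close>. The factor \<open>1 / (i + z)\<close> turns the
  moments into alternating sums of a polynomial of degree \<open>m\<close> over a linear factor, which only see
  the value of the polynomial at \<open>-z\<close>; for \<open>z = A\<close> and \<open>z = A + 1\<close> it vanishes for almost all \<open>j\<close>.\<close>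

definition jac :: "real \<Rightarrow> real \<Rightarrow> nat \<Rightarrow> real \<Rightarrow> nat \<Rightarrow> real" where
  "jac A B m z i = (-1) ^ i * real (m choose i) * Gamma (real m + A + B + real i) / Gamma (A + real i) / (real i + z)"

lemma not_nonpos_Int: "(x::real) > 0 \<Longrightarrow> x \<notin> \<int>\<^sub>\<le>\<^sub>0"
  by (meson nonpos_Ints_nonpos not_le)

lemma Gamma_quotient: "(x::real) > 0 \<Longrightarrow> Gamma (x + real n) = pochhammer x n * Gamma x"
  using pochhammer_Gamma[OF not_nonpos_Int, of x n] Gamma_real_pos[of x]
  by (metis less_irrefl nonzero_divide_eq_eq)

text \<open>Both quotients of Gamma values are Pochhammer products in \<open>i\<close>, of degrees
  \<open>j\<close> and \<open>m - j\<close>. Together they form \<open>R\<close>, whose degree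
  \<open>m\<close> is the largest that \<open>alternating_binomial_div\<close> admits.\<close>

lemma jac_moment:
  assumes A: "A > 0" and B: "B > 0" and z: "z > 0" and j: "j \<le> m"
  shows "(\<Sum>i\<le>m. jac A B m z i * Beta B (A + real i + real j))
    = Gamma B * (pochhammer (A - z) j * pochhammer (A + B - z + real j) (m - j))
      * (fact m / pochhammer z (Suc m))"
proof -
  define R :: "real poly" where
    "R = (\<Prod>r<j. [:A + real r, 1:]) * (\<Prod>r<m - j. [:A + B + real j + real r, 1:])"
  have "degree R \<le> j + (m - j)"
    unfolding R_def by (intro order.trans[OF degree_mult_le] add_mono order.trans[OF degree_prod_sum_le]) auto
  then have deg: "degree R \<le> m" using j by simp
  have R: "poly R x = pochhammer (A + x) j * pochhammer (A + B + x + real j) (m - j)" for x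
    by (simp add: R_def poly_prod pochhammer_prod atLeast0LessThan add_ac)
  have "jac A B m z i * Beta B (A + real i + real j)
      = Gamma B * ((-1) ^ i * real (m choose i) * (poly R (real i) / (real i + z)))" for i
  proof -
    have pos: "A + real i > 0" "A + B + real i + real j > 0" using A B by linarith+
    have 1: "Gamma (A + real i + real j) = pochhammer (A + real i) j * Gamma (A + real i)"
      using Gamma_quotient[OF pos(1)] .
    have 2: "Gamma (real m + A + B + real i)
        = pochhammer (A + B + real i + real j) (m - j) * Gamma (A + B + real i + real j)"
      using Gamma_quotient[OF pos(2), of "m - j"] j by (simp add: add_ac of_nat_diff)
    have 3: "Gamma (B + (A + real i + real j)) = Gamma (A + B + real i + real j)"
      by (simp add: add_ac)
    have "Gamma (A + real i) \<noteq> 0" "Gamma (A + B + real i + real j) \<noteq> 0"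
      using pos[THEN Gamma_real_pos] by linarith+
    then show ?thesis
      unfolding jac_def Beta_def R 1 2 3 by simp
  qed
  then have "(\<Sum>i\<le>m. jac A B m z i * Beta B (A + real i + real j))
      = Gamma B * (\<Sum>i\<le>m. (-1) ^ i * real (m choose i) * (poly R (real i) / (real i + z)))"
    by (simp add: sum_distrib_left)
  then show ?thesis
    unfolding alternating_binomial_div[OF deg z] by (simp add: R)
qed

text \<open>The reciprocal of the moment in \<open>jac_moment\<close> for \<open>z = A\<close> and
  \<open>j = 0\<close>.\<close>

definition jac_norm :: "real \<Rightarrow> real \<Rightarrow> nat \<Rightarrow> real" where
  "jac_norm A B m = pochhammer A (Suc m) / (Gamma B * pochhammer B m * fact m)"

text \<open>\<open>ev0\<close> and \<open>ev1\<close> are columns 0 and 1 of the inverse of the Gram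
  matrix of the powers of \<open>u\<close>. As polynomials in \<open>u\<close> they represent the
  value and the derivative at \<open>u = 0\<close>, the boundary of the ball.\<close>

definition ev0 :: "real \<Rightarrow> real \<Rightarrow> nat \<Rightarrow> nat \<Rightarrow> real" where
  "ev0 A B m i = jac_norm A B m * jac A B m A i"

text \<open>The moments of \<open>jac\<close> for \<open>z = A + 1\<close> vanish for
  \<open>j \<ge> 2\<close>. The second coefficient normalizes the one for \<open>j = 1\<close>, and
  the first cancels the one for \<open>j = 0\<close>.\<close>

definition ev1 :: "real \<Rightarrow> real \<Rightarrow> nat \<Rightarrow> nat \<Rightarrow> real" where
  "ev1 A B m i = (B - 1) * jac_norm A B m * jac A B m A i
     - jac_norm A B m * ((A + 1 + real m) * (B - 1 + real m) / A) * jac A B m (A + 1) i"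

definition jker :: "real \<Rightarrow> real \<Rightarrow> nat \<Rightarrow> real" where
  "jker A B m = ev0 A B m 0"

lemma ev0_moment:
  assumes A: "A > 0" and B: "B > 0" and j: "j \<le> m"
  shows "(\<Sum>i\<le>m. ev0 A B m i * Beta B (A + real i + real j)) = (if j = 0 then 1 else 0)"
proof -
  have pos: "pochhammer A (Suc m) > 0" "pochhammer B m > 0" "Gamma B > 0"
    using A B by (auto intro: pochhammer_pos Gamma_real_pos simp del: pochhammer_Suc)
  have "(\<Sum>i\<le>m. ev0 A B m i * Beta B (A + real i + real j))
      = jac_norm A B m * (\<Sum>i\<le>m. jac A B m A i * Beta B (A + real i + real j))"
    by (simp add: ev0_def sum_distrib_left mult.assoc)
  also have "\<dots> = (if j = 0 then 1 else 0)"
    unfolding jac_moment[OF A B A j] using pos by (simp add: jac_norm_def pochhammer_0_left del: pochhammer_Suc)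
  finally show ?thesis .
qed

lemma ev1_moment:
  assumes A: "A > 0" and B: "B > 0" and j: "j \<le> m"
  shows "(\<Sum>i\<le>m. ev1 A B m i * Beta B (A + real i + real j)) = (if j = 1 then 1 else 0)"
proof -
  define c where "c = jac_norm A B m"
  define S where "S z = (\<Sum>i\<le>m. jac A B m z i * Beta B (A + real i + real j))" for z
  have pos: "pochhammer A (Suc m) > 0" "pochhammer (A + 1) (Suc m) > 0" "pochhammer B m > 0" "Gamma B > 0"
    using A B by (auto intro: pochhammer_pos Gamma_real_pos simp del: pochhammer_Suc)
  have pA: "pochhammer A (Suc m) * (A + 1 + real m) = A * pochhammer (A + 1) (Suc m)"
    using pochhammer_rec[of A "Suc m"] pochhammer_Suc[of A "Suc m"] by (simp add: add_ac del: pochhammer_Suc)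
  have split: "(\<Sum>i\<le>m. ev1 A B m i * Beta B (A + real i + real j))
      = (B - 1) * c * S A - c * ((A + 1 + real m) * (B - 1 + real m) / A) * S (A + 1)"
    by (simp add: ev1_def S_def c_def left_diff_distrib sum_subtractf sum_distrib_left mult.assoc)
  have SA: "c * S A = (if j = 0 then 1 else 0)"
    using ev0_moment[OF assms] by (simp add: ev0_def S_def c_def sum_distrib_left mult.assoc)
  have S1: "S (A + 1) = Gamma B * (pochhammer (- 1) j * pochhammer (B - 1 + real j) (m - j))
      * (fact m / pochhammer (A + 1) (Suc m))"
    unfolding S_def using A B j by (subst jac_moment) (auto simp del: pochhammer_Suc)
  have c1: "c * (A + 1 + real m) / A * (Gamma B * X * (fact m / pochhammer (A + 1) (Suc m)))
      = X / pochhammer B m" for X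
  proof -
    have "c * (A + 1 + real m) / A * (Gamma B * X * (fact m / pochhammer (A + 1) (Suc m)))
      = (pochhammer A (Suc m) * (A + 1 + real m)) / (A * pochhammer (A + 1) (Suc m)) * (X / pochhammer B m)"
      using pos A by (simp add: c_def jac_norm_def field_simps del: pochhammer_Suc)
    then show ?thesis unfolding pA using pos A by (simp del: pochhammer_Suc)
  qed
  have main: "c * ((A + 1 + real m) * (B - 1 + real m) / A) * S (A + 1)
      = (B - 1 + real m) * (pochhammer (- 1) j * pochhammer (B - 1 + real j) (m - j)) / pochhammer B m"
    using c1[of "(B - 1 + real m) * (pochhammer (- 1) j * pochhammer (B - 1 + real j) (m - j))"]
    unfolding S1 by (simp add: mult_ac del: pochhammer_Suc)
  consider "j = 0" | "j = 1" | r where "j = Suc (Suc r)" by (cases j; cases "j - 1"; auto)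
  then show ?thesis
  proof cases
    case 1
    have "(B - 1 + real m) * pochhammer (B - 1) m = (B - 1) * pochhammer B m"
      using pochhammer_rec[of "B - 1" m] pochhammer_Suc[of "B - 1" m] by (simp add: mult.commute)
    then show ?thesis unfolding split main using 1 SA pos by (simp add: mult.assoc)
  next
    case 2
    then obtain r where r: "m = Suc r" using j by (cases m) auto
    have "(B - 1 + real m) * pochhammer B (m - 1) = pochhammer B m"
      unfolding r by (simp add: algebra_simps pochhammer_Suc)
    then show ?thesis unfolding split main using 2 SA pos by (simp add: mult.assoc)
  next
    case 3
    have "pochhammer (- 1 :: real) (Suc (Suc r)) = 0"
      by (simp add: pochhammer_rec[of _ "Suc r"] pochhammer_rec[of _ r] del: pochhammer_Suc)
    then show ?thesis unfolding split main using 3 SA by simp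
  qed
qed

lemma jker_eq:
  "jker A B m = jac_norm A B m * (Gamma (real m + A + B) / Gamma A / A)"
  by (simp add: jker_def ev0_def jac_def)

lemma jac_1:
  assumes "A > 0" "B > 0"
  shows "jac A B m z 1 = - (real m * (real m + A + B)) * (Gamma (real m + A + B) / Gamma A / A) / (1 + z)"
proof -
  have "Gamma (real m + A + B + 1) = (real m + A + B) * Gamma (real m + A + B)"
    using assms by (intro Gamma_plus1 not_nonpos_Int) (simp add: add_nonneg_pos)
  moreover have "Gamma (A + 1) = A * Gamma A"
    using assms by (intro Gamma_plus1 not_nonpos_Int)
  ultimately show ?thesis by (simp add: jac_def mult_ac)
qed

text \<open>With \<open>jker\<close>, \<open>ev1_0\<close> and \<open>ev1_1\<close> this is the
  upper left two by two block of the inverse Gram matrix, all that the functional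
  \<open>k q(0) - 2 q'(0)\<close> sees; the agreement with \<open>ev1_0\<close> is the symmetry of
  that matrix.\<close>

lemma ev0_1:
  assumes "A > 0" "B > 0"
  shows "ev0 A B m 1 = - jker A B m * (real m * (real m + A + B)) / (A + 1)"
  using assms by (simp add: ev0_def jac_1[OF assms, simplified] jker_eq add_ac)

lemma ev1_0:
  assumes "A > 0" "B > 0"
  shows "ev1 A B m 0 = - jker A B m * (real m * (real m + A + B)) / (A + 1)"
proof -
  define g where "g = Gamma (real m + A + B) / Gamma A / A"
  have j0: "jac A B m A 0 = g" "jac A B m (A + 1) 0 = g * A / (A + 1)"
    using assms by (simp_all add: jac_def g_def)
  have "ev1 A B m 0 = jac_norm A B m * g * ((B - 1) - (A + 1 + real m) * (B - 1 + real m) / (A + 1))"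
  proof -
    have "e * c * g - c * (U / A) * (g * A / (A + 1)) = c * g * (e - U / (A + 1))" for e c U
      using assms by (simp add: right_diff_distrib mult_ac)
    then show ?thesis unfolding ev1_def j0 .
  qed
  also have "(B - 1) - (A + 1 + real m) * (B - 1 + real m) / (A + 1) = - (real m * (real m + A + B)) / (A + 1)"
    using assms by (simp add: divide_simps) (simp add: algebra_simps)
  finally show ?thesis by (simp add: jker_eq g_def)
qed

lemma ev1_1:
  fixes m :: nat
  assumes "A > 0" "B > 0"
  defines "s \<equiv> real m * (real m + A + B)"
  shows "ev1 A B m 1 = jker A B m * s * (s + (B - 1) / (A + 1)) / (A * (A + 2))"
proof -
  define g where "g = Gamma (real m + A + B) / Gamma A / A"
  have "ev1 A B m 1 = jac_norm A B m * g * s *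
      ((A + 1 + real m) * (B - 1 + real m) / (A * (A + 2)) - (B - 1) / (A + 1))"
  proof -
    have "e * c * (- s * g / (A + 1)) - c * (U / A) * (- s * g / (A + 2))
        = c * g * s * (U / (A * (A + 2)) - e / (A + 1))" for e c U
      using assms by (simp add: right_diff_distrib mult_ac)
    moreover have "jac A B m A 1 = - s * g / (A + 1)" "jac A B m (A + 1) 1 = - s * g / (A + 2)"
      unfolding jac_1[OF assms(1,2)] g_def[symmetric] s_def[symmetric] by (simp_all add: add_ac)
    ultimately show ?thesis unfolding ev1_def by simp
  qed
  also have "(A + 1 + real m) * (B - 1 + real m) = s + (B - 1) * (A + 1)"
    by (simp add: s_def algebra_simps)
  also have "(s + (B - 1) * (A + 1)) / (A * (A + 2)) - (B - 1) / (A + 1)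
      = (s + (B - 1) / (A + 1)) / (A * (A + 2))"
  proof -
    have "E * (A + 1) / (A * (A + 2)) - E / (A + 1) = E / (A + 1) / (A * (A + 2))" for E
      using assms(1) by (simp add: divide_simps) (simp add: algebra_simps)
    from this[of "B - 1"] show ?thesis by (simp add: add_divide_distrib)
  qed
  finally show ?thesis by (simp add: jker_eq g_def)
qed

lemma ev_zero: "m < i \<Longrightarrow> ev0 A B m i = 0" "m < i \<Longrightarrow> ev1 A B m i = 0"
  by (simp_all add: ev0_def ev1_def jac_def binomial_eq_0)


section \<open>The rank one perturbation of the Jacobi kernel\<close>

text \<open>For \<open>Y\<close> homogeneous of degree \<open>k\<close>, the normal derivative of \<open>(1 - \<parallel>y\<parallel>\<^sup>2) ^ j * Y y\<close> on the sphere
  is \<open>tau k j * Y y\<close>. The formula for \<open>sev\<close> is Sherman--Morrison's for a rank one perturbation.\<close>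

definition tau :: "nat \<Rightarrow> nat \<Rightarrow> real" where
  "tau k j = (if j = 0 then real k else if j = 1 then -2 else 0)"

text \<open>The kernel at the endpoint 0 for the weight
  \<open>u powr (A - 1) * (1 - u) powr (B - 1)\<close> is a multiple of the Jacobi polynomial with
  parameters \<open>A\<close> and \<open>B - 1\<close>; this is its eigenvalue in degree
  \<open>m\<close>.\<close>

definition jeig :: "real \<Rightarrow> real \<Rightarrow> nat \<Rightarrow> real" where
  "jeig A B m = real m * (real m + A + B)"

text \<open>With \<open>G\<close> the Gram matrix, \<open>e\<close> the first unit vector and
  \<open>t\<close> the vector \<open>tau k\<close>, this is the scalar product of \<open>t\<close>
  with \<open>G^-1 e\<close> in closed form, and \<open>tau_tau\<close> is that of \<open>t\<close>
  with \<open>G^-1 t\<close>.\<close>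

definition tau_ev :: "nat \<Rightarrow> real \<Rightarrow> real \<Rightarrow> nat \<Rightarrow> real" where
  "tau_ev k A B m = jker A B m * (real k + 2 * jeig A B m / (A + 1))"

definition tau_tau :: "nat \<Rightarrow> real \<Rightarrow> real \<Rightarrow> nat \<Rightarrow> real" where
  "tau_tau k A B m = jker A B m * ((real k)\<^sup>2 + 4 * real k * jeig A B m / (A + 1)
     + 4 * jeig A B m * (jeig A B m + (B - 1) / (A + 1)) / (A * (A + 2)))"

definition sev :: "real \<Rightarrow> nat \<Rightarrow> real \<Rightarrow> real \<Rightarrow> nat \<Rightarrow> nat \<Rightarrow> real" where
  "sev L k A B m i = ev0 A B m i
     - L * tau_ev k A B m / (1 + L * tau_tau k A B m) * (real k * ev0 A B m i - 2 * ev1 A B m i)"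

definition sratio :: "real \<Rightarrow> nat \<Rightarrow> real \<Rightarrow> real \<Rightarrow> nat \<Rightarrow> real" where
  "sratio L k A B m = 1 - L * tau_ev k A B m * (real k + 2 * jeig A B m / (A + 1)) / (1 + L * tau_tau k A B m)"

text \<open>The vanishing of \<open>c\<close> beyond \<open>m\<close> serves the case
  \<open>m = 0\<close>, where the index 1 lies outside the sum.\<close>

lemma sum_tau:
  assumes "\<And>i. m < i \<Longrightarrow> c i = 0"
  shows "(\<Sum>i\<le>m. c i * tau k i) = real k * c 0 - 2 * c 1"
proof -
  have "(\<Sum>i\<le>m. c i * tau k i) = (\<Sum>i\<le>m. if i = 0 then real k * c 0 else 0) + (\<Sum>i\<le>m. if i = 1 then - 2 * c 1 else 0)"
    unfolding sum.distrib[symmetric] by (intro sum.cong) (auto simp: tau_def)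
  also have "\<dots> = real k * c 0 - 2 * c 1"
    using assms[of 1] by (cases "m \<ge> 1") (simp_all add: not_le)
  finally show ?thesis .
qed

lemma jker_pos:
  assumes "A > 0" "B > 0"
  shows "jker A B m > 0"
  using assms by (simp add: jker_eq jac_norm_def)
    (auto intro!: divide_pos_pos mult_pos_pos pochhammer_pos Gamma_real_pos simp del: pochhammer_Suc simp: pochhammer_Suc[symmetric])

lemma jeig_nonneg: "A > 0 \<Longrightarrow> B > 0 \<Longrightarrow> jeig A B m \<ge> 0"
  by (simp add: jeig_def)

lemma tau_tau_nonneg:
  assumes "A > 0" "B \<ge> 1"
  shows "tau_tau k A B m \<ge> 0"
  using assms jker_pos[of A B m] jeig_nonneg[of A B m] unfolding tau_tau_def
  by (intro mult_nonneg_nonneg add_nonneg_nonneg divide_nonneg_nonneg) auto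

text \<open>The left side is row \<open>j\<close> of the Gram matrix, perturbed by \<open>L\<close>
  times the square of \<open>tau k\<close>, applied to \<open>sev\<close>. The scalar
  \<open>C\<close> solves \<open>C = L (tau_ev - C tau_tau)\<close>, which makes the correction
  cancel the rank one term.\<close>

lemma sev_moment:
  assumes A: "A > 0" and B: "B \<ge> 1" and L: "L \<ge> 0" and j: "j \<le> m"
  shows "(\<Sum>i\<le>m. sev L k A B m i * Beta B (A + real i + real j))
      + L * tau k j * (\<Sum>i\<le>m. sev L k A B m i * tau k i) = (if j = 0 then 1 else 0)"
proof -
  have B0: "B > 0" using B by simp
  define C where "C = L * tau_ev k A B m / (1 + L * tau_tau k A B m)"
  have D: "1 + L * tau_tau k A B m > 0" using tau_tau_nonneg[OF A B, of k m] L by (simp add: add_pos_nonneg)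
  have sev: "sev L k A B m i = ev0 A B m i - C * (real k * ev0 A B m i - 2 * ev1 A B m i)" for i
    by (simp add: sev_def C_def)
  have 1: "(\<Sum>i\<le>m. sev L k A B m i * Beta B (A + real i + real j))
      = (if j = 0 then 1 else 0) - C * tau k j"
  proof -
    have "(\<Sum>i\<le>m. sev L k A B m i * Beta B (A + real i + real j))
      = (\<Sum>i\<le>m. ev0 A B m i * Beta B (A + real i + real j))
        - C * (real k * (\<Sum>i\<le>m. ev0 A B m i * Beta B (A + real i + real j))
          - 2 * (\<Sum>i\<le>m. ev1 A B m i * Beta B (A + real i + real j)))"
      by (simp add: sev left_diff_distrib right_diff_distrib sum_subtractf sum_distrib_left mult.assoc)
    then show ?thesis using ev0_moment[OF A B0 j] ev1_moment[OF A B0 j] by (simp add: tau_def)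
  qed
  have "(\<Sum>i\<le>m. sev L k A B m i * tau k i) = real k * sev L k A B m 0 - 2 * sev L k A B m 1"
    by (intro sum_tau) (simp add: sev ev_zero)
  also have "\<dots> = tau_ev k A B m - C * tau_tau k A B m"
  proof -
    define K where "K = jker A B m"
    define p where "p = jeig A B m / (A + 1)"
    define q where "q = jeig A B m * (jeig A B m + (B - 1) / (A + 1)) / (A * (A + 2))"
    have "ev0 A B m 0 = K" "ev0 A B m 1 = - (K * p)" "ev1 A B m 0 = - (K * p)" "ev1 A B m 1 = K * q"
      using ev0_1[OF A B0, of m] ev1_0[OF A B0, of m] ev1_1[OF A B0, of m]
      by (simp_all add: K_def p_def q_def jker_def jeig_def)
    moreover have "tau_ev k A B m = K * (real k + 2 * p)"
      "tau_tau k A B m = K * ((real k)\<^sup>2 + 4 * real k * p + 4 * q)"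
      by (simp_all add: tau_ev_def tau_tau_def K_def p_def q_def mult.assoc)
    ultimately show ?thesis unfolding sev by (simp add: algebra_simps power2_eq_square)
  qed
  also have "\<dots> = tau_ev k A B m / (1 + L * tau_tau k A B m)"
    using D by (simp add: C_def field_simps)
  finally have "L * (\<Sum>i\<le>m. sev L k A B m i * tau k i) = C" by (simp add: C_def)
  then have "L * tau k j * (\<Sum>i\<le>m. sev L k A B m i * tau k i) = C * tau k j"
    by (simp add: mult.commute mult.left_commute)
  then show ?thesis unfolding 1 by simp
qed

lemma sev_0:
  assumes "A > 0" "B > 0"
  shows "sev L k A B m 0 = jker A B m * sratio L k A B m"
proof -
  have "real k * jker A B m - 2 * (- jker A B m * jeig A B m / (A + 1))
      = jker A B m * (real k + 2 * jeig A B m / (A + 1))"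
    by (simp add: algebra_simps)
  then show ?thesis
    unfolding sev_def sratio_def ev1_0[OF assms] jker_def[symmetric] jeig_def[symmetric]
    by (simp only:) (simp add: right_diff_distrib mult_ac)
qed

text \<open>Nonnegativity is the Cauchy-Schwarz inequality
  \<open>tau_ev^2 \<le> jker * tau_tau\<close>; in the closed forms it comes down to
  \<open>A (A + 2) \<le> (A + 1)^2\<close> and \<open>B \<ge> 1\<close>.\<close>

lemma sratio_bounds:
  assumes A: "A > 0" and B: "B \<ge> 1" and L: "L \<ge> 0"
  shows "0 \<le> sratio L k A B m" "sratio L k A B m \<le> 1"
proof -
  define s where "s = jeig A B m"
  define K where "K = jker A B m"
  have K: "K > 0" and s: "s \<ge> 0" using jker_pos[of A B m] jeig_nonneg[of A B m] A B by (auto simp: K_def s_def)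
  have D: "1 + L * tau_tau k A B m > 0" using tau_tau_nonneg[OF A B, of k m] L by (simp add: add_pos_nonneg)
  have "A * (A + 2) \<le> (A + 1)\<^sup>2" by (simp add: power2_eq_square algebra_simps)
  then have "4 * s * s / (A + 1)\<^sup>2 \<le> 4 * s * s / (A * (A + 2))"
    using A s by (intro divide_left_mono mult_pos_pos zero_less_power) auto
  also have "\<dots> \<le> 4 * s * (s + (B - 1) / (A + 1)) / (A * (A + 2))"
    using A B s by (intro divide_right_mono mult_left_mono) auto
  finally have *: "4 * s * s / (A + 1)\<^sup>2 \<le> 4 * s * (s + (B - 1) / (A + 1)) / (A * (A + 2))" .
  have "(real k + 2 * s / (A + 1))\<^sup>2
      \<le> (real k)\<^sup>2 + 4 * real k * s / (A + 1) + 4 * s * (s + (B - 1) / (A + 1)) / (A * (A + 2))"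
  proof -
    define p where "p = s / (A + 1)"
    have "4 * s * s / (A + 1)\<^sup>2 = 4 * p\<^sup>2" "4 * real k * s / (A + 1) = 4 * real k * p"
      "2 * s / (A + 1) = 2 * p"
      by (simp_all add: p_def power_divide power2_eq_square)
    moreover have "(real k + 2 * p)\<^sup>2 = (real k)\<^sup>2 + 4 * real k * p + 4 * p\<^sup>2"
      by (simp add: power2_eq_square algebra_simps)
    ultimately show ?thesis using * by simp
  qed
  then have "K * (real k + 2 * s / (A + 1))\<^sup>2 \<le> tau_tau k A B m"
    using K unfolding tau_tau_def K_def s_def by (intro mult_left_mono) auto
  from mult_left_mono[OF this L]
  have le: "L * tau_ev k A B m * (real k + 2 * s / (A + 1)) \<le> L * tau_tau k A B m"
    by (simp add: tau_ev_def K_def s_def power2_eq_square mult.assoc)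
  have "L * tau_ev k A B m * (real k + 2 * s / (A + 1)) / (1 + L * tau_tau k A B m) \<le> 1"
    using le D by (simp add: divide_le_eq_1)
  then show "0 \<le> sratio L k A B m" by (simp add: sratio_def s_def)
  have "0 \<le> L * tau_ev k A B m * (real k + 2 * s / (A + 1))"
    using L K s A unfolding tau_ev_def K_def s_def by (intro mult_nonneg_nonneg add_nonneg_nonneg divide_nonneg_nonneg) auto
  then show "sratio L k A B m \<le> 1"
    using D by (simp add: sratio_def s_def divide_nonneg_pos)
qed

section \<open>Growth of the Jacobi kernel in its degree, uniformly in \<open>B\<close>\<close>

lemma jker_Suc:
  assumes "A > 0" "B > 0"
  shows "jker A B (Suc m) = jker A B m * ((A + real m + 1) * (A + B + real m) / ((real m + 1) * (B + real m)))"
proof -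
  have "Gamma (real m + A + B + 1) = (real m + A + B) * Gamma (real m + A + B)"
    using assms by (intro Gamma_plus1 not_nonpos_Int) (simp add: add_nonneg_pos)
  then have 1: "Gamma (real (Suc m) + A + B) = (real m + A + B) * Gamma (real m + A + B)"
    by (simp add: add_ac)
  have pos: "pochhammer A (Suc m) > 0" "pochhammer B m > 0" "Gamma B > 0" "Gamma A > 0" "B + real m > 0"
    using assms by (auto intro: pochhammer_pos Gamma_real_pos simp del: pochhammer_Suc)
  have 2: "pochhammer A (Suc (Suc m)) = pochhammer A (Suc m) * (A + real m + 1)"
    by (subst pochhammer_Suc) (simp add: add_ac del: pochhammer_Suc)
  show ?thesis
    unfolding jker_eq jac_norm_def 1 2 pochhammer_Suc[of B m] fact_Suc
    by (simp add: ac_simps)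
qed

text \<open>The factor \<open>(A + B + m) / (B + m)\<close> of the recurrence is at least 1, which
  removes \<open>B\<close> from the bound.\<close>

lemma jker_Suc_ge:
  assumes "A > 0" "B > 0"
  shows "jker A B m * (1 + A / (real m + 1)) \<le> jker A B (Suc m)"
proof -
  have "1 + A / (real m + 1) = (A + real m + 1) * 1 / (real m + 1)" by (simp add: field_simps)
  also have "\<dots> \<le> (A + real m + 1) * ((A + B + real m) / (B + real m)) / (real m + 1)"
    using assms by (intro divide_right_mono mult_left_mono) auto
  also have "\<dots> = (A + real m + 1) * (A + B + real m) / ((real m + 1) * (B + real m))"
    by (simp add: mult.commute)
  finally show ?thesis
    unfolding jker_Suc[OF assms] using jker_pos[OF assms, of m] by (intro mult_left_mono) auto
qed

text \<open>In degree 0 the kernel is \<open>1 / Beta B A\<close>, and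
  \<open>Beta B A \<le> Beta 1 A = 1 / A\<close>. Being uniform in \<open>k\<close>, the bound makes
  the contribution of \<open>1\<close> to the denominator \<open>1 + L * tau_tau\<close> of the
  ratio negligible.\<close>

lemma jker_lower:
  assumes A: "A > 0" and B: "B \<ge> 1"
  shows "jker A B m \<ge> A"
proof (induction m)
  case 0
  have B0: "B > 0" using B by simp
  have "Beta B A \<le> Beta 1 A"
  proof (rule has_integral_le[OF has_integral_Beta_real[OF B0 A] has_integral_Beta_real[OF _ A]])
    show "t powr (B - 1) * (1 - t) powr (A - 1) \<le> t powr (1 - 1) * (1 - t) powr (A - 1)"
      if "t \<in> {0..1}" for t
      using that B by (cases "t = 0") (auto intro!: mult_left_le_one_le powr_le1)
  qed simp
  also have "Beta 1 A = 1 / A"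
    using A Gamma_plus1[OF not_nonpos_Int[OF A]]
    by (simp add: Beta_def add.commute less_imp_neq[OF Gamma_real_pos[OF A], symmetric])
  finally have "Beta B A \<le> 1 / A" .
  moreover have "jker A B 0 = 1 / Beta B A"
    using A B0 by (simp add: jker_eq jac_norm_def Beta_def add.commute)
  moreover have "Beta B A > 0" using A B0 by (rule Beta_real_pos[rotated])
  moreover from calculation have "A \<le> 1 / Beta B A" using A by (simp add: field_simps)
  ultimately show ?case by simp
next
  case (Suc m)
  have B0: "B > 0" using B by simp
  have "jker A B m * 1 \<le> jker A B m * (1 + A / (real m + 1))"
    using jker_pos[OF A B0, of m] A by (intro mult_left_mono) auto
  then show ?case using Suc jker_Suc_ge[OF A B0, of m] by simp
qed

text \<open>A product of factors \<open>1 + a\<close> dominates 1 plus the sum of the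
  \<open>a\<close>. The increments are taken at indices from \<open>M\<close> on instead of
  \<open>m\<close>, for a bound valid for all \<open>m \<le> M\<close> at once.\<close>

lemma jker_growth:
  assumes A: "A > 0" and B: "B > 0" and "m \<le> M"
  shows "jker A B m * (1 + A * (\<Sum>i<N. 1 / (real (M + i) + 1))) \<le> jker A B (m + N)"
proof (induction N)
  case (Suc N)
  define S where "S = (\<Sum>i<N. 1 / (real (M + i) + 1))"
  have S: "S \<ge> 0" unfolding S_def by (intro sum_nonneg) auto
  have K: "jker A B m > 0" by (rule jker_pos[OF A B])
  have "jker A B m * (1 + A * (\<Sum>i<Suc N. 1 / (real (M + i) + 1)))
      = jker A B m * (1 + A * S) + jker A B m * (A / (real (M + N) + 1))"
    by (simp add: S_def algebra_simps)
  also have "\<dots> \<le> jker A B (m + N) + jker A B (m + N) * (A / (real (m + N) + 1))"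
  proof (intro add_mono mult_mono)
    show "jker A B m * (1 + A * S) \<le> jker A B (m + N)" using Suc by (simp add: S_def)
    have "jker A B m * 1 \<le> jker A B m * (1 + A * S)" using K A S by (intro mult_left_mono) auto
    then show "jker A B m \<le> jker A B (m + N)" using Suc by (simp add: S_def)
    show "A / (real (M + N) + 1) \<le> A / (real (m + N) + 1)"
      using A \<open>m \<le> M\<close> by (intro divide_left_mono) auto
  qed (use A less_imp_le[OF jker_pos[OF A B]] in auto)
  also have "\<dots> \<le> jker A B (Suc (m + N))"
    using jker_Suc_ge[OF A B, of "m + N"] by (simp add: distrib_left)
  finally show ?case by simp
qed simp

text \<open>The harmonic series diverges, so \<open>N\<close> steps multiply the kernel by at least
  \<open>1 / \<epsilon>\<close>, with \<open>N\<close> depending on \<open>M\<close> but not on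
  \<open>B\<close>.\<close>

lemma jker_small_index:
  assumes A: "A > 0" and \<epsilon>: "\<epsilon> > 0"
  shows "\<exists>N. \<forall>m\<le>M. \<forall>B>0. jker A B m \<le> \<epsilon> * jker A B (m + N)"
proof -
  have "\<not> summable (\<lambda>i. 1 / (real (M + i) + 1))"
  proof
    assume "summable (\<lambda>i. 1 / (real (M + i) + 1))"
    then have "summable (\<lambda>i. inverse (real (Suc (i + M))))" by (simp add: add_ac inverse_eq_divide)
    then have "summable (\<lambda>i. inverse (real i))"
      using summable_iff_shift[of "\<lambda>i. inverse (real i)" "Suc M"] by simp
    then show False using not_summable_harmonic[where 'a=real] by simp
  qed
  then have "\<exists>N. (\<Sum>i<N. 1 / (real (M + i) + 1)) > 1 / (\<epsilon> * A)"
    using summableI_nonneg_bounded[of "\<lambda>i. 1 / (real (M + i) + 1)" "1 / (\<epsilon> * A)"]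
    by (meson not_le of_nat_0_le_iff zero_le_divide_1_iff add_nonneg_nonneg zero_le_one)
  then obtain N where N: "(\<Sum>i<N. 1 / (real (M + i) + 1)) > 1 / (\<epsilon> * A)" ..
  have "jker A B m \<le> \<epsilon> * jker A B (m + N)" if "m \<le> M" "B > 0" for m B
  proof -
    have "1 \<le> \<epsilon> * (A * (\<Sum>i<N. 1 / (real (M + i) + 1)))"
      using N A \<epsilon> by (simp add: field_simps)
    also have "\<dots> \<le> \<epsilon> * (1 + A * (\<Sum>i<N. 1 / (real (M + i) + 1)))"
      using \<epsilon> by (intro mult_left_mono) auto
    finally have "jker A B m * 1 \<le> jker A B m * (\<epsilon> * (1 + A * (\<Sum>i<N. 1 / (real (M + i) + 1))))"
      using jker_pos[OF A that(2), of m] by (intro mult_left_mono) auto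
    also have "\<dots> \<le> \<epsilon> * jker A B (m + N)"
      using mult_left_mono[OF jker_growth[OF A that(2,1), of N], of \<epsilon>] \<epsilon> by (simp add: mult_ac)
    finally show ?thesis by simp
  qed
  then show ?thesis by blast
qed

text \<open>After division by \<open>s\<^sup>2\<close> with \<open>s\<close> the Jacobi eigenvalue, the ratio is a fixed rational
  function of \<open>k / s\<close>, \<open>(B - 1) / s\<close> and \<open>1 / (L K s\<^sup>2)\<close>, which are all \<open>O(1/m)\<close> uniformly in \<open>k\<close>.\<close>

lemma sratio_limit:
  fixes h :: real
  assumes A: "A > 0" and h: "h \<ge> 1" and L: "L > 0" and \<epsilon>: "\<epsilon> > 0"
  shows "\<exists>M. \<forall>m\<ge>M. \<forall>k. \<bar>sratio L k A (real k + h) m - 1 / (A + 1)\<^sup>2\<bar> < \<epsilon>"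
proof -
  define F where "F = (\<lambda>p::real \<times> real \<times> real.
    1 - (fst p + 2 / (A + 1))\<^sup>2 / (snd (snd p) + (fst p)\<^sup>2 + 4 * fst p / (A + 1)
      + 4 * (1 + fst (snd p) / (A + 1)) / (A * (A + 2))))"
  have A2: "A * (A + 2) > 0" using A by simp
  have "(F \<longlongrightarrow> F (0, 0, 0)) (nhds (0, 0, 0))"
    unfolding F_def using A A2 by (intro tendsto_intros filterlim_ident) auto
  \<comment> \<open>At the origin the ratio is \<open>1 - A (A + 2) / (A + 1)^2\<close>, the source
    of the rational factor in both limits.\<close>
  moreover have "F (0, 0, 0) = 1 / (A + 1)\<^sup>2"
    unfolding F_def using A by (simp add: power_divide divide_simps) (simp add: power2_eq_square algebra_simps)
  ultimately have "\<forall>\<^sub>F p in nhds (0, 0, 0). \<bar>F p - 1 / (A + 1)\<^sup>2\<bar> < \<epsilon>"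
    using \<epsilon> by (simp add: tendsto_iff dist_real_def)
  then obtain \<delta> where \<delta>: "\<delta> > 0" and F: "\<And>p. dist p (0, 0, 0) < \<delta> \<Longrightarrow> \<bar>F p - 1 / (A + 1)\<^sup>2\<bar> < \<epsilon>"
    unfolding eventually_nhds_metric by blast
  \<comment> \<open>Below, \<open>x\<close> and \<open>y\<close> are at most \<open>1 / m\<close>
    and \<open>w\<close> is at most \<open>1 / (L A m)\<close>; \<open>C\<close> dominates both
    numerators, and the 3 counts the coordinates.\<close>
  define C where "C = max 1 (1 / (L * A))"
  have C: "C \<ge> 1" "C \<ge> 1 / (L * A)" by (auto simp: C_def)
  obtain M :: nat where M: "3 * C / \<delta> < real M" using reals_Archimedean2 by blast
  have "\<bar>sratio L k A (real k + h) m - 1 / (A + 1)\<^sup>2\<bar> < \<epsilon>" if m: "m \<ge> Suc M" for m k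
  proof -
    define B where "B = real k + h"
    define s where "s = jeig A B m"
    define K where "K = jker A B m"
    have B: "B \<ge> 1" using h by (simp add: B_def)
    have m1: "real m \<ge> 1" using m by simp
    have s_ge: "s \<ge> real m * (real m + B)" unfolding s_def jeig_def using A by (intro mult_left_mono) auto
    have "real m * B \<le> real m * (real m + B)" by (intro mult_left_mono) auto
    then have sB: "s \<ge> real m * B" using s_ge by linarith
    have "real m * 1 \<le> real m * B" using B by (intro mult_left_mono) auto
    then have sm: "s \<ge> real m" using sB by linarith
    then have s: "s > 0" using m1 by linarith
    have K: "K \<ge> A" unfolding K_def using A B by (rule jker_lower)
    have K0: "K > 0" using K A by linarith
    define x where "x = real k / s"
    define y where "y = (B - 1) / s"
    define w where "w = 1 / (L * K * s\<^sup>2)"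
    have x: "0 \<le> x" "x \<le> 1 / real m"
    proof -
      have "real m * real k \<le> real m * B" using h by (intro mult_left_mono) (auto simp: B_def)
      from order.trans[OF this sB] show "x \<le> 1 / real m" using s m1 by (simp add: x_def field_simps)
    qed (use s in \<open>simp add: x_def\<close>)
    have y: "0 \<le> y" "y \<le> 1 / real m"
    proof -
      have "real m * (B - 1) \<le> real m * B" by (intro mult_left_mono) auto
      from order.trans[OF this sB] show "y \<le> 1 / real m" using s m1 by (simp add: y_def field_simps)
    qed (use s B in \<open>simp add: y_def\<close>)
    have w: "0 \<le> w" "w \<le> (1 / (L * A)) / real m"
    proof -
      have "s * 1 \<le> s * s" using sm m1 s by (intro mult_left_mono) auto
      then have "real m \<le> s\<^sup>2" using sm by (simp add: power2_eq_square)
      then have "L * A * real m \<le> L * K * s\<^sup>2"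
        using K L A K0 by (intro mult_mono) auto
      then have "1 / (L * K * s\<^sup>2) \<le> 1 / (L * A * real m)"
        using L A m1 K0 s by (intro divide_left_mono) auto
      then show "w \<le> (1 / (L * A)) / real m" by (simp add: w_def)
    qed (use L K0 in \<open>simp add: w_def\<close>)
    have Cm: "1 / real m \<le> C / real m" "(1 / (L * A)) / real m \<le> C / real m"
      using divide_right_mono[OF C(1), of "real m"] divide_right_mono[OF C(2), of "real m"] by simp_all
    have "dist (x, y, w) (0, 0, 0) = norm (x, y, w)" by (simp add: dist_norm)
    also have "\<dots> \<le> \<bar>x\<bar> + (\<bar>y\<bar> + \<bar>w\<bar>)"
      using norm_Pair_le[of x "(y, w)"] norm_Pair_le[of y w] by simp
    also have "\<dots> \<le> 3 * C / real m" using x y w Cm by simp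
    also have "\<dots> < \<delta>"
    proof -
      have "3 * C < \<delta> * real M" using M \<delta> by (simp add: field_simps)
      also have "\<dots> \<le> \<delta> * real m" using m \<delta> by (intro mult_left_mono) auto
      finally show ?thesis using m1 by (simp add: field_simps)
    qed
    finally have "\<bar>F (x, y, w) - 1 / (A + 1)\<^sup>2\<bar> < \<epsilon>" by (rule F)
    moreover have "sratio L k A B m = F (x, y, w)"
    proof -
      have e1: "real k + 2 * s / (A + 1) = s * (x + 2 / (A + 1))"
        using s by (simp add: x_def distrib_left)
      have e2: "1 + L * tau_tau k A B m = L * K * s\<^sup>2 * (w + x\<^sup>2 + 4 * x / (A + 1) + 4 * (1 + y / (A + 1)) / (A * (A + 2)))"
      proof -
        have "1 = L * K * s\<^sup>2 * w" using L K0 s by (simp add: w_def)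
        moreover have "(real k)\<^sup>2 = s\<^sup>2 * x\<^sup>2" using s by (simp add: x_def power_divide)
        moreover have "4 * real k * s / (A + 1) = s\<^sup>2 * (4 * x / (A + 1))"
          using s by (simp add: x_def power2_eq_square)
        moreover have "4 * s * (s + (B - 1) / (A + 1)) / (A * (A + 2)) = s\<^sup>2 * (4 * (1 + y / (A + 1)) / (A * (A + 2)))"
        proof -
          have "B - 1 = s * y" using s by (simp add: y_def)
          then have "s + (B - 1) / (A + 1) = s * (1 + y / (A + 1))" by (simp add: distrib_left)
          then show ?thesis by (simp add: power2_eq_square mult_ac)
        qed
        ultimately show ?thesis
          unfolding tau_tau_def K_def[symmetric] s_def[symmetric] by (simp only: distrib_left mult.assoc)
      qed
      have "sratio L k A B m = 1 - (L * K * s\<^sup>2) * (x + 2 / (A + 1))\<^sup>2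
          / ((L * K * s\<^sup>2) * (w + x\<^sup>2 + 4 * x / (A + 1) + 4 * (1 + y / (A + 1)) / (A * (A + 2))))"
        unfolding sratio_def e2 tau_ev_def K_def[symmetric] s_def[symmetric] e1
        by (simp add: power2_eq_square mult_ac)
      also have "\<dots> = F (x, y, w)"
        using L K0 s by (simp add: F_def)
      finally show ?thesis .
    qed
    ultimately show ?thesis by (simp add: B_def)
  qed
  then show ?thesis by blast
qed

section \<open>The ball kernel at a boundary point\<close>

lemma Beta_bochner:
  fixes A B :: real
  assumes A: "A > 0" and B: "B > 0"
  shows "has_bochner_integral lborel
    (\<lambda>u. indicator {0..1} u * (u ^ j * (u powr (A - 1) * (1 - u) powr (B - 1)))) (Beta (A + real j) B)"
proof (rule has_bochner_integral_nn_integral)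
  have pos: "A + real j > 0" using A by linarith
  have eq: "u ^ j * (u powr (A - 1) * (1 - u) powr (B - 1)) = u powr (A + real j - 1) * (1 - u) powr (B - 1)"
    if "u \<in> {0..1}" for u :: real
  proof (cases "u = 0")
    case False
    then have "u > 0" using that by auto
    then have "u ^ j * u powr (A - 1) = u powr (real j + (A - 1))"
      by (simp only: powr_add powr_realpow)
    also have "real j + (A - 1) = A + real j - 1" by simp
    finally show ?thesis by simp
  qed simp
  have "(\<integral>\<^sup>+u. ennreal (indicator {0..1} u * (u ^ j * (u powr (A - 1) * (1 - u) powr (B - 1)))) \<partial>lborel)
      = (\<integral>\<^sup>+u. ennreal (u powr (A + real j - 1) * (1 - u) powr (B - 1)) * indicator {0..1} u \<partial>lborel)"
    using eq by (intro nn_integral_cong) (auto simp: indicator_def)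
  also have "\<dots> = ennreal (Beta (A + real j) B)"
    using has_integral_Beta_real[OF pos B] by (intro nn_integral_has_integral_lebesgue') auto
  finally show "(\<integral>\<^sup>+u. ennreal (indicator {0..1} u * (u ^ j * (u powr (A - 1) * (1 - u) powr (B - 1)))) \<partial>lborel)
      = ennreal (Beta (A + real j) B)" .
  show "0 \<le> Beta (A + real j) B" using Beta_real_pos[OF pos B] by simp
qed (auto intro!: AE_I2 simp: indicator_def)

lemma gegenbauer_index_pos:
  assumes "\<mu> > -1"
  shows "\<mu> + (real CARD('d::finite) + 1) / 2 > 0"
proof -
  have "(real CARD('d) + 1) / 2 \<ge> 1" by (simp add: Suc_leI)
  with assms show ?thesis by linarith
qed

text \<open>For \<open>A = \<mu> + (d + 1) / 2\<close> the weight is, up to a constant, the integral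
  of the ball weight over the slice at height \<open>t\<close>, a ball of dimension
  \<open>d - 1\<close> and radius \<open>sqrt (1 - t^2)\<close>.\<close>

definition gegenbauer_int :: "real \<Rightarrow> (real \<Rightarrow> real) \<Rightarrow> real" where
  "gegenbauer_int A g = (LINT t|lborel. indicator {-1..1} t * (g t * (1 - t\<^sup>2) powr (A - 1)))"

text \<open>The substitution \<open>t = 1 - 2 u\<close> has Jacobian 2 and gives
  \<open>1 - t^2 = 4 u (1 - u)\<close>, whence the constant; it carries the endpoint
  \<open>t = 1\<close> to \<open>u = 0\<close> and the weight to the Jacobi case
  \<open>B = A\<close>.\<close>

lemma gegenbauer_int_sum:
  fixes c :: "'s \<Rightarrow> real"
  assumes A: "A > 0" and S: "finite S"
  shows "gegenbauer_int A (\<lambda>t. \<Sum>s\<in>S. c s * ((1 - t) / 2) ^ k s)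
    = 2 * 4 powr (A - 1) * (\<Sum>s\<in>S. c s * Beta A (A + real (k s)))"
proof -
  define w where "w u = u powr (A - 1) * (1 - u) powr (A - 1)" for u :: real
  have "gegenbauer_int A (\<lambda>t. \<Sum>s\<in>S. c s * ((1 - t) / 2) ^ k s)
      = 2 * (LINT u|lborel. indicator {-1..1} (1 + -2 * u) *
          ((\<Sum>s\<in>S. c s * ((1 - (1 + -2 * u)) / 2) ^ k s) * (1 - (1 + -2 * u)\<^sup>2) powr (A - 1)))"
    unfolding gegenbauer_int_def by (subst lborel_integral_real_affine[of "-2" _ 1]) simp_all
  also have "\<dots> = 2 * (LINT u|lborel. 4 powr (A - 1) * (\<Sum>s\<in>S. c s * (indicator {0..1} u * (u ^ k s * w u))))"
  proof (intro arg_cong[where f="\<lambda>x. 2 * x"] Bochner_Integration.integral_cong refl)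
    fix u :: real
    have "(1 - (1 + -2 * u)\<^sup>2) powr (A - 1) = 4 powr (A - 1) * w u" if "u \<in> {0..1}"
    proof -
      have "1 - (1 + -2 * u)\<^sup>2 = 4 * (u * (1 - u))" by (simp add: power2_eq_square algebra_simps)
      then show ?thesis using that by (simp add: w_def powr_mult)
    qed
    moreover have "1 + -2 * u \<in> {-1..1} \<longleftrightarrow> u \<in> {0..1}" by auto
    ultimately show "indicator {-1..1} (1 + -2 * u) *
          ((\<Sum>s\<in>S. c s * ((1 - (1 + -2 * u)) / 2) ^ k s) * (1 - (1 + -2 * u)\<^sup>2) powr (A - 1))
        = 4 powr (A - 1) * (\<Sum>s\<in>S. c s * (indicator {0..1} u * (u ^ k s * w u)))"
      by (cases "u \<in> {0..1}") (simp_all add: sum_distrib_right sum_distrib_left mult_ac)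
  qed
  also have "(LINT u|lborel. 4 powr (A - 1) * (\<Sum>s\<in>S. c s * (indicator {0..1} u * (u ^ k s * w u))))
      = 4 powr (A - 1) * (\<Sum>s\<in>S. c s * Beta (A + real (k s)) A)"
  proof (rule has_bochner_integral_integral_eq, intro has_bochner_integral_mult_right has_bochner_integral_sum)
    show "has_bochner_integral lborel (\<lambda>u. indicator {0..1} u * (u ^ k s * w u)) (Beta (A + real (k s)) A)" for s
      using Beta_bochner[OF A A] by (simp add: w_def)
  qed
  finally show ?thesis by (simp add: Beta_commute)
qed

definition kappa :: "real \<Rightarrow> nat \<Rightarrow> real poly" where
  "kappa A n = (\<Sum>i\<le>n. smult (ev0 A A n i) ([:1 / 2, - (1 / 2):] ^ i))"

lemma poly_kappa: "poly (kappa A n) t = (\<Sum>i\<le>n. ev0 A A n i * ((1 - t) / 2) ^ i)"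
  by (simp add: kappa_def poly_sum diff_divide_distrib)

text \<open>In powers of \<open>(1 - t) / 2\<close> the moments of \<open>ev0\<close> select the
  constant coefficient of \<open>G\<close>, its value at \<open>t = 1\<close>.\<close>

lemma gegenbauer_reproducing:
  assumes A: "A > 0" and G: "degree G \<le> n"
  shows "gegenbauer_int A (\<lambda>t. poly (kappa A n) t * poly G t) = 2 * 4 powr (A - 1) * poly G 1"
proof -
  define P where "P = pcompose G [:1, -2:]"
  have GP: "poly G t = (\<Sum>j\<le>n. coeff P j * ((1 - t) / 2) ^ j)" for t
  proof -
    have "poly [:1, -2:] ((1 - t) / 2) = t" by (simp add: field_simps)
    then have "poly G t = poly P ((1 - t) / 2)" unfolding P_def poly_pcompose by simp
    also have "\<dots> = (\<Sum>j\<le>n. coeff P j * ((1 - t) / 2) ^ j)"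
      unfolding poly_altdef using G
      by (intro sum.mono_neutral_left) (auto simp: P_def degree_pcompose coeff_eq_0)
    finally show ?thesis .
  qed
  have "poly (kappa A n) t * poly G t
      = (\<Sum>s\<in>{..n} \<times> {..n}. (ev0 A A n (fst s) * coeff P (snd s)) * ((1 - t) / 2) ^ (fst s + snd s))" for t
    unfolding GP poly_kappa sum_product sum.cartesian_product by (simp add: case_prod_beta power_add mult_ac)
  then have "gegenbauer_int A (\<lambda>t. poly (kappa A n) t * poly G t) = 2 * 4 powr (A - 1) *
      (\<Sum>s\<in>{..n} \<times> {..n}. (ev0 A A n (fst s) * coeff P (snd s)) * Beta A (A + real (fst s + snd s)))"
    using gegenbauer_int_sum[OF A, of "{..n} \<times> {..n}"] by simp
  also have "(\<Sum>s\<in>{..n} \<times> {..n}. (ev0 A A n (fst s) * coeff P (snd s)) * Beta A (A + real (fst s + snd s)))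
      = (\<Sum>j\<le>n. coeff P j * (\<Sum>i\<le>n. ev0 A A n i * Beta A (A + real i + real j)))"
    unfolding sum_distrib_left
    by (subst sum.swap, subst sum.cartesian_product) (simp add: case_prod_beta mult_ac add_ac)
  also have "\<dots> = (\<Sum>j\<le>n. if j = 0 then coeff P 0 else 0)"
    using ev0_moment[OF A A] by (intro sum.cong) auto
  also have "\<dots> = poly P 0" by (simp add: poly_0_coeff_0)
  also have "\<dots> = poly G 1" by (simp add: P_def poly_pcompose)
  finally show ?thesis .
qed

lemma gegenbauer_mass: "A > 0 \<Longrightarrow> gegenbauer_int A (\<lambda>t. 1) = 2 * 4 powr (A - 1) * Beta A A"
  using gegenbauer_int_sum[of A "{()}" "\<lambda>_. 1" "\<lambda>_. 0"] by simp

lemma gegenbauer_integrable: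
  fixes A :: real
  assumes "A > 0"
  shows "integrable lborel (\<lambda>t. indicator {-1..1} t * (poly P t * (1 - t\<^sup>2) powr (A - 1)))"
proof -
  have "bounded (poly P ` {-1..1})"
    by (intro compact_imp_bounded compact_continuous_image continuous_on_poly[OF continuous_on_id] compact_Icc)
  then obtain M where "\<forall>x\<in>poly P ` {-1..1}. norm x \<le> M" unfolding bounded_iff by blast
  then have M: "\<bar>poly P t\<bar> \<le> M" if "t \<in> {-1..1}" for t using that by auto
  have [measurable]: "poly P \<in> borel_measurable borel"
    by (intro borel_measurable_continuous_onI continuous_on_poly[OF continuous_on_id])
  show ?thesis
  proof (rule Bochner_Integration.integrable_bound)
    show "integrable lborel (\<lambda>t. M * (indicator {-1..1} t * (t ^ 0 * (1 - t\<^sup>2) powr (A - 1))))"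
      using real_ball_moment_even[of 0 "A - 1"] assms
      by (intro integrable_mult_right) (simp add: has_bochner_integral_iff)
    show "AE t in lborel. norm (indicator {-1..1} t * (poly P t * (1 - t\<^sup>2) powr (A - 1)))
        \<le> norm (M * (indicator {-1..1} t * (t ^ 0 * (1 - t\<^sup>2) powr (A - 1))))"
    proof (rule AE_I2)
      fix t :: real
      show "norm (indicator {-1..1} t * (poly P t * (1 - t\<^sup>2) powr (A - 1)))
        \<le> norm (M * (indicator {-1..1} t * (t ^ 0 * (1 - t\<^sup>2) powr (A - 1))))"
        using order.trans[OF M[of t] abs_ge_self[of M]]
        by (cases "t \<in> {-1..1}") (auto simp: abs_mult intro!: mult_right_mono)
    qed
  qed measurable
qed

lemma gegenbauer_int_linear:
  assumes "A > 0"
  shows "gegenbauer_int A (\<lambda>t. \<Sum>s\<in>S. c s * poly (P s) t) = (\<Sum>s\<in>S. c s * gegenbauer_int A (poly (P s)))"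
proof -
  have "gegenbauer_int A (\<lambda>t. \<Sum>s\<in>S. c s * poly (P s) t)
      = (LINT t|lborel. (\<Sum>s\<in>S. c s * (indicator {-1..1} t * (poly (P s) t * (1 - t\<^sup>2) powr (A - 1)))))"
    unfolding gegenbauer_int_def
    by (intro Bochner_Integration.integral_cong refl) (simp add: sum_distrib_left sum_distrib_right mult_ac)
  also have "\<dots> = (\<Sum>s\<in>S. c s * gegenbauer_int A (poly (P s)))"
    unfolding gegenbauer_int_def using gegenbauer_integrable[OF assms]
    by (subst Bochner_Integration.integral_sum) (auto intro!: integrable_mult_right)
  finally show ?thesis .
qed

section \<open>From the ball to the interval\<close>

lemma ball_int_reflect_zero:
  fixes f :: "real^'d::finite \<Rightarrow> real"
  assumes f: "f \<in> polys D" and odd: "\<And>y. f (\<chi> j. if j = i then - (y $ j) else y $ j) = - f y"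
  shows "ball_int \<mu> f = 0"
proof -
  let ?T = "\<lambda>y::real^'d. \<chi> j. if j = i then - (y $ j) else y $ j"
  have "orthogonal_transformation ?T"
    unfolding orthogonal_transformation_def
    by (intro conjI linearI allI) (auto simp: vec_eq_iff inner_vec_def intro!: sum.cong)
  from ball_int_rotate[OF this f, of \<mu>] have "ball_int \<mu> (\<lambda>y. - 1 * f y) = ball_int \<mu> f"
    by (simp add: odd)
  then show ?thesis unfolding ball_int_scale by simp
qed

lemma monomial_fun_reflect:
  "monomial_fun \<alpha> (\<chi> j. if j = i then - (y $ j) else y $ j) = (-1) ^ \<alpha> i * monomial_fun \<alpha> y"
proof -
  have "monomial_fun \<alpha> (\<chi> j. if j = i then - (y $ j) else y $ j)
      = (\<Prod>j\<in>UNIV. (if j = i then (-1) ^ \<alpha> i else 1) * (y $ j) ^ \<alpha> j)"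
    unfolding monomial_fun_def by (intro prod.cong) (auto simp: power_minus[of "_ $ _"])
  then show ?thesis by (simp add: prod.distrib monomial_fun_def)
qed

lemma ball_int_monomial_odd:
  "odd (\<alpha> i) \<Longrightarrow> ball_int \<mu> (monomial_fun \<alpha> :: real^'d::finite \<Rightarrow> real) = 0"
  by (rule ball_int_reflect_zero[OF monomial_polys[of _ UNIV], of _ i]) (simp_all add: monomial_fun_reflect)

lemma gegenbauer_power:
  assumes A: "A > 0"
  shows "gegenbauer_int A (\<lambda>t. t ^ j * (1 - t\<^sup>2) ^ h)
    = (if even j then Beta ((real j + 1) / 2) (A + real h) else 0)"
proof -
  have eq: "(1 - t\<^sup>2) ^ h * (1 - t\<^sup>2) powr (A - 1) = (1 - t\<^sup>2) powr (A - 1 + real h)" if "t \<in> {-1..1}" for t :: real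
  proof (cases "t\<^sup>2 = 1")
    case False
    have "t\<^sup>2 \<le> 1" using that by (simp add: abs_square_le_1 abs_le_iff)
    then have "1 - t\<^sup>2 > 0" using False by simp
    then show ?thesis by (simp add: powr_add powr_realpow)
  qed simp
  have "gegenbauer_int A (\<lambda>t. t ^ j * (1 - t\<^sup>2) ^ h)
      = (LINT t|lborel. indicator {-1..1} t * (t ^ j * (1 - t\<^sup>2) powr (A - 1 + real h)))"
    unfolding gegenbauer_int_def
  proof (intro Bochner_Integration.integral_cong refl)
    fix t :: real
    show "indicator {-1..1} t * (t ^ j * (1 - t\<^sup>2) ^ h * (1 - t\<^sup>2) powr (A - 1))
      = indicator {-1..1} t * (t ^ j * (1 - t\<^sup>2) powr (A - 1 + real h))"
      using eq[of t] by (cases "t \<in> {-1..1}") (simp_all add: mult.assoc)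
  qed
  also have "\<dots> = (if even j then Beta ((real j + 1) / 2) (A + real h) else 0)"
  proof (cases "even j")
    case True
    then show ?thesis
      using real_ball_moment_even[of j "A - 1 + real h"] A
      by (simp add: has_bochner_integral_iff add_ac)
  next
    case False
    then show ?thesis
      by (simp, intro lborel_integral_odd) (auto simp: indicator_def)
  qed
  finally show ?thesis .
qed

text \<open>Over a slice the other coordinates, of total degree \<open>2 h\<close>, contribute a
  constant times \<open>(1 - t^2) ^ h\<close>. This is checked by comparing the Gamma values from
  \<open>even_moment\<close> instead of by iterated integrals; what matters is that \<open>C\<close>
  does not depend on \<open>j\<close>. An odd exponent in \<open>\<alpha>\<close> gives
  \<open>C = 0\<close>.\<close>

lemma ball_int_monomial_slice:
  fixes \<alpha> :: "'d::finite \<Rightarrow> nat" and i0 :: 'd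
  assumes \<mu>: "\<mu> > -1" and \<alpha>0: "\<alpha> i0 = 0"
  defines "A \<equiv> \<mu> + (real CARD('d) + 1) / 2"
  shows "\<exists>C. \<forall>j. ball_int \<mu> (monomial_fun (\<alpha>(i0 := j)) :: real^'d \<Rightarrow> real)
    = C * gegenbauer_int A (\<lambda>t. t ^ j * (1 - t\<^sup>2) ^ ((\<Sum>i\<in>UNIV. \<alpha> i) div 2))"
proof (cases "\<forall>i. even (\<alpha> i)")
  case False
  then obtain i where i: "odd (\<alpha> i)" by blast
  then have "odd ((\<alpha>(i0 := j)) i)" for j using \<alpha>0 by (cases "i = i0") auto
  then have "ball_int \<mu> (monomial_fun (\<alpha>(i0 := j)) :: real^'d \<Rightarrow> real) = 0" for j
    using ball_int_monomial_odd by blast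
  then show ?thesis by (intro exI[of _ 0]) simp
next
  case True
  define h where "h = (\<Sum>i\<in>UNIV. \<alpha> i) div 2"
  have h: "(\<Sum>i\<in>UNIV. \<alpha> i) = 2 * h" using True by (simp add: h_def dvd_sum)
  have A: "A > 0" unfolding A_def by (rule gegenbauer_index_pos[OF \<mu>])
  define Q where "Q = (\<Prod>i\<in>UNIV - {i0}. Gamma ((real (\<alpha> i) + 1) / 2))"
  define C where "C = Q * Gamma (\<mu> + 1) / Gamma (A + real h)"
  have "ball_int \<mu> (monomial_fun (\<alpha>(i0 := j)) :: real^'d \<Rightarrow> real)
    = C * gegenbauer_int A (\<lambda>t. t ^ j * (1 - t\<^sup>2) ^ h)" for j
  proof (cases "even j")
    case False
    then have "odd ((\<alpha>(i0 := j)) i0)" by simp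
    from ball_int_monomial_odd[where \<alpha>="\<alpha>(i0 := j)", OF this] False
    show ?thesis by (simp add: gegenbauer_power[OF A])
  next
    case j: True
    define L where "L = (real (2 * h + j) + real CARD('d)) / 2"
    have L: "L > 0" unfolding L_def by (rule card_half_pos)
    have sum: "(\<Sum>i\<in>UNIV. (\<alpha>(i0 := j)) i) = 2 * h + j"
    proof -
      have "(\<Sum>i\<in>UNIV. (\<alpha>(i0 := j)) i) = j + (\<Sum>i\<in>UNIV - {i0}. (\<alpha>(i0 := j)) i)"
        by (subst sum.remove[of _ i0]) auto
      also have "(\<Sum>i\<in>UNIV - {i0}. (\<alpha>(i0 := j)) i) = (\<Sum>i\<in>UNIV - {i0}. \<alpha> i)" by (intro sum.cong) auto
      also have "\<dots> = (\<Sum>i\<in>UNIV. \<alpha> i)" using \<alpha>0 sum.remove[of UNIV i0 \<alpha>] by simp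
      finally show ?thesis using h by simp
    qed
    have prod: "(\<Prod>i\<in>UNIV. Gamma ((real ((\<alpha>(i0 := j)) i) + 1) / 2)) = Gamma ((real j + 1) / 2) * Q"
      unfolding Q_def by (subst prod.remove[of _ i0]) (auto intro!: prod.cong)
    have 1: "Gamma L / 2 * sph (monomial_fun (\<alpha>(i0 := j)) :: real^'d \<Rightarrow> real) = Gamma ((real j + 1) / 2) * Q"
      using even_moment[of "\<alpha>(i0 := j)"] True j unfolding sum prod L_def by simp
    have "ball_int \<mu> (monomial_fun (\<alpha>(i0 := j)) :: real^'d \<Rightarrow> real)
        = Beta L (\<mu> + 1) / 2 * sph (monomial_fun (\<alpha>(i0 := j)) :: real^'d \<Rightarrow> real)"
      unfolding L_def using sum by (intro ball_int_homogeneous monomial_polys \<mu>) simp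
    also have "\<dots> = Gamma L / 2 * sph (monomial_fun (\<alpha>(i0 := j)) :: real^'d \<Rightarrow> real)
        * (Gamma (\<mu> + 1) / Gamma (L + (\<mu> + 1)))"
      by (simp add: Beta_def mult_ac)
    also note 1
    also have "L + (\<mu> + 1) = (real j + 1) / 2 + (A + real h)"
      by (simp add: L_def A_def field_simps)
    also have "Gamma ((real j + 1) / 2) * Q * (Gamma (\<mu> + 1) / Gamma ((real j + 1) / 2 + (A + real h)))
        = C * Beta ((real j + 1) / 2) (A + real h)"
      using less_imp_neq[OF Gamma_real_pos[of "A + real h"]] A by (simp add: C_def Beta_def)
    finally show ?thesis by (simp only: gegenbauer_power[OF A] if_P[OF j])
  qed
  then show ?thesis unfolding h_def by blast
qed


lemma monomial_fun_upd:
  assumes "\<alpha> i0 = 0"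
  shows "monomial_fun (\<alpha>(i0 := j)) y = monomial_fun \<alpha> y * (y $ i0) ^ j"
proof -
  have "monomial_fun (\<alpha>(i0 := j)) y = (\<Prod>i\<in>UNIV. (y $ i) ^ \<alpha> i * (if i = i0 then (y $ i0) ^ j else 1))"
    unfolding monomial_fun_def using assms by (intro prod.cong) auto
  then show ?thesis by (simp add: prod.distrib monomial_fun_def)
qed

text \<open>The coordinates other than \<open>i0\<close> turn into \<open>(1 - t^2) ^ h\<close>,
  leaving the one-variable polynomial \<open>t ^ a (1 - t^2) ^ h\<close> of degree at most
  \<open>n\<close>, which \<open>kappa\<close> evaluates at 1. Unless \<open>h = 0\<close> this is
  0, like the monomial at the axis point.\<close>

lemma ball_int_kappa:
  fixes \<alpha> :: "'d::finite \<Rightarrow> nat" and i0 :: 'd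
  assumes \<mu>: "\<mu> > -1" and \<alpha>: "(\<Sum>i\<in>UNIV. \<alpha> i) \<le> n"
  defines "A \<equiv> \<mu> + (real CARD('d) + 1) / 2"
  shows "ball_int \<mu> (\<lambda>y. monomial_fun \<alpha> y * poly (kappa A n) (y $ i0))
    = ball_mass TYPE('d) \<mu> / Beta A A * monomial_fun \<alpha> (axis i0 1)"
proof -
  have A: "A > 0" unfolding A_def by (rule gegenbauer_index_pos[OF \<mu>])
  define a where "a = \<alpha> i0"
  define \<beta> where "\<beta> = \<alpha>(i0 := 0)"
  have \<beta>0: "\<beta> i0 = 0" and \<alpha>\<beta>: "\<alpha> = \<beta>(i0 := a)" by (auto simp: \<beta>_def a_def)
  define h where "h = (\<Sum>i\<in>UNIV. \<beta> i) div 2"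
  define E where "E = kappa A n"
  define W where "W = [:1, 0, -1 :: real:] ^ h"
  have W: "poly W t = (1 - t\<^sup>2) ^ h" for t
    by (simp add: W_def poly_power) (simp add: power2_eq_square)
  have PW: "poly (Polynomial.monom 1 k * W) = (\<lambda>t. t ^ k * (1 - t\<^sup>2) ^ h)" for k
    by (simp add: fun_eq_iff poly_monom W)
  obtain C where C: "\<And>j. ball_int \<mu> (monomial_fun (\<beta>(i0 := j)) :: real^'d \<Rightarrow> real)
    = C * gegenbauer_int A (\<lambda>t. t ^ j * (1 - t\<^sup>2) ^ h)"
    using ball_int_monomial_slice[of \<mu> \<beta> i0, OF \<mu> \<beta>0] unfolding A_def h_def by blast
  have sum: "(\<Sum>i\<in>UNIV. \<alpha> i) = a + (\<Sum>i\<in>UNIV. \<beta> i)"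
  proof -
    have "(\<Sum>i\<in>UNIV. \<alpha> i) = (\<Sum>i\<in>UNIV. \<beta> i + (if i = i0 then a else 0))"
      by (intro sum.cong) (auto simp: \<alpha>\<beta> \<beta>0)
    then show ?thesis by (simp add: sum.distrib)
  qed
  have "ball_int \<mu> (\<lambda>y::real^'d. monomial_fun \<alpha> y * poly E (y $ i0))
      = ball_int \<mu> (\<lambda>y::real^'d. \<Sum>j\<le>degree E. coeff E j * monomial_fun (\<beta>(i0 := a + j)) y)"
    by (simp add: \<alpha>\<beta> monomial_fun_upd[of \<beta>, OF \<beta>0] poly_altdef sum_distrib_left power_add mult_ac)
  also have "\<dots> = (\<Sum>j\<le>degree E. coeff E j * ball_int \<mu> (monomial_fun (\<beta>(i0 := a + j)) :: real^'d \<Rightarrow> real))"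
    by (subst ball_int_sum[where D=UNIV]) (auto intro!: polys_scale monomial_polys simp: \<mu> ball_int_scale)
  also have "\<dots> = C * (\<Sum>j\<le>degree E. coeff E j * gegenbauer_int A (poly (Polynomial.monom 1 (a + j) * W)))"
    unfolding PW C by (simp add: sum_distrib_left mult_ac)
  also have "\<dots> = C * gegenbauer_int A (\<lambda>t. \<Sum>j\<le>degree E. coeff E j * poly (Polynomial.monom 1 (a + j) * W) t)"
    by (simp only: gegenbauer_int_linear[OF A])
  also have "(\<lambda>t. \<Sum>j\<le>degree E. coeff E j * poly (Polynomial.monom 1 (a + j) * W) t)
      = (\<lambda>t. poly E t * poly (Polynomial.monom 1 a * W) t)"
    by (simp add: poly_monom poly_altdef[of E] sum_distrib_right sum_distrib_left power_add mult_ac)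
  also have "gegenbauer_int A \<dots> = 2 * 4 powr (A - 1) * poly (Polynomial.monom 1 a * W) 1"
  proof -
    have "degree (Polynomial.monom 1 a * W) \<le> a + 2 * h"
    proof (rule order.trans[OF degree_mult_le add_mono])
      show "degree W \<le> 2 * h"
        unfolding W_def by (rule order.trans[OF degree_power_le]) simp
    qed (simp add: degree_monom_le)
    also have "\<dots> \<le> n" using \<alpha> sum by (simp add: h_def) 
    finally show ?thesis unfolding E_def by (rule gegenbauer_reproducing[OF A])
  qed
  also have "poly (Polynomial.monom 1 a * W) 1 = (if h = 0 then 1 else 0)"
    by (simp add: poly_monom W)
  finally have main: "ball_int \<mu> (\<lambda>y::real^'d. monomial_fun \<alpha> y * poly E (y $ i0))
      = C * (2 * 4 powr (A - 1) * (if h = 0 then 1 else 0))" .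
  have mono: "monomial_fun \<alpha> (axis i0 1 :: real^'d) = (if (\<Sum>i\<in>UNIV. \<beta> i) = 0 then 1 else 0)"
  proof (cases "\<forall>i. \<beta> i = 0")
    case True
    then show ?thesis by (auto simp: \<alpha>\<beta> monomial_fun_upd[of \<beta>, OF \<beta>0] monomial_fun_def axis_def
        intro!: prod.neutral)
  next
    case False
    then obtain i where i: "\<beta> i \<noteq> 0" by blast
    then have "i \<noteq> i0" using \<beta>0 by auto
    then have "monomial_fun \<beta> (axis i0 1 :: real^'d) = 0"
      unfolding monomial_fun_def using i by (intro prod_zero) (auto simp: axis_def intro!: bexI[of _ i])
    then show ?thesis using i by (auto simp: \<alpha>\<beta> monomial_fun_upd[of \<beta>, OF \<beta>0])
  qed
  have Bpos: "Beta A A > 0" using A by (intro Beta_real_pos)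
  show ?thesis
  proof (cases "(\<Sum>i\<in>UNIV. \<beta> i) = 0")
    case True
    then have "\<beta> = (\<lambda>_. 0)" by (auto simp: fun_eq_iff)
    then have "\<beta>(i0 := 0) = (\<lambda>_. 0)" by auto
    then have "monomial_fun (\<beta>(i0 := 0)) = (\<lambda>_::real^'d. 1)" by (simp add: monomial_fun_def fun_eq_iff)
    \<comment> \<open>The constant is fixed by the total mass, the case \<open>j = 0\<close> of the
      slice formula.\<close>
    with C[of 0] True have "ball_int \<mu> (\<lambda>_::real^'d. 1) = C * (2 * 4 powr (A - 1) * Beta A A)"
      by (simp add: h_def gegenbauer_mass[OF A])
    moreover have "ball_int \<mu> (\<lambda>_::real^'d. 1) = ball_mass TYPE('d) \<mu>"
      by (simp add: ball_int_def ball_mass_def)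
    ultimately have "ball_mass TYPE('d) \<mu> / Beta A A = C * (2 * 4 powr (A - 1))"
      using Bpos by (simp add: field_simps)
    then show ?thesis using main mono True by (simp add: E_def h_def)
  next
    case False
    show ?thesis
    proof (cases "h = 0")
      case True
      \<comment> \<open>Because of \<open>div\<close>, \<open>h = 0\<close> also occurs for total
        degree 1; there an odd exponent forces \<open>C = 0\<close>.\<close>
      then have "(\<Sum>i\<in>UNIV. \<beta> i) = 1" using False unfolding h_def by presburger
      then have "\<exists>i. odd (\<beta> i)" by (metis dvd_sum odd_one)
      then obtain i where i: "odd (\<beta> i)" by blast
      then have "odd ((\<beta>(i0 := 0)) i)" using \<beta>0 by (cases "i = i0") auto
      from ball_int_monomial_odd[where \<alpha>="\<beta>(i0 := 0)", OF this] C[of 0] True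
      have "C * gegenbauer_int A (\<lambda>t. 1) = 0" by simp
      then have "C = 0" using Bpos by (simp add: gegenbauer_mass[OF A])
      then show ?thesis using main mono False by (simp add: E_def)
    qed (use main mono False in \<open>simp add: E_def\<close>)
  qed
qed

lemma ball_int_kappa_poly:
  fixes g :: "real^'d::finite \<Rightarrow> real" and i0 :: 'd
  assumes \<mu>: "\<mu> > -1" and g: "g \<in> polys {..n}"
  defines "A \<equiv> \<mu> + (real CARD('d) + 1) / 2"
  shows "ball_int \<mu> (\<lambda>y. g y * poly (kappa A n) (y $ i0))
    = ball_mass TYPE('d) \<mu> / Beta A A * g (axis i0 1)"
proof -
  have kp: "(\<lambda>y::real^'d. poly (kappa A n) (y $ i0)) \<in> polys UNIV"
  proof -
    have "(\<lambda>y::real^'d. (y $ i0) ^ i) \<in> polys UNIV" for i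
      using polys_power[OF polys_coord, of i0 i] polys_mono[of "{1 * i}" UNIV] by blast
    then show ?thesis unfolding poly_altdef by (intro polys_sum polys_scale)
  qed
  have fk: "(\<lambda>y. f y * poly (kappa A n) (y $ i0)) \<in> polys UNIV" if "f \<in> polys UNIV" for f :: "real^'d \<Rightarrow> real"
    using that kp by (rule polys_mult) simp
  have "g \<in> polys UNIV \<and> ball_int \<mu> (\<lambda>y. g y * poly (kappa A n) (y $ i0))
      = ball_mass TYPE('d) \<mu> / Beta A A * g (axis i0 1)"
    using g
  proof (induction rule: polys_induct)
    case zero
    then show ?case by (simp add: ball_int_def set_lebesgue_integral_def polys_zero)
  next
    case (step c \<alpha> f)
    have m: "monomial_fun \<alpha> \<in> polys UNIV" by (rule monomial_polys) simp
    have "ball_int \<mu> (\<lambda>y. c * (monomial_fun \<alpha> y * poly (kappa A n) (y $ i0)) + f y * poly (kappa A n) (y $ i0))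
        = c * ball_int \<mu> (\<lambda>y. monomial_fun \<alpha> y * poly (kappa A n) (y $ i0))
          + ball_int \<mu> (\<lambda>y. f y * poly (kappa A n) (y $ i0))"
      using step m \<mu> by (subst ball_int_add[of _ UNIV _ UNIV]) (auto intro!: polys_scale fk simp: ball_int_scale)
    also have "ball_int \<mu> (\<lambda>y. monomial_fun \<alpha> y * poly (kappa A n) (y $ i0))
        = ball_mass TYPE('d) \<mu> / Beta A A * monomial_fun \<alpha> (axis i0 1)"
      unfolding A_def by (rule ball_int_kappa[OF \<mu>]) (use step in simp)
    finally show ?case using step m by (auto intro!: polys_add polys_scale simp: algebra_simps)
  qed
  then show ?thesis ..
qed

text \<open>With one argument at \<open>x\<close> the kernel is a function of
  \<open>y \<bullet> x\<close> alone, and a rotation taking a coordinate axis to \<open>x\<close>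
  turns it into a function of one coordinate. The factor \<open>Beta A A\<close> compensates the
  denominator in \<open>ball_int_kappa_poly\<close>.\<close>

lemma ball_kernel_boundary:
  fixes x :: "real^'d::finite"
  assumes \<mu>: "\<mu> > -1" and x: "norm x = 1"
  defines "A \<equiv> \<mu> + (real CARD('d) + 1) / 2"
  shows "ball_kernel \<mu> n x x = Beta A A * jker A A n"
proof -
  have A: "A > 0" unfolding A_def by (rule gegenbauer_index_pos[OF \<mu>])
  have Bpos: "Beta A A > 0" using A by (intro Beta_real_pos)
  define i0 :: 'd where "i0 = undefined"
  obtain T :: "real^'d \<Rightarrow> real^'d" where T: "orthogonal_transformation T" and Tx: "T (axis i0 1) = x"
  proof (rule orthogonal_transformation_exists_1[of "axis i0 1" x])
    show "norm (axis i0 1 :: real^'d) = 1" by simp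
  qed (use x in \<open>blast intro: that\<close>)+
  have linT: "linear T" using T by (rule orthogonal_transformation_linear)
  define K where "K y = Beta A A * poly (kappa A n) (y \<bullet> x)" for y
  interpret fn_inner "poly_space n" "inner_ball \<mu> :: (real^'d \<Rightarrow> real) \<Rightarrow> _"
    by (rule fn_inner_ball[OF \<mu>])
  have K: "K \<in> poly_space n"
  proof -
    have lin: "(\<lambda>y. (1 - y \<bullet> x) / 2) \<in> polys {..1}"
    proof -
      have "(\<lambda>y. y $ i) \<in> polys {..1}" for i :: 'd using polys_coord polys_mono[of "{1}" "{..1}"] by auto
      moreover have "(\<lambda>y::real^'d. 1) \<in> polys {..1}" using polys_const polys_mono[of "{0}" "{..1}"] by auto
      ultimately have "(\<lambda>y. 1 / 2 * (1 - (\<Sum>i\<in>UNIV. x $ i * y $ i))) \<in> polys {..1}"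
        by (intro polys_scale polys_diff polys_sum)
      then show ?thesis by (simp add: inner_vec_def mult.commute)
    qed
    have "(\<lambda>y. ((1 - y \<bullet> x) / 2) ^ i) \<in> polys {..n}" if "i \<le> n" for i
      using polys_power_le[OF lin, of i] polys_mono[of "{..1 * i}" "{..n}"] that by auto
    then show ?thesis
      unfolding poly_space_eq K_def[abs_def] poly_kappa by (intro polys_scale polys_sum) auto
  qed
  have "ball_kernel \<mu> n x x = K x"
    unfolding ball_kernel_def
  proof (rule repr_kernel_eqI[OF K])
    fix f :: "real^'d \<Rightarrow> real"
    assume f: "f \<in> poly_space n"
    define g where "g y = f (T y)" for y
    have g: "g \<in> polys {..n}"
      using polys_linear_compose[OF linT, of f "{..n}"] f by (simp add: g_def[abs_def] poly_space_eq)
    have KT: "K (T y) = Beta A A * poly (kappa A n) (y $ i0)" for y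
    proof -
      have "T y \<bullet> x = y \<bullet> axis i0 1" using T Tx unfolding orthogonal_transformation_def by metis
      then show ?thesis by (simp add: K_def inner_axis)
    qed
    have red: "inner_ball \<mu> f K = ball_int \<mu> (\<lambda>y. g y * poly (kappa A n) (y $ i0)) * Beta A A / ball_mass TYPE('d) \<mu>"
    proof -
      have "(\<lambda>y. f y * K y) \<in> polys UNIV" using f K by (rule poly_space_mult)
      from ball_int_rotate[OF T this, of \<mu>]
      have "inner_ball \<mu> f K = ball_int \<mu> (\<lambda>y. Beta A A * (g y * poly (kappa A n) (y $ i0))) / ball_mass TYPE('d) \<mu>"
        by (simp add: inner_ball_eq KT g_def mult_ac)
      then show ?thesis unfolding ball_int_scale by simp
    qed
    have "ball_int \<mu> (\<lambda>y. g y * poly (kappa A n) (y $ i0)) = ball_mass TYPE('d) \<mu> / Beta A A * g (axis i0 1)"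
      unfolding A_def by (rule ball_int_kappa_poly[OF \<mu> g])
    then have "inner_ball \<mu> f K = g (axis i0 1)"
      unfolding red using Bpos ball_mass_pos[OF \<mu>, where 'd='d] by simp
    then show "inner_ball \<mu> f K = f x" by (simp add: g_def Tx)
  qed
  also have "K x = Beta A A * jker A A n"
  proof -
    have "x \<bullet> x = 1" using x by (simp add: dot_square_norm)
    then show ?thesis by (simp add: K_def poly_kappa jker_def power_0_left if_distrib cong: if_cong)
  qed
  finally show ?thesis .
qed

text \<open>Written with \<open>Suc n\<close> so that the last factor is, up to
  \<open>n powr (2 * A)\<close>, the inverse of Euler's \<open>Gamma_series\<close> at
  \<open>2 * A\<close>.\<close>

lemma jker_diagonal:
  assumes A: "A > 0"
  shows "Beta A A * jker A A n = (A + real n) / (A * (2 * A + real n)) * (pochhammer (2 * A) (Suc n) / fact n)"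
proof -
  have G: "Gamma (real n + A + A) = pochhammer (2 * A) n * Gamma (2 * A)"
    using Gamma_quotient[of "2 * A" n] A by (simp add: add_ac)
  have "2 * A > 0" using A by simp
  note pos = less_imp_neq[OF Gamma_real_pos[OF A], symmetric]
    less_imp_neq[OF Gamma_real_pos[OF \<open>2 * A > 0\<close>], symmetric]
    less_imp_neq[OF pochhammer_pos[OF A], symmetric]
  have "Beta A A * jker A A n = (A + real n) / A * (pochhammer (2 * A) n / fact n)"
    unfolding jker_eq jac_norm_def G pochhammer_Suc[of A n] Beta_def using pos A
    by (simp add: mult_2[symmetric])
  also have "pochhammer (2 * A) n = pochhammer (2 * A) (Suc n) / (2 * A + real n)"
    using A by (simp add: pochhammer_Suc)
  finally show ?thesis by simp
qed

lemma jker_diagonal_asymp: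
  assumes A: "A > 0"
  shows "(\<lambda>n. Beta A A * jker A A n / real n powr (2 * A)) \<longlonglongrightarrow> 2 / Gamma (2 * A + 1)"
proof -
  have G: "Gamma (2 * A) > 0" using A by (intro Gamma_real_pos) simp
  have 1: "(\<lambda>n. inverse (Gamma_series (2 * A) n)) \<longlonglongrightarrow> inverse (Gamma (2 * A))"
    using Gamma_series_LIMSEQ[of "2 * A"] G by (intro tendsto_inverse) auto
  have 2: "(\<lambda>n. (A + real n) / (A * (2 * A + real n))) \<longlonglongrightarrow> inverse A"
    using A by real_asymp
  have "(\<lambda>n. (A + real n) / (A * (2 * A + real n)) * inverse (Gamma_series (2 * A) n))
      \<longlonglongrightarrow> inverse A * inverse (Gamma (2 * A))"
    by (intro tendsto_mult 1 2)
  also have "inverse A * inverse (Gamma (2 * A)) = 2 / Gamma (2 * A + 1)"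
    using Gamma_plus1[OF not_nonpos_Int[of "2 * A"]] A by (simp add: field_simps)
  finally show ?thesis
  proof (rule Lim_transform_eventually)
    show "\<forall>\<^sub>F n in sequentially. (A + real n) / (A * (2 * A + real n)) * inverse (Gamma_series (2 * A) n)
        = Beta A A * jker A A n / real n powr (2 * A)"
      using eventually_gt_at_top[of 0]
    proof eventually_elim
      case (elim n)
      then have "exp (2 * A * ln (real n)) = real n powr (2 * A)" by (simp add: powr_def)
      then show ?case unfolding jker_diagonal[OF A] Gamma_series_def by (simp add: field_simps)
    qed
  qed
qed

section \<open>Decomposition into radial and spherical parts\<close>

text \<open>The restrictions to the sphere of these polynomials are the spherical harmonics of degree
  \<open>k\<close>; orthogonality to lower degree replaces harmonicity, so that no Laplacian is needed.\<close>

definition sph_harm :: "nat \<Rightarrow> (real^'d::finite \<Rightarrow> real) set" where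
  "sph_harm k = {Y \<in> polys {k}. k \<ge> 2 \<longrightarrow> (\<forall>g\<in>polys {k - 2}. avg (\<lambda>x. Y x * g x) = 0)}"

lemma harm_polys: "Y \<in> sph_harm k \<Longrightarrow> Y \<in> polys {k}"
  by (simp add: sph_harm_def)

lemma avg_add_UNIV: "f \<in> polys D \<Longrightarrow> g \<in> polys E \<Longrightarrow> avg (\<lambda>x. f x + g x) = avg f + avg g"
  using avg_add[of f UNIV g] polys_mono[of D UNIV] polys_mono[of E UNIV] by auto

lemma polys_mult_single: "f \<in> polys {a} \<Longrightarrow> g \<in> polys {b} \<Longrightarrow> (\<lambda>x. f x * g x) \<in> polys {a + b}"
  by (rule polys_mult) auto

lemma harm_subspace: "fn.subspace (sph_harm k :: (real^'d::finite \<Rightarrow> real) set)"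
proof (rule fn.subspaceI)
  show "0 \<in> (sph_harm k :: (real^'d \<Rightarrow> real) set)"
    using polys_zero[of "{k}"] by (simp add: sph_harm_def zero_fun_def avg_def sph_def)
  fix Y Y' :: "real^'d \<Rightarrow> real" and c :: real
  assume Y: "Y \<in> sph_harm k"
  then show "(\<lambda>x. c * Y x) \<in> sph_harm k"
    by (auto simp: sph_harm_def mult.assoc avg_scale intro: polys_scale)
  assume Y': "Y' \<in> sph_harm k"
  have "avg (\<lambda>x. (Y x + Y' x) * g x) = avg (\<lambda>x. Y x * g x) + avg (\<lambda>x. Y' x * g x)"
    if "g \<in> polys {k - 2}" for g
    unfolding distrib_right using that Y Y' harm_polys
    by (intro avg_add_UNIV[of _ "{k + (k - 2)}" _ "{k + (k - 2)}"] polys_mult_single) auto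
  then show "Y + Y' \<in> sph_harm k"
    using Y Y' by (auto simp: sph_harm_def plus_fun_def intro: polys_add)
qed

text \<open>The antipodal map is orthogonal and changes the sign of \<open>f\<close>; rotation
  invariance is used on the ball and passed on to the sphere by homogeneity.\<close>

lemma avg_odd:
  fixes f :: "real^'d::finite \<Rightarrow> real"
  assumes f: "f \<in> polys {k}" and "odd k"
  shows "avg f = 0"
proof -
  have "orthogonal_transformation (uminus :: real^'d \<Rightarrow> _)"
    by (simp add: orthogonal_transformation_def linear_uminus)
  moreover have "f (- x) = - 1 * f x" for x
    using polys_scaleR[OF f, of "-1" x] \<open>odd k\<close> by simp
  ultimately have "ball_int 0 (\<lambda>x. - 1 * f x) = ball_int 0 f"
    using ball_int_rotate[OF _ f, of uminus 0] by simp
  then have "ball_int 0 f = 0" unfolding ball_int_scale by simp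
  then show ?thesis
    using ball_int_homogeneous[OF f, of 0] Beta_real_pos[OF card_half_pos[of k, where 'd='d], of 1]
    by (simp add: avg_def)
qed

text \<open>For degrees of different parity the product is odd. For equal parity a power of
  \<open>norm x ^ 2\<close>, which is 1 on the sphere, raises \<open>Y'\<close> to degree
  \<open>k - 2\<close>, where the definition of \<open>sph_harm\<close> applies.\<close>

lemma harm_orthogonal_less:
  fixes Y Y' :: "real^'d::finite \<Rightarrow> real"
  assumes Y: "Y \<in> sph_harm k" and Y': "Y' \<in> sph_harm l" and "l < k"
  shows "avg (\<lambda>x. Y x * Y' x) = 0"
proof (cases "even (k + l)")
  case False
  then show ?thesis using avg_odd polys_mult_single[OF harm_polys[OF Y] harm_polys[OF Y']] by blast
next
  case True
  then have "\<exists>j. k = l + 2 * j + 2" using \<open>l < k\<close> by presburger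
  then obtain j where j: "k = l + 2 * j + 2" ..
  define g where "g x = ((norm x)\<^sup>2) ^ j * Y' x" for x
  have "g \<in> polys {2 * j + l}"
    unfolding g_def[abs_def] by (intro polys_mult_single polys_power polys_norm_sq harm_polys Y')
  then have g: "g \<in> polys {k - 2}" using j by (simp add: add.commute)
  have "avg (\<lambda>x. Y x * Y' x) = avg (\<lambda>x. Y x * g x)"
    using polys_mult_single[OF harm_polys[OF Y] harm_polys[OF Y']] polys_mult_single[OF harm_polys[OF Y] g]
    by (rule avg_cong) (simp add: g_def)
  also have "\<dots> = 0" using Y g j by (simp add: sph_harm_def)
  finally show ?thesis .
qed

lemma harm_orthogonal:
  assumes "Y \<in> sph_harm k" "Y' \<in> sph_harm l" "k \<noteq> l"
  shows "avg (\<lambda>x. Y x * Y' x) = 0"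
  using harm_orthogonal_less[OF assms(1,2)] harm_orthogonal_less[OF assms(2,1)] assms(3)
  by (cases "l < k") (auto simp: mult.commute)

text \<open>Powers of \<open>1 - norm y ^ 2\<close> rather than of \<open>norm y ^ 2\<close>: on the
  sphere only \<open>j = 0\<close> contributes to values and only \<open>j \<le> 1\<close> to normal
  derivatives.\<close>

definition radial_harm :: "nat \<Rightarrow> (real^'d::finite \<Rightarrow> real) \<Rightarrow> real^'d \<Rightarrow> real" where
  "radial_harm j Y = (\<lambda>y. (1 - (norm y)\<^sup>2) ^ j * Y y)"

definition harm_span :: "nat \<Rightarrow> (real^'d::finite \<Rightarrow> real) set" where
  "harm_span n = fn.span {radial_harm j Y | j k Y. Y \<in> sph_harm k \<and> 2 * j + k \<le> n}"

lemma harm_span_mono: "m \<le> n \<Longrightarrow> harm_span m \<subseteq> harm_span n"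
  unfolding harm_span_def by (rule fn.span_mono) (use order.trans in blast)

lemma harm_span_mult:
  assumes "f \<in> harm_span n"
  shows "(\<lambda>y. (1 - (norm y)\<^sup>2) * f y) \<in> harm_span (n + 2)"
  using assms unfolding harm_span_def
proof (induction rule: fn.span_induct_alt)
  case base
  show ?case using fn.span_zero by (simp add: zero_fun_def)
next
  case (step c x f)
  then obtain j k Y where Y: "x = radial_harm j Y" "Y \<in> sph_harm k" "2 * j + k \<le> n" by blast
  let ?S = "{radial_harm j Y | j k Y. Y \<in> sph_harm k \<and> 2 * j + k \<le> n + 2}"
  have "radial_harm (Suc j) Y \<in> ?S" using Y by (intro CollectI exI[of _ "Suc j"] exI[of _ k] exI[of _ Y]) auto
  then have "(\<lambda>y. c * radial_harm (Suc j) Y y) + (\<lambda>y. (1 - (norm y)\<^sup>2) * f y) \<in> fn.span ?S"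
    using step(2) by (intro fn.span_add fn.span_scale[OF fn.span_base])
  also have "(\<lambda>y. c * radial_harm (Suc j) Y y) + (\<lambda>y. (1 - (norm y)\<^sup>2) * f y)
      = (\<lambda>y. (1 - (norm y)\<^sup>2) * ((\<lambda>y. c * x y) + f) y)"
    by (simp add: fun_eq_iff Y radial_harm_def algebra_simps)
  finally show ?case .
qed

lemma harm_span_harm: "Y \<in> sph_harm k \<Longrightarrow> Y \<in> harm_span k"
  unfolding harm_span_def
  by (intro fn.span_base CollectI exI[of _ 0] exI[of _ k] exI[of _ Y]) (simp add: radial_harm_def)

text \<open>\<open>K\<close> represents \<open>g \<mapsto> avg (f g)\<close> in degree
  \<open>k - 2\<close>, so \<open>f - norm y ^ 2 K\<close> is a harmonic. The rest is rewritten as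
  \<open>K - (1 - norm y ^ 2) K\<close>, which lies in the span by induction.\<close>

lemma polys_harm_span:
  fixes f :: "real^'d::finite \<Rightarrow> real"
  assumes "f \<in> polys {k}"
  shows "f \<in> harm_span k"
  using assms
proof (induction k arbitrary: f rule: less_induct)
  case (less k)
  show ?case
  proof (cases "k \<ge> 2")
    \<comment> \<open>In degrees 0 and 1 membership in \<open>sph_harm\<close> imposes no
      orthogonality.\<close>
    case False
    then show ?thesis using less.prems by (intro harm_span_harm) (simp add: sph_harm_def)
  next
    case True
    define V :: "(real^'d \<Rightarrow> real) set" where "V = polys {k - 2}"
    interpret fn_inner V "\<lambda>f g. avg (\<lambda>x. f x * g x)"
      unfolding V_def by (rule fn_inner_avg[OF polys_subspace order.refl])
    have fg: "(\<lambda>x. f x * g x) \<in> polys {k + (k - 2)}" if "g \<in> V" for g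
      using that less.prems unfolding V_def by (intro polys_mult_single)
    obtain K where K: "K \<in> V" "\<And>g. g \<in> V \<Longrightarrow> avg (\<lambda>x. g x * K x) = avg (\<lambda>x. f x * g x)"
    proof -
      have "\<exists>K\<in>V. \<forall>g\<in>V. avg (\<lambda>x. g x * K x) = avg (\<lambda>x. f x * g x)"
      proof (rule representer_exists)
        fix g h assume "g \<in> V" "h \<in> V"
        then show "avg (\<lambda>x. f x * (g + h) x) = avg (\<lambda>x. f x * g x) + avg (\<lambda>x. f x * h x)"
          using avg_add[OF fg fg] by (simp add: distrib_left)
        show "avg (\<lambda>x. f x * (c * g x)) = c * avg (\<lambda>x. f x * g x)" for c
          unfolding mult.left_commute[of _ c] by (rule avg_scale)
      qed
      then show ?thesis using that by blast
    qed
    have nK: "(\<lambda>y. (norm y)\<^sup>2 * K y) \<in> polys {k}"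
    proof -
      have "2 + (k - 2) = k" using True by simp
      then show ?thesis using polys_mult_single[OF polys_norm_sq K(1)[unfolded V_def]] by metis
    qed
    define Y where "Y y = f y - (norm y)\<^sup>2 * K y" for y
    have Yk: "Y \<in> polys {k}" unfolding Y_def[abs_def] by (intro polys_diff less.prems nK)
    have "avg (\<lambda>x. Y x * g x) = 0" if g: "g \<in> V" for g
    proof -
      have g': "g \<in> polys {k - 2}" using g by (simp add: V_def)
      have "avg (\<lambda>x. f x * g x) = avg (\<lambda>x. Y x * g x + ((norm x)\<^sup>2 * K x) * g x)"
        by (simp add: Y_def algebra_simps)
      also have "\<dots> = avg (\<lambda>x. Y x * g x) + avg (\<lambda>x. ((norm x)\<^sup>2 * K x) * g x)"
        using polys_mult_single[OF Yk g'] polys_mult_single[OF nK g'] by (rule avg_add)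
      also have "avg (\<lambda>x. ((norm x)\<^sup>2 * K x) * g x) = avg (\<lambda>x. g x * K x)"
        using polys_mult_single[OF nK g'] polys_mult_single[OF g' K(1)[unfolded V_def]]
        by (rule avg_cong) (simp add: mult.commute)
      finally show ?thesis using K(2)[OF g] by simp
    qed
    then have Y: "Y \<in> sph_harm k" using Yk by (simp add: sph_harm_def V_def)
    have K': "K \<in> harm_span (k - 2)" using K(1) True unfolding V_def by (intro less.IH) auto
    have "Y + (K - (\<lambda>y. (1 - (norm y)\<^sup>2) * K y)) \<in> harm_span k"
    proof -
      have "K \<in> harm_span k" using K' harm_span_mono[of "k - 2" k] by auto
      moreover have "(\<lambda>y. (1 - (norm y)\<^sup>2) * K y) \<in> harm_span k"
      proof -
        have "k - 2 + 2 = k" using True by simp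
        then show ?thesis using harm_span_mult[OF K'] by metis
      qed
      ultimately show ?thesis
        using harm_span_harm[OF Y] unfolding harm_span_def by (intro fn.span_add fn.span_diff)
    qed
    also have "Y + (K - (\<lambda>y. (1 - (norm y)\<^sup>2) * K y)) = f"
      by (simp add: fun_eq_iff Y_def algebra_simps)
    finally show ?thesis .
  qed
qed

lemma radial_harm_polys:
  assumes "Y \<in> polys {k}" "2 * j + k \<le> n"
  shows "radial_harm j Y \<in> polys {..n}"
proof -
  have "(\<lambda>y::real^'a. 1 - (norm y)\<^sup>2) \<in> polys {..2}"
    using polys_const[of 1] polys_norm_sq polys_mono[of "{0}" "{..2}"] polys_mono[of "{2}" "{..2}"]
    by (intro polys_diff) auto
  then have "(\<lambda>y. (1 - (norm y)\<^sup>2) ^ j * Y y) \<in> polys {..n}"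
    using assms polys_power_le by (intro polys_mult[of _ "{..2 * j}" _ "{k}"]) auto
  then show ?thesis by (simp add: radial_harm_def)
qed

lemma poly_space_eq_harm_span: "poly_space n = (harm_span n :: (real^'d::finite \<Rightarrow> real) set)"
proof
  show "harm_span n \<subseteq> (poly_space n :: (real^'d \<Rightarrow> real) set)"
    unfolding harm_span_def poly_space_eq using radial_harm_polys harm_polys
    by (intro fn.span_minimal polys_subspace) blast
  have "monomial_fun \<alpha> \<in> (harm_span n :: (real^'d \<Rightarrow> real) set)" if "(\<Sum>i\<in>UNIV. \<alpha> i) \<le> n" for \<alpha>
    using polys_harm_span[OF monomial_polys, of \<alpha> "\<Sum>i\<in>UNIV. \<alpha> i"] harm_span_mono[OF that] by auto
  then show "poly_space n \<subseteq> (harm_span n :: (real^'d \<Rightarrow> real) set)"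
    unfolding poly_space_def harm_span_def[of n]
    by (intro fn.span_minimal fn.subspace_span) (auto simp: harm_span_def)
qed

section \<open>The Sobolev kernel as a sum over harmonic degrees\<close>

lemma harm_representer:
  fixes x :: "real^'d::finite"
  shows "\<exists>Z\<in>sph_harm k. \<forall>Y\<in>sph_harm k. avg (\<lambda>y. Y y * Z y) = Y x"
proof -
  interpret fn_inner "sph_harm k :: (real^'d \<Rightarrow> real) set" "\<lambda>f g. avg (\<lambda>x. f x * g x)"
    using harm_subspace harm_polys by (intro fn_inner_avg) blast+
  show ?thesis by (rule representer_exists) auto
qed

lemma inner_sobolev_radial:
  fixes Y Y' :: "real^'d::finite \<Rightarrow> real"
  assumes Y: "Y \<in> polys {k}" and Y': "Y' \<in> polys {l}" and \<mu>: "\<mu> > -1"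
  shows "inner_sobolev lam \<mu> (radial_harm i Y) (radial_harm j Y')
    = (Beta ((real (k + l) + real CARD('d)) / 2) (\<mu> + real (i + j) + 1) / Beta (real CARD('d) / 2) (\<mu> + 1)
       + lam * (tau k i * tau l j)) * avg (\<lambda>y. Y y * Y' y)"
proof -
  have R: "radial_harm i Y \<in> polys UNIV" "radial_harm j Y' \<in> polys UNIV"
    using radial_harm_polys[OF Y order.refl] radial_harm_polys[OF Y' order.refl] polys_mono[of _ UNIV] by blast+
  have YY: "(\<lambda>y. Y y * Y' y) \<in> polys UNIV"
    using polys_mult_single[OF Y Y'] polys_mono[of _ UNIV] by blast
  have nd: "normal_deriv (radial_harm i Y) x = tau k i * Y x" "normal_deriv (radial_harm j Y') x = tau l j * Y' x"
    if "norm x = 1" for x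
    using normal_deriv_radial[OF Y that] normal_deriv_radial[OF Y' that]
    by (simp_all add: radial_harm_def tau_def)
  have "avg (\<lambda>x. normal_deriv (radial_harm i Y) x * normal_deriv (radial_harm j Y') x)
      = avg (\<lambda>x. tau k i * tau l j * (Y x * Y' x))"
  proof (rule avg_cong)
    show "(\<lambda>x. normal_deriv (radial_harm i Y) x * normal_deriv (radial_harm j Y') x) \<in> polys UNIV"
      using R by (intro polys_mult[of _ UNIV _ UNIV] normal_deriv_polys) auto
    show "(\<lambda>x. tau k i * tau l j * (Y x * Y' x)) \<in> polys UNIV" by (intro polys_scale YY)
  qed (simp add: nd)
  also have "\<dots> = tau k i * tau l j * avg (\<lambda>y. Y y * Y' y)" by (rule avg_scale)
  finally show ?thesis
    using inner_ball_radial[OF Y Y' \<mu>, of i j, folded radial_harm_def]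
    by (simp add: inner_sobolev_eq distrib_right mult.assoc)
qed

text \<open>The order of quantifiers matters: one family \<open>z\<close> serves every
  \<open>lam \<ge> 0\<close> and every \<open>n\<close>, so the case \<open>lam = 0\<close> carries
  information about the ball kernel over to positive \<open>lam\<close>. Different degrees are
  orthogonal, so each contributes its own one-variable kernel.\<close>

lemma sobolev_kernel_boundary:
  fixes x :: "real^'d::finite"
  assumes d: "CARD('d) \<ge> 2" and \<mu>: "\<mu> > -1" and x: "norm x = 1"
  defines "A \<equiv> \<mu> + 1" and "h \<equiv> real CARD('d) / 2"
  shows "\<exists>z. (\<forall>k. 0 \<le> z k) \<and> (\<forall>lam\<ge>0. \<forall>n. sobolev_kernel lam \<mu> n x x
    = (\<Sum>k\<le>n. z k * (jker A (real k + h) ((n - k) div 2)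
        * sratio (lam * Beta h A) k A (real k + h) ((n - k) div 2))))"
proof -
  have A: "A > 0" using \<mu> by (simp add: A_def)
  have h: "h \<ge> 1" using d by (simp add: h_def)
  \<comment> \<open>\<open>inner_ball\<close> divides its radial moments by \<open>B0\<close>;
    clearing this denominator leaves the Gram matrix of \<open>Beta\<close> values and replaces
    \<open>lam\<close> by \<open>lam * B0\<close>.\<close>
  define B0 where "B0 = Beta h A"
  have B0: "B0 > 0" unfolding B0_def using A h by (intro Beta_real_pos) auto
  \<comment> \<open>\<open>Z k\<close> is the zonal harmonic with pole \<open>x\<close>; its value
    at \<open>x\<close> is its own mean square, hence nonnegative.\<close>
  obtain Z where Z: "\<And>k. Z k \<in> sph_harm k" "\<And>k Y. Y \<in> sph_harm k \<Longrightarrow> avg (\<lambda>y. Y y * Z k y) = Y x"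
    using harm_representer[of _ x] by metis
  have z: "0 \<le> Z k x" for k
  proof -
    have "0 \<le> avg (\<lambda>y. Z k y * Z k y)" by (intro avg_nonneg) simp
    then show ?thesis using Z by simp
  qed
  have "sobolev_kernel lam \<mu> n x x = (\<Sum>k\<le>n. (B0 * Z k x) * (jker A (real k + h) ((n - k) div 2)
        * sratio (lam * B0) k A (real k + h) ((n - k) div 2)))"
    if lam: "lam \<ge> 0" for lam n
  proof -
    interpret fn_inner "poly_space n" "inner_sobolev lam \<mu> :: (real^'d \<Rightarrow> real) \<Rightarrow> _"
      by (rule fn_inner_sobolev[OF \<mu> lam])
    \<comment> \<open>For \<open>k \<le> n\<close> the largest \<open>j\<close> with
      \<open>2 * j + k \<le> n\<close>.\<close>
    define m where "m k = (n - k) div 2" for k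
    define e where "e k i = sev (lam * B0) k A (real k + h) (m k) i" for k i
    define I where "I = (SIGMA k:{..n}. {..m k})"
    define F where "F s = radial_harm (snd s) (Z (fst s))" for s
    have F: "F s \<in> poly_space n" if "s \<in> I" for s
      unfolding F_def poly_space_eq using that
      by (intro radial_harm_polys[of _ "fst s"] harm_polys Z) (auto simp: I_def m_def)
    \<comment> \<open>In each degree the zonal harmonic is multiplied by the polynomial in
      \<open>1 - norm y ^ 2\<close> that represents \<open>q \<mapsto> q(0)\<close> for the
      perturbed radial product.\<close>
    define K where "K = (\<Sum>s\<in>I. (\<lambda>y. (B0 * e (fst s) (snd s)) * F s y))"
    have K: "K \<in> poly_space n" unfolding K_def using F by (rule sum_mem)
    have bas: "inner_sobolev lam \<mu> (radial_harm j Y) K = radial_harm j Y x"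
      if Y: "Y \<in> sph_harm l" and jl: "2 * j + l \<le> n" for j l Y
    proof -
      have fY: "radial_harm j Y \<in> poly_space n"
        unfolding poly_space_eq using Y jl by (intro radial_harm_polys[of _ l] harm_polys)
      have jm: "j \<le> m l" using jl by (simp add: m_def)
      have "inner_sobolev lam \<mu> (radial_harm j Y) K
          = (\<Sum>s\<in>I. (B0 * e (fst s) (snd s)) * inner_sobolev lam \<mu> (radial_harm j Y) (F s))"
        unfolding K_def by (rule sum_right[OF fY F])
      also have "\<dots> = (\<Sum>k\<le>n. \<Sum>i\<le>m k. (B0 * e k i) * inner_sobolev lam \<mu> (radial_harm j Y) (radial_harm i (Z k)))"
        unfolding I_def F_def by (subst sum.Sigma) (auto simp: case_prod_beta)
      also have "\<dots> = (\<Sum>k\<le>n. if k = l then (\<Sum>i\<le>m l. (B0 * e l i) *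
          inner_sobolev lam \<mu> (radial_harm j Y) (radial_harm i (Z l))) else 0)"
      proof (intro sum.cong refl)
        fix k
        have "inner_sobolev lam \<mu> (radial_harm j Y) (radial_harm i (Z k)) = 0" if "k \<noteq> l" for i
          using inner_sobolev_radial[OF harm_polys[OF Y] harm_polys[OF Z(1)[of k]] \<mu>]
            harm_orthogonal[OF Y Z(1)[of k]] that by simp
        then show "(\<Sum>i\<le>m k. (B0 * e k i) * inner_sobolev lam \<mu> (radial_harm j Y) (radial_harm i (Z k)))
          = (if k = l then (\<Sum>i\<le>m l. (B0 * e l i) *
              inner_sobolev lam \<mu> (radial_harm j Y) (radial_harm i (Z l))) else 0)"
          by simp
      qed
      also have "\<dots> = (\<Sum>i\<le>m l. (B0 * e l i) * inner_sobolev lam \<mu> (radial_harm j Y) (radial_harm i (Z l)))"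
        using jl by simp
      also have "\<dots> = (\<Sum>i\<le>m l. e l i * (Beta (real l + h) (A + real i + real j)
          + lam * B0 * tau l j * tau l i)) * Y x"
      proof -
        have "(B0 * e l i) * inner_sobolev lam \<mu> (radial_harm j Y) (radial_harm i (Z l))
          = e l i * (Beta (real l + h) (A + real i + real j) + lam * B0 * tau l j * tau l i) * Y x" for i
        proof -
          have 1: "(real (l + l) + real CARD('d)) / 2 = real l + h" "\<mu> + real (j + i) + 1 = A + real i + real j"
            by (simp_all add: h_def A_def add_divide_distrib)
          have 2: "Beta (real CARD('d) / 2) (\<mu> + 1) = B0" by (simp add: B0_def h_def A_def)
          show ?thesis
            unfolding inner_sobolev_radial[OF harm_polys[OF Y] harm_polys[OF Z(1)] \<mu>] Z(2)[OF Y] 1 2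
            using B0 by (simp add: distrib_left distrib_right mult_ac)
        qed
        then show ?thesis by (simp only: sum_distrib_right)
      qed
      also have "(\<Sum>i\<le>m l. e l i * (Beta (real l + h) (A + real i + real j) + lam * B0 * tau l j * tau l i))
          = (if j = 0 then 1 else 0)"
      proof -
        have "real l + h \<ge> 1" "lam * B0 \<ge> 0" using h lam B0 by auto
        from sev_moment[OF A this jm, of l] show ?thesis
          by (simp add: e_def distrib_left sum.distrib sum_distrib_left mult_ac)
      qed
      also have "(if j = 0 then 1 else 0) * Y x = radial_harm j Y x"
        using x by (simp add: radial_harm_def power_0_left)
      finally show ?thesis .
    qed
    have "sobolev_kernel lam \<mu> n x x = K x"
      unfolding sobolev_kernel_def
    proof (rule repr_kernel_eqI[OF K])
      fix f :: "real^'d \<Rightarrow> real"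
      assume "f \<in> poly_space n"
      then have "f \<in> fn.span {radial_harm j Y | j k Y. Y \<in> sph_harm k \<and> 2 * j + k \<le> n}"
        by (simp add: poly_space_eq_harm_span harm_span_def)
      then have "f \<in> poly_space n \<and> inner_sobolev lam \<mu> f K = f x"
      proof (induction rule: fn.span_induct_alt)
        case base
        then show ?case using zero_left[OF K] fn.subspace_0[OF subspace] by (simp only: zero_fun_def simp_thms)
      next
        case (step c g f)
        then obtain j l Y where Y: "g = radial_harm j Y" "Y \<in> sph_harm l" "2 * j + l \<le> n" by blast
        then have g: "g \<in> poly_space n"
          unfolding poly_space_eq by (auto intro: radial_harm_polys[of _ l] harm_polys)
        have "inner_sobolev lam \<mu> ((\<lambda>y. c * g y) + f) K = c * g x + f x"
        proof -
          have "inner_sobolev lam \<mu> g K = g x" unfolding Y(1) by (rule bas[OF Y(2,3)])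
          then show ?thesis
            unfolding add_left[OF scale_mem[OF g] conjunct1[OF step(2)] K] scale_left[OF g K]
            using step(2) by simp
        qed
        then show ?case
          using fn.subspace_add[OF subspace scale_mem[OF g, of c] conjunct1[OF step(2)]]
          by (simp only: plus_fun_def simp_thms)
      qed
      then show "inner_sobolev lam \<mu> f K = f x" ..
    qed
    also have "K x = (\<Sum>k\<le>n. \<Sum>i\<le>m k. B0 * e k i * (0 ^ i * Z k x))"
      unfolding K_def sum_fun_apply I_def F_def radial_harm_def using x
      by (subst sum.Sigma) (auto simp: case_prod_beta)
    also have "\<dots> = (\<Sum>k\<le>n. (B0 * Z k x) * e k 0)"
    proof (intro sum.cong refl)
      fix k
      have "(\<Sum>i\<le>m k. B0 * e k i * (0 ^ i * Z k x)) = (\<Sum>i\<le>m k. if i = 0 then B0 * e k 0 * Z k x else 0)"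
        by (intro sum.cong) auto
      then show "(\<Sum>i\<le>m k. B0 * e k i * (0 ^ i * Z k x)) = (B0 * Z k x) * e k 0" by simp
    qed
    finally have "sobolev_kernel lam \<mu> n x x = (\<Sum>k\<le>n. (B0 * Z k x) * e k 0)" .
    moreover have "e k 0 = jker A (real k + h) (m k) * sratio (lam * B0) k A (real k + h) (m k)" for k
      unfolding e_def using h by (intro sev_0 A) auto
    ultimately show ?thesis by (simp only: m_def)
  qed
  then show ?thesis using z B0 by (intro exI[of _ "\<lambda>k. B0 * Z k x"]) (auto simp: B0_def)
qed

section \<open>Asymptotics\<close>

text \<open>Only the sign of \<open>z\<close> and the asymptotics of the full sum are available.
  Where \<open>m\<close> is large the ratio is within \<open>\<epsilon>\<close> of
  \<open>\<rho>\<close>; where it is small the error is at most \<open>\<epsilon>\<close> times the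
  summand of the same \<open>k\<close> for \<open>n + 2 * N\<close>. The latter add up to at most
  \<open>\<epsilon> * S (n + 2 * N)\<close>, which is again controlled by
  \<open>n powr p\<close>.\<close>

lemma weighted_sum_asymp:
  fixes z :: "nat \<Rightarrow> real" and K r :: "nat \<Rightarrow> nat \<Rightarrow> real"
  defines "m \<equiv> \<lambda>n k. (n - k) div 2"
  assumes z: "\<And>k. 0 \<le> z k" and K: "\<And>k m. 0 < K k m"
    and r: "\<And>k m. 0 \<le> r k m" "\<And>k m. r k m \<le> 1" and \<rho>: "0 \<le> \<rho>" "\<rho> \<le> 1"
    and lim: "\<And>\<epsilon>. \<epsilon> > 0 \<Longrightarrow> \<exists>M. \<forall>m\<ge>M. \<forall>k. \<bar>r k m - \<rho>\<bar> < \<epsilon>"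
    and small: "\<And>M \<epsilon>. \<epsilon> > 0 \<Longrightarrow> \<exists>N. \<forall>m\<le>M. \<forall>k. K k m \<le> \<epsilon> * K k (m + N)"
    and L: "(\<lambda>n. (\<Sum>k\<le>n. z k * K k (m n k)) / real n powr p) \<longlonglongrightarrow> l"
  shows "(\<lambda>n. (\<Sum>k\<le>n. z k * (K k (m n k) * r k (m n k))) / real n powr p) \<longlonglongrightarrow> \<rho> * l"
proof -
  define S where "S n = (\<Sum>k\<le>n. z k * K k (m n k))" for n
  define R where "R n = (\<Sum>k\<le>n. z k * (K k (m n k) * r k (m n k)))" for n
  have L: "(\<lambda>n. S n / real n powr p) \<longlonglongrightarrow> l" using L by (simp add: S_def)
  have S0: "S n \<ge> 0" for n
    unfolding S_def using z K by (intro sum_nonneg mult_nonneg_nonneg) (auto intro: less_imp_le)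
  have l0: "l \<ge> 0"
    using L by (rule LIMSEQ_le_const) (auto intro!: divide_nonneg_nonneg S0)
  have bound: "\<exists>N. \<forall>n. \<bar>R n - \<rho> * S n\<bar> \<le> \<epsilon> * S n + \<epsilon> * S (n + 2 * N)" if \<epsilon>: "\<epsilon> > 0" for \<epsilon>
  proof -
    obtain M where M: "\<And>m k. m \<ge> M \<Longrightarrow> \<bar>r k m - \<rho>\<bar> < \<epsilon>" using lim[OF \<epsilon>] by blast
    obtain N where N: "\<And>m k. m \<le> M \<Longrightarrow> K k m \<le> \<epsilon> * K k (m + N)" using small[OF \<epsilon>] by blast
    have "\<bar>R n - \<rho> * S n\<bar> \<le> \<epsilon> * S n + \<epsilon> * S (n + 2 * N)" for n
    proof -
      have summand: "z k * (K k (m n k) * \<bar>r k (m n k) - \<rho>\<bar>)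
          \<le> z k * (\<epsilon> * K k (m n k)) + z k * (\<epsilon> * K k (m (n + 2 * N) k))" if "k \<le> n" for k
      proof -
        \<comment> \<open>Raising \<open>n\<close> by \<open>2 * N\<close> raises \<open>m\<close>
          by exactly \<open>N\<close> for each \<open>k \<le> n\<close>, in step with the index
          shift in \<open>small\<close>.\<close>
        have mN: "m (n + 2 * N) k = m n k + N"
        proof -
          have "n + 2 * N - k = (n - k) + 2 * N" using that by simp
          then show ?thesis by (simp add: m_def)
        qed
        have pos: "0 \<le> \<epsilon> * K k (m n k)" "0 \<le> \<epsilon> * K k (m n k + N)"
          using \<epsilon> K by (simp_all add: less_imp_le)
        have "K k (m n k) * \<bar>r k (m n k) - \<rho>\<bar> \<le> \<epsilon> * K k (m n k) + \<epsilon> * K k (m n k + N)"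
        proof (cases "m n k \<ge> M")
          case True
          have "K k (m n k) * \<bar>r k (m n k) - \<rho>\<bar> \<le> K k (m n k) * \<epsilon>"
            using less_imp_le[OF M[OF True]] less_imp_le[OF K] by (intro mult_left_mono) auto
          then show ?thesis using pos by (simp add: mult.commute)
        next
          case False
          have "\<bar>r k (m n k) - \<rho>\<bar> \<le> 1" using r[of k "m n k"] \<rho> by (simp add: abs_le_iff)
          then have "K k (m n k) * \<bar>r k (m n k) - \<rho>\<bar> \<le> K k (m n k) * 1"
            using less_imp_le[OF K] by (intro mult_left_mono) auto
          then show ?thesis using N[of "m n k" k] False pos by simp
        qed
        from mult_left_mono[OF this z[of k]] show ?thesis by (simp add: mN distrib_left)
      qed
      have "\<bar>R n - \<rho> * S n\<bar> = \<bar>\<Sum>k\<le>n. z k * (K k (m n k) * (r k (m n k) - \<rho>))\<bar>"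
        by (simp add: R_def S_def sum_distrib_left right_diff_distrib sum_subtractf mult_ac)
      also have "\<dots> \<le> (\<Sum>k\<le>n. \<bar>z k * (K k (m n k) * (r k (m n k) - \<rho>))\<bar>)" by (rule sum_abs)
      also have "\<dots> = (\<Sum>k\<le>n. z k * (K k (m n k) * \<bar>r k (m n k) - \<rho>\<bar>))"
        using z K by (simp add: abs_mult less_imp_le)
      also have "\<dots> \<le> (\<Sum>k\<le>n. z k * (\<epsilon> * K k (m n k)) + z k * (\<epsilon> * K k (m (n + 2 * N) k)))"
        by (intro sum_mono summand) simp
      also have "\<dots> = \<epsilon> * S n + \<epsilon> * (\<Sum>k\<le>n. z k * K k (m (n + 2 * N) k))"
        by (simp add: S_def sum.distrib sum_distrib_left mult_ac)
      \<comment> \<open>The sum for \<open>n + 2 * N\<close> has further values of \<open>k\<close>,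
        all with nonnegative terms.\<close>
      also have "(\<Sum>k\<le>n. z k * K k (m (n + 2 * N) k)) \<le> S (n + 2 * N)"
        unfolding S_def using z K by (intro sum_mono2) (auto simp: less_imp_le)
      finally show ?thesis using \<epsilon> by (simp add: mult_left_mono)
    qed
    then show ?thesis by blast
  qed
  have "(\<lambda>n. (R n - \<rho> * S n) / real n powr p) \<longlonglongrightarrow> 0"
  proof (rule tendstoI)
    fix \<delta> :: real
    assume \<delta>: "\<delta> > 0"
    \<comment> \<open>Both quotients by \<open>n powr p\<close> are eventually below
      \<open>l + 1\<close>; the \<open>+ 1\<close> also keeps the denominator positive when
      \<open>l = 0\<close>.\<close>
    define \<epsilon> where "\<epsilon> = \<delta> / (2 * (l + 1))"
    have \<epsilon>: "\<epsilon> > 0" using \<delta> l0 by (simp add: \<epsilon>_def)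
    obtain N where N: "\<And>n. \<bar>R n - \<rho> * S n\<bar> \<le> \<epsilon> * S n + \<epsilon> * S (n + 2 * N)"
      using bound[OF \<epsilon>] by blast
    have "(\<lambda>n. S (n + 2 * N) / real (n + 2 * N) powr p * (real (n + 2 * N) / real n) powr p) \<longlonglongrightarrow> l * 1 powr p"
    proof (intro tendsto_mult tendsto_powr)
      show "(\<lambda>n. S (n + 2 * N) / real (n + 2 * N) powr p) \<longlonglongrightarrow> l"
        using LIMSEQ_ignore_initial_segment[OF L] .
      show "(\<lambda>n. real (n + 2 * N) / real n) \<longlonglongrightarrow> 1" by real_asymp
    qed auto
    then have "(\<lambda>n. S (n + 2 * N) / real (n + 2 * N) powr p * (real (n + 2 * N) / real n) powr p) \<longlonglongrightarrow> l"
      unfolding powr_one_eq_one mult_1_right .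
    then have "(\<lambda>n. S (n + 2 * N) / real n powr p) \<longlonglongrightarrow> l"
    proof (rule Lim_transform_eventually)
      show "\<forall>\<^sub>F n in sequentially. S (n + 2 * N) / real (n + 2 * N) powr p * (real (n + 2 * N) / real n) powr p
          = S (n + 2 * N) / real n powr p"
        using eventually_gt_at_top[of 0]
        by eventually_elim (simp add: powr_divide)
    qed
    then have ev2: "\<forall>\<^sub>F n in sequentially. S (n + 2 * N) / real n powr p < l + 1"
      by (rule order_tendstoD) simp
    have ev1: "\<forall>\<^sub>F n in sequentially. S n / real n powr p < l + 1"
      using L by (rule order_tendstoD) simp
    show "\<forall>\<^sub>F n in sequentially. dist ((R n - \<rho> * S n) / real n powr p) 0 < \<delta>"
      using ev1 ev2 eventually_gt_at_top[of 0]
    proof eventually_elim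
      case (elim n)
      have P: "real n powr p > 0" using elim by simp
      have "\<bar>R n - \<rho> * S n\<bar> / real n powr p \<le> (\<epsilon> * S n + \<epsilon> * S (n + 2 * N)) / real n powr p"
        using N P by (intro divide_right_mono) auto
      also have "\<dots> = \<epsilon> * (S n / real n powr p) + \<epsilon> * (S (n + 2 * N) / real n powr p)"
        by (simp add: add_divide_distrib)
      also have "\<dots> < \<epsilon> * (l + 1) + \<epsilon> * (l + 1)"
        using elim \<epsilon> by (intro add_strict_mono mult_strict_left_mono) auto
      also have "\<dots> = \<epsilon> * (2 * (l + 1))" by (simp add: algebra_simps)
      also have "\<dots> = \<delta>" using l0 by (simp add: \<epsilon>_def)
      finally show ?case using P by (simp add: dist_real_def)
    qed
  qed
  from tendsto_add[OF this tendsto_mult[OF tendsto_const[of \<rho>] L]]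
  show ?thesis by (simp add: R_def diff_divide_distrib)
qed

lemma sobolev_kernel_0: "sobolev_kernel 0 \<mu> n = ball_kernel \<mu> n"
  by (simp add: sobolev_kernel_def ball_kernel_def inner_sobolev_def[abs_def])

lemma sratio_0: "sratio 0 k A B m = 1"
  by (simp add: sratio_def)

lemma ball_kernel_asymp:
  fixes x :: "real^'d::finite"
  assumes \<mu>: "\<mu> > -1" and x: "norm x = 1"
  shows "(\<lambda>n. ball_kernel \<mu> n x x / real n powr (2 * \<mu> + real CARD('d) + 1))
    \<longlonglongrightarrow> 2 / Gamma (2 * \<mu> + real CARD('d) + 2)"
proof -
  define A where "A = \<mu> + (real CARD('d) + 1) / 2"
  have A: "A > 0" unfolding A_def by (rule gegenbauer_index_pos[OF \<mu>])
  have e: "2 * A = 2 * \<mu> + real CARD('d) + 1"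
    "2 * \<mu> + real CARD('d) + 1 + 1 = 2 * \<mu> + real CARD('d) + 2"
    by (simp_all add: A_def add_divide_distrib)
  show ?thesis
    using jker_diagonal_asymp[OF A] unfolding e ball_kernel_boundary[OF \<mu> x, folded A_def] .
qed

lemma sobolev_kernel_asymp:
  fixes x :: "real^'d::finite"
  assumes d: "CARD('d) \<ge> 2" and lam: "lam > 0" and \<mu>: "\<mu> > -1" and x: "norm x = 1"
  shows "(\<lambda>n. sobolev_kernel lam \<mu> n x x / real n powr (2 * \<mu> + real CARD('d) + 1))
    \<longlonglongrightarrow> 1 / (\<mu> + 2)\<^sup>2 * (2 / Gamma (2 * \<mu> + real CARD('d) + 2))"
proof -
  define A where "A = \<mu> + 1"
  define h where "h = real CARD('d) / 2"
  have A: "A > 0" using \<mu> by (simp add: A_def)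
  have h: "h \<ge> 1" using d by (simp add: h_def)
  define Lam where "Lam = lam * Beta h A"
  have Lam: "Lam > 0" unfolding Lam_def using lam A h by (intro mult_pos_pos Beta_real_pos) auto
  obtain z where z: "\<And>k. 0 \<le> z k"
    and ker: "\<And>lam n. lam \<ge> 0 \<Longrightarrow> sobolev_kernel lam \<mu> n x x = (\<Sum>k\<le>n. z k *
      (jker A (real k + h) ((n - k) div 2) * sratio (lam * Beta h A) k A (real k + h) ((n - k) div 2)))"
    using sobolev_kernel_boundary[OF d \<mu> x] unfolding A_def h_def by blast
  have "(\<lambda>n. (\<Sum>k\<le>n. z k * (jker A (real k + h) ((n - k) div 2) *
      sratio Lam k A (real k + h) ((n - k) div 2))) / real n powr (2 * \<mu> + real CARD('d) + 1))
    \<longlonglongrightarrow> 1 / (\<mu> + 2)\<^sup>2 * (2 / Gamma (2 * \<mu> + real CARD('d) + 2))"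
  proof (rule weighted_sum_asymp[where K="\<lambda>k. jker A (real k + h)" and r="\<lambda>k. sratio Lam k A (real k + h)"])
    have B: "real k + h \<ge> 1" for k using h by simp
    show "0 < jker A (real k + h) m" for k m using B[of k] by (intro jker_pos A) linarith
    show "0 \<le> sratio Lam k A (real k + h) m" "sratio Lam k A (real k + h) m \<le> 1" for k m
      using sratio_bounds[OF A B less_imp_le[OF Lam]] by auto
    have "(\<mu> + 2)\<^sup>2 \<ge> 1" using \<mu> by (intro one_le_power) simp
    moreover have "(\<mu> + 2)\<^sup>2 > 0" using \<mu> by simp
    ultimately show "1 / (\<mu> + 2)\<^sup>2 \<le> 1" by (metis divide_le_eq_1_pos)
    show "\<exists>M. \<forall>m\<ge>M. \<forall>k. \<bar>sratio Lam k A (real k + h) m - 1 / (\<mu> + 2)\<^sup>2\<bar> < \<epsilon>" if "\<epsilon> > 0" for \<epsilon>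
      using sratio_limit[OF A h Lam that] by (simp add: A_def add.commute)
    show "\<exists>N. \<forall>m\<le>M. \<forall>k. jker A (real k + h) m \<le> \<epsilon> * jker A (real k + h) (m + N)" if "\<epsilon> > 0" for M \<epsilon>
    proof -
      have "real k + h > 0" for k using B[of k] by linarith
      then show ?thesis using jker_small_index[OF A that, of M] by blast
    qed
    \<comment> \<open>For \<open>lam = 0\<close> every ratio is 1, so this sum is exactly the ball
      kernel at \<open>x\<close>, whose limit is known.\<close>
    show "(\<lambda>n. (\<Sum>k\<le>n. z k * jker A (real k + h) ((n - k) div 2)) / real n powr (2 * \<mu> + real CARD('d) + 1))
      \<longlonglongrightarrow> 2 / Gamma (2 * \<mu> + real CARD('d) + 2)"
      using ball_kernel_asymp[OF \<mu> x] ker[of 0] by (simp add: sobolev_kernel_0 sratio_0)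
  qed (use z in auto)
  then show ?thesis using ker[of lam] lam by (simp add: Lam_def)
qed

theorem theorem6p1:
  fixes x :: "real^'d::finite" and lam \<mu> :: real
  assumes "CARD('d) \<ge> 2" and "lam > 0" and "\<mu> \<ge> -1/2" and "norm x = 1"
  shows "(\<lambda>n. (ball_kernel \<mu> n x x - sobolev_kernel lam \<mu> n x x)
              / real n powr (2 * \<mu> + real CARD('d) + 1))
           \<longlonglongrightarrow> 2 / Gamma (2 * \<mu> + real CARD('d) + 2) * ((\<mu> + 1) * (\<mu> + 3) / (\<mu> + 2)\<^sup>2)
       \<and> (\<lambda>n. sobolev_kernel lam \<mu> n x x / real n powr (2 * \<mu> + real CARD('d) + 1))
           \<longlonglongrightarrow> 2 / (Gamma (2 * \<mu> + real CARD('d) + 2) * (\<mu> + 2)\<^sup>2)"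
proof -
  have \<mu>: "\<mu> > -1" using assms(3) by simp
  define G where "G = Gamma (2 * \<mu> + real CARD('d) + 2)"
  note ball = ball_kernel_asymp[OF \<mu> assms(4), folded G_def]
  note sob = sobolev_kernel_asymp[OF assms(1,2) \<mu> assms(4), folded G_def]
  have "2 / G - 1 / (\<mu> + 2)\<^sup>2 * (2 / G) = 2 / G * (((\<mu> + 2)\<^sup>2 - 1) / (\<mu> + 2)\<^sup>2)"
    using \<mu> by (simp add: diff_divide_distrib right_diff_distrib)
  also have "(\<mu> + 2)\<^sup>2 - 1 = (\<mu> + 1) * (\<mu> + 3)"
    by (simp add: power2_eq_square algebra_simps)
  finally show ?thesis
    using tendsto_diff[OF ball sob] sob unfolding G_def[symmetric]
    by (simp add: diff_divide_distrib mult.commute[of G])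
qed

end
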